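(* Let $(\Phi,\Psi):(\mathtt O',\mathtt M')\to(\mathtt O'',\mathtt M'')$ be a morphism of left operadic modules over unary operadic categories, let $\mathcal P$ be an $\mathtt O''$-operad in graded $R$-modules, $\Phi^*(\mathcal P)$ its restriction along $\Phi$, $\mathcal M$ a $\mathcal P$-module and $\Psi^*(\mathcal M)$ its restriction along $(\Phi,\Psi)$. Then, for each object $M$ of $\mathtt M'$, there exists a natural chain map $$\beta_*(\Phi,\Psi)(M):\beta_*\big(\Phi^*(\mathcal P),\Psi^*(\mathcal M)\big)(M)\longrightarrow\beta_*(\mathcal P,\mathcal M)\big(\Psi(M)\big)$$ of un-normalized bar complexes which commutes with the augmentations to $\Psi^*(\mathcal M)(M)=\mathcal M(\Psi(M))$.
   Context: $R$ is a commutative unital ring. **Unary operadic category.** A category $\mathtt O$ with functors $\mathscr F_S:\mathtt O/S\to\mathtt O$; $\mathrm{Fib}(f):=\mathscr F_S(f)$ for $f:X\to S$, and for $\varphi:X'\to X''$, $f'':X''\to S$, $\varphi_S:\mathrm{Fib}(f''\varphi)\to\mathrm{Fib}(f'')$ is the induced map. Axioms: $\mathrm{Fib}(\varphi_S)=\mathrm{Fib}(\varphi)$, and $(\varphi_T)_{\mathrm{Fib}(c)}=\varphi_S$ for $Y\xrightarrow{\varphi}X\xrightarrow{a}S\xrightarrow{c}T$, where $\varphi_T:\mathrm{Fib}(ca\varphi)\to\mathrm{Fib}(ca)$ is viewed over $\mathrm{Fib}(c)$ via $a_T$. **Left operadic $\mathtt O$-module $\mathtt M$.** A set of objects, for each object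 $L$ and $S\in\mathtt O$ a set of arrows $\alpha:L\to S$, with an associative unital action $(\alpha,g)\mapsto g\alpha$ of morphisms of $\mathtt O$; each arrow $\alpha:L\to S$ has a fiber $\mathrm{Fib}(\alpha)$, an object of $\mathtt M$, and each arrow $\alpha:L\to X$ and morphism $g:X\to S$ induce an arrow $\alpha_S:\mathrm{Fib}(g\alpha)\to\mathrm{Fib}(g)$, with $(h\alpha)_S=h_S\alpha_S$ for morphisms $h$ over $S$, $\mathrm{Fib}(\alpha_S)=\mathrm{Fib}(\alpha)$, and $(\alpha_T)_{\mathrm{Fib}(c)}=\alpha_S$ for $L\xrightarrow{\alpha}X\xrightarrow{a}S\xrightarrow{c}T$. **Morphism** $(\Phi,\Psi):(\mathtt O',\mathtt M')\to(\mathtt O'',\mathtt M'')$: a functor $\Phi:\mathtt O'\to\mathtt O''$, and a rule $\Psi$ sending objects $L$ of $\mathtt M'$ to objects $\Psi(L)$ of $\mathtt M''$ and arrows $\alpha:L\to S$ to arrows $\Psi(\alpha):\Psi(L)\to\Phi(S)$ with $\Psi(f\alpha)=\Phi(f)\Psi(\alpha)$, both commuting with fibers and induced maps of fibers. **Operads and modules.** An $\mathtt O$-operad $\mathcal P$: graded $R$-modules $\mathcal P(A)$, $A\in\mathtt O$, and maps $\gamma_h:\mathcal P(F)\otimes\mathcal P(B)\to\mathcal P(A)$ for $h:A\to B$ with fiber $F$, such that $\gamma_f(\mathrm{id}\otimes\gamma_g)=\gamma_{gf}(\gamma_{f_C}\otimes\mathrm{id})$ for $A\xrightarrow fB\xrightarrow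 gC$. A $\mathcal P$-module $\mathcal M$: graded $R$-modules $\mathcal M(L)$, $L\in\mathtt M$, and maps $\nu_\alpha:\mathcal M(G)\otimes\mathcal P(S)\to\mathcal M(L)$ for $\alpha:L\to S$ with fiber $G$, such that $\nu_\alpha(\mathrm{id}\otimes\gamma_g)=\nu_{g\alpha}(\nu_{\alpha_C}\otimes\mathrm{id})$ for $L\xrightarrow{\alpha}B\xrightarrow gC$. Restrictions: $\Phi^*(\mathcal P)(s):=\mathcal P(\Phi(s))$ for $s\in\mathtt O'$, $\Psi^*(\mathcal M)(m):=\mathcal M(\Psi(m))$ for $m\in\mathtt M'$, with the induced structure operations ($\Psi^*(\mathcal M)$ is a $\Phi^*(\mathcal P)$-module). **Bar complex.** $\beta_n(\mathcal P,\mathcal M)(M):=\bigoplus\mathcal P(T_0)\otimes\mathcal P(F_1)\otimes\cdots\otimes\mathcal P(F_n)\otimes\mathcal M(N)$, the sum over towers $T_0\xleftarrow{f_1}T_1\leftarrow\cdots\xleftarrow{f_n}T_n\xleftarrow{\alpha}M$ with $f_i$ in $\mathtt O$, $\alpha$ an arrow of $\mathtt M$, $F_i=\mathrm{Fib}(f_i)$, $N=\mathrm{Fib}(\alpha)$. The differential is $\partial_n=\sum_{i=0}^n(-1)^id_i$, where on $t_0\otimes p_1\otimes\cdots\otimes p_n\otimes m$ (Koszul sign rule) $d_i$ deletes $T_i$ from the tower and replaces $t_0\otimes p_1$ by $\gamma_{f_1}(p_1,t_0)$ if $i=0$, $p_i\otimes p_{i+1}$ by $\gamma_{(f_{i+1})_{T_{i-1}}}(p_{i+1},p_i)$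 if $0<i<n$, and $p_n\otimes m$ by $\nu_{\alpha_{T_{n-1}}}(m,p_n)$ if $i=n$. The augmentation $\epsilon:\beta_0(\mathcal P,\mathcal M)(M)\to\mathcal M(M)$ is $\epsilon(t_0\otimes m)=\nu_\alpha(m,t_0)$. *)

theory Defs
  imports "HOL-Algebra.Module" "HOL-Algebra.AbelCoset"
begin

section \<open>Linear algebra over a commutative ring\<close>

definition mod_hom ::
  "('r, 'z) ring_scheme \<Rightarrow> ('r, 'u) module \<Rightarrow> ('r, 'v) module \<Rightarrow> ('u \<Rightarrow> 'v) set" where
  "mod_hom R U V = {f \<in> carrier U \<rightarrow> carrier V.
     (\<forall>x\<in>carrier U. \<forall>y\<in>carrier U. f (x \<oplus>\<^bsub>U\<^esub> y) = f x \<oplus>\<^bsub>V\<^esub> f y) \<and>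
     (\<forall>a\<in>carrier R. \<forall>x\<in>carrier U. f (a \<odot>\<^bsub>U\<^esub> x) = a \<odot>\<^bsub>V\<^esub> f x)}"

definition bilinear_map ::
  "('r, 'z) ring_scheme \<Rightarrow> ('r, 'u) module \<Rightarrow> ('r, 'v) module \<Rightarrow> ('r, 'w) module
     \<Rightarrow> ('u \<Rightarrow> 'v \<Rightarrow> 'w) \<Rightarrow> bool" where
  "bilinear_map R U V W b \<longleftrightarrow>
     (\<forall>x\<in>carrier U. b x \<in> mod_hom R V W) \<and>
     (\<forall>y\<in>carrier V. (\<lambda>x. b x y) \<in> mod_hom R U W)"

text \<open>Only the additive group and the scalar multiplication of a \<open>module\<close> record matter; the
  fields \<open>mult\<close> and \<open>one\<close>, inherited from rings, are left unspecified.\<close>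

definition direct_sum :: "'i set \<Rightarrow> ('i \<Rightarrow> ('r, 'v) module) \<Rightarrow> ('r, 'i \<Rightarrow> 'v) module" where
  "direct_sum I M =
     \<lparr>carrier = {x \<in> \<Pi>\<^sub>E i\<in>I. carrier (M i). finite {i \<in> I. x i \<noteq> \<zero>\<^bsub>M i\<^esub>}},
      mult = undefined, one = undefined,
      zero = (\<lambda>i\<in>I. \<zero>\<^bsub>M i\<^esub>),
      add = (\<lambda>x y. \<lambda>i\<in>I. x i \<oplus>\<^bsub>M i\<^esub> y i),
      smult = (\<lambda>a x. \<lambda>i\<in>I. a \<odot>\<^bsub>M i\<^esub> x i)\<rparr>"

definition direct_sum_inj ::
  "'i set \<Rightarrow> ('i \<Rightarrow> ('r, 'v) module) \<Rightarrow> 'i \<Rightarrow> 'v \<Rightarrow> ('i \<Rightarrow> 'v)" where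
  "direct_sum_inj I M i x = (\<lambda>j\<in>I. if j = i then x else \<zero>\<^bsub>M j\<^esub>)"

text \<open>The map out of a direct sum with components \<open>g i\<close>.\<close>

definition direct_sum_ext ::
  "'i set \<Rightarrow> ('i \<Rightarrow> ('r, 'v) module) \<Rightarrow> ('r, 'w) module \<Rightarrow> ('i \<Rightarrow> 'v \<Rightarrow> 'w)
     \<Rightarrow> ('i \<Rightarrow> 'v) \<Rightarrow> 'w" where
  "direct_sum_ext I M N g x = (\<Oplus>\<^bsub>N\<^esub> i \<in> {i \<in> I. x i \<noteq> \<zero>\<^bsub>M i\<^esub>}. g i (x i))"

definition regular_module :: "('r, 'z) ring_scheme \<Rightarrow> ('r, 'r) module" where
  "regular_module R =
     \<lparr>carrier = carrier R, mult = undefined, one = undefined,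
      zero = \<zero>\<^bsub>R\<^esub>, add = add R, smult = mult R\<rparr>"

definition free_module :: "('r, 'z) ring_scheme \<Rightarrow> 's set \<Rightarrow> ('r, 's \<Rightarrow> 'r) module" where
  "free_module R S = direct_sum S (\<lambda>_. regular_module R)"

definition free_basis :: "('r, 'z) ring_scheme \<Rightarrow> 's set \<Rightarrow> 's \<Rightarrow> ('s \<Rightarrow> 'r)" where
  "free_basis R S s = direct_sum_inj S (\<lambda>_. regular_module R) s \<one>\<^bsub>R\<^esub>"

definition submodule_span ::
  "('r, 'z) ring_scheme \<Rightarrow> ('r, 'v) module \<Rightarrow> 'v set \<Rightarrow> 'v set" where
  "submodule_span R M A = \<Inter>{H. submodule H R M \<and> A \<subseteq> H}"

definition quotient_module :: "('r, 'v) module \<Rightarrow> 'v set \<Rightarrow> ('r, 'v set) module" where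
  "quotient_module M H =
     \<lparr>carrier = a_rcosets\<^bsub>M\<^esub> H, mult = undefined, one = undefined,
      zero = H, add = set_add M,
      smult = (\<lambda>a K. \<Union>x\<in>K. H +>\<^bsub>M\<^esub> (a \<odot>\<^bsub>M\<^esub> x))\<rparr>"

text \<open>The tensor product over \<open>R\<close> of a finite list of modules: the free module on the product
  of the carriers modulo the relations of multilinearity.\<close>

definition tensor_gens :: "('r, 'v) module list \<Rightarrow> 'v list set" where
  "tensor_gens Ms = listset (map carrier Ms)"

definition tensor_rels ::
  "('r, 'z) ring_scheme \<Rightarrow> ('r, 'v) module list \<Rightarrow> ('v list \<Rightarrow> 'r) set" where
  "tensor_rels R Ms =
     (let F = free_module R (tensor_gens Ms); e = free_basis R (tensor_gens Ms) in
      {e (vs[i := x \<oplus>\<^bsub>Ms ! i\<^esub> y]) \<ominus>\<^bsub>F\<^esub> (e (vs[i := x]) \<oplus>\<^bsub>F\<^esub> e (vs[i := y])) | vs i x y.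
         vs \<in> tensor_gens Ms \<and> i < length Ms \<and> x \<in> carrier (Ms ! i) \<and> y \<in> carrier (Ms ! i)} \<union>
      {e (vs[i := a \<odot>\<^bsub>Ms ! i\<^esub> x]) \<ominus>\<^bsub>F\<^esub> a \<odot>\<^bsub>F\<^esub> e (vs[i := x]) | vs i a x.
         vs \<in> tensor_gens Ms \<and> i < length Ms \<and> a \<in> carrier R \<and> x \<in> carrier (Ms ! i)})"

definition tensor_ker ::
  "('r, 'z) ring_scheme \<Rightarrow> ('r, 'v) module list \<Rightarrow> ('v list \<Rightarrow> 'r) set" where
  "tensor_ker R Ms = submodule_span R (free_module R (tensor_gens Ms)) (tensor_rels R Ms)"

definition tensor ::
  "('r, 'z) ring_scheme \<Rightarrow> ('r, 'v) module list \<Rightarrow> ('r, ('v list \<Rightarrow> 'r) set) module" where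
  "tensor R Ms = quotient_module (free_module R (tensor_gens Ms)) (tensor_ker R Ms)"

definition pure_tensor ::
  "('r, 'z) ring_scheme \<Rightarrow> ('r, 'v) module list \<Rightarrow> 'v list \<Rightarrow> ('v list \<Rightarrow> 'r) set" where
  "pure_tensor R Ms vs =
     tensor_ker R Ms +>\<^bsub>free_module R (tensor_gens Ms)\<^esub> free_basis R (tensor_gens Ms) vs"

text \<open>The linear map out of a tensor product with prescribed value \<open>g vs\<close> on the pure tensor of
  \<open>vs\<close>. For \<open>g\<close> multilinear the choice of the representative is immaterial.\<close>

definition tensor_ext ::
  "('r, 'z) ring_scheme \<Rightarrow> ('r, 'v) module list \<Rightarrow> ('r, 'w) module \<Rightarrow> ('v list \<Rightarrow> 'w)
     \<Rightarrow> ('v list \<Rightarrow> 'r) set \<Rightarrow> 'w" where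
  "tensor_ext R Ms N g K =
     direct_sum_ext (tensor_gens Ms) (\<lambda>_. regular_module R) N (\<lambda>vs a. a \<odot>\<^bsub>N\<^esub> g vs) (SOME c. c \<in> K)"


section \<open>Graded modules and complexes\<close>

type_synonym ('r, 'v) graded = "int \<Rightarrow> ('r, 'v) module"

definition degree_lists :: "nat \<Rightarrow> int \<Rightarrow> int list set" where
  "degree_lists k d = {ds. length ds = k \<and> sum_list ds = d}"

definition homog_parts :: "('r, 'v) graded list \<Rightarrow> int list \<Rightarrow> ('r, 'v) module list" where
  "homog_parts As ds = map2 (\<lambda>A e. A e) As ds"

definition graded_tensor ::
  "('r, 'z) ring_scheme \<Rightarrow> ('r, 'v) graded list
     \<Rightarrow> ('r, int list \<Rightarrow> ('v list \<Rightarrow> 'r) set) graded" where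
  "graded_tensor R As d =
     direct_sum (degree_lists (length As) d) (\<lambda>ds. tensor R (homog_parts As ds))"

definition minus_one_power :: "('r, 'z) ring_scheme \<Rightarrow> nat \<Rightarrow> 'r" where
  "minus_one_power R i = (\<ominus>\<^bsub>R\<^esub> \<one>\<^bsub>R\<^esub>) [^]\<^bsub>R\<^esub> i"

text \<open>The sign of interchanging two neighbours of degrees \<open>a\<close> and \<open>b\<close>.\<close>

definition koszul_sign :: "('r, 'z) ring_scheme \<Rightarrow> int \<Rightarrow> int \<Rightarrow> 'r" where
  "koszul_sign R a b = (if odd a \<and> odd b then \<ominus>\<^bsub>R\<^esub> \<one>\<^bsub>R\<^esub> else \<one>\<^bsub>R\<^esub>)"

text \<open>In a complex \<open>K\<close> of graded modules, \<open>chains K n d\<close> is the part of internal degree \<open>d\<close> of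
  \<open>K\<^sub>n\<close>, and \<open>bdry K n d\<close> is the differential from \<open>K\<^sub>n\<close> to \<open>K\<^sub>n\<^sub>-\<^sub>1\<close>, which is used only for \<open>n > 0\<close>.\<close>

record ('r, 'e) graded_complex =
  chains :: "nat \<Rightarrow> ('r, 'e) graded"
  bdry :: "nat \<Rightarrow> int \<Rightarrow> 'e \<Rightarrow> 'e"

definition chain_complex ::
  "('r, 'z) ring_scheme \<Rightarrow> ('r, 'e) graded_complex \<Rightarrow> bool" where
  "chain_complex R K \<longleftrightarrow>
     (\<forall>n d. module R (chains K n d)) \<and>
     (\<forall>n d. bdry K (Suc n) d \<in> mod_hom R (chains K (Suc n) d) (chains K n d)) \<and>
     (\<forall>n d. \<forall>x\<in>carrier (chains K (Suc (Suc n)) d).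
        bdry K (Suc n) d (bdry K (Suc (Suc n)) d x) = \<zero>\<^bsub>chains K n d\<^esub>)"

definition chain_map ::
  "('r, 'z) ring_scheme \<Rightarrow> ('r, 'e) graded_complex \<Rightarrow> ('r, 'f) graded_complex
     \<Rightarrow> (nat \<Rightarrow> int \<Rightarrow> 'e \<Rightarrow> 'f) \<Rightarrow> bool" where
  "chain_map R K L f \<longleftrightarrow>
     chain_complex R K \<and> chain_complex R L \<and>
     (\<forall>n d. f n d \<in> mod_hom R (chains K n d) (chains L n d)) \<and>
     (\<forall>n d. \<forall>x\<in>carrier (chains K (Suc n) d).
        f n d (bdry K (Suc n) d x) = bdry L (Suc n) d (f (Suc n) d x))"


section \<open>Unary operadic categories and left operadic modules\<close>

text \<open>For \<open>f : X \<rightarrow> S\<close>, \<open>fib f\<close> is the value of the fiber functor of \<open>S\<close> at \<open>f\<close>; and for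
  \<open>\<phi> : X' \<rightarrow> X''\<close> and \<open>f'' : X'' \<rightarrow> S\<close>, \<open>ind \<phi> f''\<close> is its value \<open>\<phi>\<^sub>S\<close> at the morphism \<open>\<phi>\<close> from
  \<open>f'' \<phi>\<close> to \<open>f''\<close>.\<close>

record ('o, 'h) operadic_cat =
  obj :: "'o set"
  arr :: "'h set"
  dom :: "'h \<Rightarrow> 'o"
  cod :: "'h \<Rightarrow> 'o"
  idn :: "'o \<Rightarrow> 'h"
  cmp :: "'h \<Rightarrow> 'h \<Rightarrow> 'h" (infixr \<open>\<cdot>\<index>\<close> 70)
  fib :: "'h \<Rightarrow> 'o"
  ind :: "'h \<Rightarrow> 'h \<Rightarrow> 'h"

definition homs :: "('o, 'h) operadic_cat \<Rightarrow> 'o \<Rightarrow> 'o \<Rightarrow> 'h set" where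
  "homs C X Y = {f \<in> arr C. dom C f = X \<and> cod C f = Y}"

locale unary_operadic_category =
  fixes C :: "('o, 'h) operadic_cat" (structure)
  assumes dom_obj: "f \<in> arr C \<Longrightarrow> dom C f \<in> obj C"
    and cod_obj: "f \<in> arr C \<Longrightarrow> cod C f \<in> obj C"
    and idn_hom: "X \<in> obj C \<Longrightarrow> idn C X \<in> homs C X X"
    and cmp_hom: "\<lbrakk>f \<in> homs C X Y; g \<in> homs C Y Z\<rbrakk> \<Longrightarrow> g \<cdot> f \<in> homs C X Z"
    and cmp_idn: "f \<in> homs C X Y \<Longrightarrow> f \<cdot> idn C X = f"
    and idn_cmp: "f \<in> homs C X Y \<Longrightarrow> idn C Y \<cdot> f = f"
    and cmp_assoc: "\<lbrakk>f \<in> homs C W X; g \<in> homs C X Y; h \<in> homs C Y Z\<rbrakk>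
      \<Longrightarrow> (h \<cdot> g) \<cdot> f = h \<cdot> (g \<cdot> f)"
    and fib_obj: "f \<in> arr C \<Longrightarrow> fib C f \<in> obj C"
    and ind_hom: "\<lbrakk>\<phi> \<in> homs C X' X''; f \<in> homs C X'' S\<rbrakk>
      \<Longrightarrow> ind C \<phi> f \<in> homs C (fib C (f \<cdot> \<phi>)) (fib C f)"
    and ind_idn: "f \<in> homs C X S \<Longrightarrow> ind C (idn C X) f = idn C (fib C f)"
    and ind_cmp: "\<lbrakk>\<phi> \<in> homs C X Y; \<psi> \<in> homs C Y Z; f \<in> homs C Z S\<rbrakk>
      \<Longrightarrow> ind C (\<psi> \<cdot> \<phi>) f = ind C \<psi> f \<cdot> ind C \<phi> (f \<cdot> \<psi>)"
    and fib_ind: "\<lbrakk>\<phi> \<in> homs C X' X''; f \<in> homs C X'' S\<rbrakk>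
      \<Longrightarrow> fib C (ind C \<phi> f) = fib C \<phi>"
    and ind_ind: "\<lbrakk>\<phi> \<in> homs C Y X; a \<in> homs C X S; c \<in> homs C S T\<rbrakk>
      \<Longrightarrow> ind C (ind C \<phi> (c \<cdot> a)) (ind C a c) = ind C \<phi> a"

text \<open>For \<open>\<alpha> : L \<rightarrow> X\<close> and \<open>g : X \<rightarrow> S\<close>, \<open>act g \<alpha>\<close> is the arrow \<open>g \<alpha> : L \<rightarrow> S\<close> and
  \<open>lind \<alpha> g\<close> is the induced arrow \<open>\<alpha>\<^sub>S : Fib(g \<alpha>) \<rightarrow> Fib(g)\<close>.\<close>

record ('o, 'h, 'l, 'a) left_operadic_mod =
  lobj :: "'l set"
  larr :: "'a set"
  lsrc :: "'a \<Rightarrow> 'l"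
  ltgt :: "'a \<Rightarrow> 'o"
  act :: "'h \<Rightarrow> 'a \<Rightarrow> 'a"
  lfib :: "'a \<Rightarrow> 'l"
  lind :: "'a \<Rightarrow> 'h \<Rightarrow> 'a"

definition larrs :: "('o, 'h, 'l, 'a) left_operadic_mod \<Rightarrow> 'l \<Rightarrow> 'o \<Rightarrow> 'a set" where
  "larrs M L S = {\<alpha> \<in> larr M. lsrc M \<alpha> = L \<and> ltgt M \<alpha> = S}"

locale left_operadic_module = unary_operadic_category C
  for C :: "('o, 'h) operadic_cat" (structure) +
  fixes M :: "('o, 'h, 'l, 'a) left_operadic_mod"
  assumes lsrc_obj: "\<alpha> \<in> larr M \<Longrightarrow> lsrc M \<alpha> \<in> lobj M"
    and ltgt_obj: "\<alpha> \<in> larr M \<Longrightarrow> ltgt M \<alpha> \<in> obj C"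
    and act_larr: "\<lbrakk>\<alpha> \<in> larrs M L X; g \<in> homs C X S\<rbrakk> \<Longrightarrow> act M g \<alpha> \<in> larrs M L S"
    and act_idn: "\<alpha> \<in> larrs M L S \<Longrightarrow> act M (idn C S) \<alpha> = \<alpha>"
    and act_cmp: "\<lbrakk>\<alpha> \<in> larrs M L X; g \<in> homs C X Y; h \<in> homs C Y Z\<rbrakk>
      \<Longrightarrow> act M (h \<cdot> g) \<alpha> = act M h (act M g \<alpha>)"
    and lfib_obj: "\<alpha> \<in> larr M \<Longrightarrow> lfib M \<alpha> \<in> lobj M"
    and lind_larr: "\<lbrakk>\<alpha> \<in> larrs M L X; g \<in> homs C X S\<rbrakk>
      \<Longrightarrow> lind M \<alpha> g \<in> larrs M (lfib M (act M g \<alpha>)) (fib C g)"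
    and lind_act: "\<lbrakk>\<alpha> \<in> larrs M L X'; h \<in> homs C X' X; g \<in> homs C X S\<rbrakk>
      \<Longrightarrow> lind M (act M h \<alpha>) g = act M (ind C h g) (lind M \<alpha> (g \<cdot> h))"
    and lfib_lind: "\<lbrakk>\<alpha> \<in> larrs M L X; g \<in> homs C X S\<rbrakk> \<Longrightarrow> lfib M (lind M \<alpha> g) = lfib M \<alpha>"
    and lind_lind: "\<lbrakk>\<alpha> \<in> larrs M L X; a \<in> homs C X S; c \<in> homs C S T\<rbrakk>
      \<Longrightarrow> lind M (lind M \<alpha> (c \<cdot> a)) (ind C a c) = lind M \<alpha> a"

locale operadic_module_morphism =
  source: left_operadic_module C M + target: left_operadic_module C' M'
  for C :: "('o, 'h) operadic_cat" and M :: "('o, 'h, 'l, 'a) left_operadic_mod"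
    and C' :: "('o2, 'h2) operadic_cat" and M' :: "('o2, 'h2, 'l2, 'a2) left_operadic_mod" +
  fixes \<Phi>o :: "'o \<Rightarrow> 'o2" and \<Phi>a :: "'h \<Rightarrow> 'h2" and \<Psi>o :: "'l \<Rightarrow> 'l2" and \<Psi>a :: "'a \<Rightarrow> 'a2"
  assumes \<Phi>_obj: "X \<in> obj C \<Longrightarrow> \<Phi>o X \<in> obj C'"
    and \<Phi>_hom: "f \<in> homs C X Y \<Longrightarrow> \<Phi>a f \<in> homs C' (\<Phi>o X) (\<Phi>o Y)"
    and \<Phi>_idn: "X \<in> obj C \<Longrightarrow> \<Phi>a (idn C X) = idn C' (\<Phi>o X)"
    and \<Phi>_cmp: "\<lbrakk>f \<in> homs C X Y; g \<in> homs C Y Z\<rbrakk> \<Longrightarrow> \<Phi>a (g \<cdot>\<^bsub>C\<^esub> f) = \<Phi>a g \<cdot>\<^bsub>C'\<^esub> \<Phi>a f"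
    and \<Phi>_fib: "f \<in> arr C \<Longrightarrow> \<Phi>o (fib C f) = fib C' (\<Phi>a f)"
    and \<Phi>_ind: "\<lbrakk>\<phi> \<in> homs C X' X''; f \<in> homs C X'' S\<rbrakk>
      \<Longrightarrow> \<Phi>a (ind C \<phi> f) = ind C' (\<Phi>a \<phi>) (\<Phi>a f)"
    and \<Psi>_obj: "L \<in> lobj M \<Longrightarrow> \<Psi>o L \<in> lobj M'"
    and \<Psi>_larr: "\<alpha> \<in> larrs M L S \<Longrightarrow> \<Psi>a \<alpha> \<in> larrs M' (\<Psi>o L) (\<Phi>o S)"
    and \<Psi>_act: "\<lbrakk>\<alpha> \<in> larrs M L X; f \<in> homs C X S\<rbrakk>
      \<Longrightarrow> \<Psi>a (act M f \<alpha>) = act M' (\<Phi>a f) (\<Psi>a \<alpha>)"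
    and \<Psi>_lfib: "\<alpha> \<in> larr M \<Longrightarrow> \<Psi>o (lfib M \<alpha>) = lfib M' (\<Psi>a \<alpha>)"
    and \<Psi>_lind: "\<lbrakk>\<alpha> \<in> larrs M L X; g \<in> homs C X S\<rbrakk>
      \<Longrightarrow> \<Psi>a (lind M \<alpha> g) = lind M' (\<Psi>a \<alpha>) (\<Phi>a g)"


section \<open>Operads and their modules\<close>

text \<open>A map out of a tensor product of two graded modules is given by its bilinear components:
  \<open>gam P h i j\<close> is the component of \<open>\<gamma>\<^sub>h\<close> on \<open>P(F)\<^sub>i \<otimes> P(B)\<^sub>j\<close> and \<open>nu X \<alpha> i j\<close> that of
  \<open>\<nu>\<^sub>\<alpha>\<close> on \<open>X(G)\<^sub>i \<otimes> P(S)\<^sub>j\<close>. Both have degree 0 and the associativity laws do not permute any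
  factors, so no Koszul sign occurs in them.\<close>

record ('o, 'h, 'r, 'v) operad_data =
  omod :: "'o \<Rightarrow> ('r, 'v) graded"
  gam :: "'h \<Rightarrow> int \<Rightarrow> int \<Rightarrow> 'v \<Rightarrow> 'v \<Rightarrow> 'v"

record ('l, 'a, 'r, 'v) opmod_data =
  mmod :: "'l \<Rightarrow> ('r, 'v) graded"
  nu :: "'a \<Rightarrow> int \<Rightarrow> int \<Rightarrow> 'v \<Rightarrow> 'v \<Rightarrow> 'v"

definition operad ::
  "('r, 'z) ring_scheme \<Rightarrow> ('o, 'h) operadic_cat \<Rightarrow> ('o, 'h, 'r, 'v) operad_data \<Rightarrow> bool" where
  "operad R C P \<longleftrightarrow>
     (\<forall>A\<in>obj C. \<forall>d. module R (omod P A d)) \<and>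
     (\<forall>A B. \<forall>h\<in>homs C A B. \<forall>i j.
        bilinear_map R (omod P (fib C h) i) (omod P B j) (omod P A (i + j)) (gam P h i j)) \<and>
     (\<forall>A B D. \<forall>f\<in>homs C A B. \<forall>g\<in>homs C B D. \<forall>i j k.
        \<forall>x\<in>carrier (omod P (fib C f) i). \<forall>y\<in>carrier (omod P (fib C g) j).
        \<forall>z\<in>carrier (omod P D k).
          gam P f i (j + k) x (gam P g j k y z)
            = gam P (g \<cdot>\<^bsub>C\<^esub> f) (i + j) k (gam P (ind C f g) i j x y) z)"

definition operad_module ::
  "('r, 'z) ring_scheme \<Rightarrow> ('o, 'h) operadic_cat \<Rightarrow> ('o, 'h, 'l, 'a) left_operadic_mod
     \<Rightarrow> ('o, 'h, 'r, 'v) operad_data \<Rightarrow> ('l, 'a, 'r, 'v) opmod_data \<Rightarrow> bool" where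
  "operad_module R C M P X \<longleftrightarrow>
     (\<forall>L\<in>lobj M. \<forall>d. module R (mmod X L d)) \<and>
     (\<forall>L S. \<forall>\<alpha>\<in>larrs M L S. \<forall>i j.
        bilinear_map R (mmod X (lfib M \<alpha>) i) (omod P S j) (mmod X L (i + j)) (nu X \<alpha> i j)) \<and>
     (\<forall>L B D. \<forall>\<alpha>\<in>larrs M L B. \<forall>g\<in>homs C B D. \<forall>i j k.
        \<forall>x\<in>carrier (mmod X (lfib M \<alpha>) i). \<forall>y\<in>carrier (omod P (fib C g) j).
        \<forall>z\<in>carrier (omod P D k).
          nu X \<alpha> i (j + k) x (gam P g j k y z)
            = nu X (act M g \<alpha>) (i + j) k (nu X (lind M \<alpha> g) i j x y) z)"

definition restrict_operad ::
  "('o \<Rightarrow> 'o2) \<Rightarrow> ('h \<Rightarrow> 'h2) \<Rightarrow> ('o2, 'h2, 'r, 'v) operad_data \<Rightarrow> ('o, 'h, 'r, 'v) operad_data"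
  where
  "restrict_operad \<Phi>o \<Phi>a P = \<lparr>omod = (\<lambda>s. omod P (\<Phi>o s)), gam = (\<lambda>h. gam P (\<Phi>a h))\<rparr>"

definition restrict_module ::
  "('l \<Rightarrow> 'l2) \<Rightarrow> ('a \<Rightarrow> 'a2) \<Rightarrow> ('l2, 'a2, 'r, 'v) opmod_data \<Rightarrow> ('l, 'a, 'r, 'v) opmod_data"
  where
  "restrict_module \<Psi>o \<Psi>a X = \<lparr>mmod = (\<lambda>m. mmod X (\<Psi>o m)), nu = (\<lambda>\<alpha>. nu X (\<Psi>a \<alpha>))\<rparr>"

definition operad_map ::
  "('r, 'z) ring_scheme \<Rightarrow> ('o, 'h) operadic_cat \<Rightarrow> ('o, 'h, 'r, 'v) operad_data
     \<Rightarrow> ('o, 'h, 'r, 'v) operad_data \<Rightarrow> ('o \<Rightarrow> int \<Rightarrow> 'v \<Rightarrow> 'v) \<Rightarrow> bool" where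
  "operad_map R C P Q \<theta> \<longleftrightarrow>
     (\<forall>A\<in>obj C. \<forall>d. \<theta> A d \<in> mod_hom R (omod P A d) (omod Q A d)) \<and>
     (\<forall>A B. \<forall>h\<in>homs C A B. \<forall>i j.
        \<forall>x\<in>carrier (omod P (fib C h) i). \<forall>y\<in>carrier (omod P B j).
          \<theta> A (i + j) (gam P h i j x y) = gam Q h i j (\<theta> (fib C h) i x) (\<theta> B j y))"

definition operad_module_map ::
  "('r, 'z) ring_scheme \<Rightarrow> ('o, 'h, 'l, 'a) left_operadic_mod
     \<Rightarrow> ('o, 'h, 'r, 'v) operad_data \<Rightarrow> ('l, 'a, 'r, 'v) opmod_data
     \<Rightarrow> ('l, 'a, 'r, 'v) opmod_data
     \<Rightarrow> ('o \<Rightarrow> int \<Rightarrow> 'v \<Rightarrow> 'v) \<Rightarrow> ('l \<Rightarrow> int \<Rightarrow> 'v \<Rightarrow> 'v) \<Rightarrow> bool" where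
  "operad_module_map R M P X Y \<theta> \<eta> \<longleftrightarrow>
     (\<forall>L\<in>lobj M. \<forall>d. \<eta> L d \<in> mod_hom R (mmod X L d) (mmod Y L d)) \<and>
     (\<forall>L S. \<forall>\<alpha>\<in>larrs M L S. \<forall>i j.
        \<forall>x\<in>carrier (mmod X (lfib M \<alpha>) i). \<forall>y\<in>carrier (omod P S j).
          \<eta> L (i + j) (nu X \<alpha> i j x y) = nu Y \<alpha> i j (\<eta> (lfib M \<alpha>) i x) (\<theta> S j y))"


section \<open>The un-normalized bar complex\<close>

text \<open>The tower \<open>T\<^sub>0 \<leftarrow> T\<^sub>1 \<leftarrow> \<dots> \<leftarrow> T\<^sub>n \<leftarrow> L\<close> is the triple of the list \<open>[T\<^sub>0, \<dots>, T\<^sub>n]\<close>, the list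
  \<open>[f\<^sub>1, \<dots>, f\<^sub>n]\<close> and \<open>\<alpha>\<close>; thus \<open>fs ! i\<close> is \<open>f\<^sub>i\<^sub>+\<^sub>1\<close>.\<close>

type_synonym ('o, 'h, 'a) tower = "'o list \<times> 'h list \<times> 'a"

definition towers ::
  "('o, 'h) operadic_cat \<Rightarrow> ('o, 'h, 'l, 'a) left_operadic_mod \<Rightarrow> 'l \<Rightarrow> nat
     \<Rightarrow> ('o, 'h, 'a) tower set" where
  "towers C M L n = {(Ts, fs, \<alpha>).
     length Ts = Suc n \<and> length fs = n \<and> set Ts \<subseteq> obj C \<and>
     (\<forall>i<n. fs ! i \<in> homs C (Ts ! Suc i) (Ts ! i)) \<and> \<alpha> \<in> larrs M L (Ts ! n)}"

definition map_tower ::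
  "('o \<Rightarrow> 'o2) \<Rightarrow> ('h \<Rightarrow> 'h2) \<Rightarrow> ('a \<Rightarrow> 'a2) \<Rightarrow> ('o, 'h, 'a) tower \<Rightarrow> ('o2, 'h2, 'a2) tower"
  where
  "map_tower \<Phi>o \<Phi>a \<Psi>a = (\<lambda>(Ts, fs, \<alpha>). (map \<Phi>o Ts, map \<Phi>a fs, \<Psi>a \<alpha>))"

text \<open>The list of the values of \<open>p\<close> at \<open>T\<^sub>0, F\<^sub>1, \<dots>, F\<^sub>n\<close>, followed by the value of \<open>x\<close> at \<open>N\<close>.\<close>

definition tower_factors ::
  "('o, 'h) operadic_cat \<Rightarrow> ('o, 'h, 'l, 'a) left_operadic_mod \<Rightarrow> ('o \<Rightarrow> 'c) \<Rightarrow> ('l \<Rightarrow> 'c)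
     \<Rightarrow> ('o, 'h, 'a) tower \<Rightarrow> 'c list" where
  "tower_factors C M p x = (\<lambda>(Ts, fs, \<alpha>). p (hd Ts) # map (\<lambda>f. p (fib C f)) fs @ [x (lfib M \<alpha>)])"

abbreviation bar_factors where
  "bar_factors C M P X \<tau> \<equiv> tower_factors C M (omod P) (mmod X) \<tau>"

type_synonym ('o, 'h, 'a, 'r, 'v) bar_elt =
  "('o, 'h, 'a) tower \<Rightarrow> int list \<Rightarrow> ('v list \<Rightarrow> 'r) set"

definition bar_module ::
  "('r, 'z) ring_scheme \<Rightarrow> ('o, 'h) operadic_cat \<Rightarrow> ('o, 'h, 'l, 'a) left_operadic_mod
     \<Rightarrow> ('o, 'h, 'r, 'v) operad_data \<Rightarrow> ('l, 'a, 'r, 'v) opmod_data \<Rightarrow> 'l \<Rightarrow> nat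
     \<Rightarrow> ('r, ('o, 'h, 'a, 'r, 'v) bar_elt) graded" where
  "bar_module R C M P X L n d =
     direct_sum (towers C M L n) (\<lambda>\<tau>. graded_tensor R (bar_factors C M P X \<tau>) d)"

text \<open>The generator \<open>t\<^sub>0 \<otimes> p\<^sub>1 \<otimes> \<dots> \<otimes> p\<^sub>n \<otimes> m\<close> in the summand of the tower \<open>\<tau>\<close>, where
  \<open>vs = [t\<^sub>0, p\<^sub>1, \<dots>, p\<^sub>n, m]\<close> and \<open>ds\<close> is the list of the degrees of these elements.\<close>

definition bar_gen ::
  "('r, 'z) ring_scheme \<Rightarrow> ('o, 'h) operadic_cat \<Rightarrow> ('o, 'h, 'l, 'a) left_operadic_mod
     \<Rightarrow> ('o, 'h, 'r, 'v) operad_data \<Rightarrow> ('l, 'a, 'r, 'v) opmod_data \<Rightarrow> 'l \<Rightarrow> nat \<Rightarrow> int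
     \<Rightarrow> ('o, 'h, 'a) tower \<Rightarrow> int list \<Rightarrow> 'v list \<Rightarrow> ('o, 'h, 'a, 'r, 'v) bar_elt" where
  "bar_gen R C M P X L n d \<tau> ds vs =
     direct_sum_inj (towers C M L n) (\<lambda>\<tau>. graded_tensor R (bar_factors C M P X \<tau>) d) \<tau>
       (direct_sum_inj (degree_lists (n + 2) d)
          (\<lambda>ds. tensor R (homog_parts (bar_factors C M P X \<tau>) ds)) ds
          (pure_tensor R (homog_parts (bar_factors C M P X \<tau>) ds) vs))"

text \<open>The linear map to \<open>N\<close> with prescribed values \<open>g \<tau> ds vs\<close> on these generators.\<close>

definition bar_ext ::
  "('r, 'z) ring_scheme \<Rightarrow> ('o, 'h) operadic_cat \<Rightarrow> ('o, 'h, 'l, 'a) left_operadic_mod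
     \<Rightarrow> ('o, 'h, 'r, 'v) operad_data \<Rightarrow> ('l, 'a, 'r, 'v) opmod_data \<Rightarrow> 'l \<Rightarrow> nat \<Rightarrow> int
     \<Rightarrow> ('r, 'w) module \<Rightarrow> (('o, 'h, 'a) tower \<Rightarrow> int list \<Rightarrow> 'v list \<Rightarrow> 'w)
     \<Rightarrow> ('o, 'h, 'a, 'r, 'v) bar_elt \<Rightarrow> 'w" where
  "bar_ext R C M P X L n d N g =
     direct_sum_ext (towers C M L n) (\<lambda>\<tau>. graded_tensor R (bar_factors C M P X \<tau>) d) N
       (\<lambda>\<tau>. direct_sum_ext (degree_lists (n + 2) d)
          (\<lambda>ds. tensor R (homog_parts (bar_factors C M P X \<tau>) ds)) N
          (\<lambda>ds. tensor_ext R (homog_parts (bar_factors C M P X \<tau>) ds) N (g \<tau> ds)))"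

text \<open>Deletion of \<open>T\<^sub>i\<close>, for towers with \<open>n > 0\<close>.\<close>

definition del_tower ::
  "('o, 'h) operadic_cat \<Rightarrow> ('o, 'h, 'l, 'a) left_operadic_mod \<Rightarrow> nat
     \<Rightarrow> ('o, 'h, 'a) tower \<Rightarrow> ('o, 'h, 'a) tower" where
  "del_tower C M i = (\<lambda>(Ts, fs, \<alpha>).
     (take i Ts @ drop (Suc i) Ts,
      if i = 0 then tl fs
      else if i < length fs then take (i - 1) fs @ [fs ! (i - 1) \<cdot>\<^bsub>C\<^esub> fs ! i] @ drop (Suc i) fs
      else butlast fs,
      if i = length fs then act M (last fs) \<alpha> else \<alpha>))"

text \<open>The structure operation used by the \<open>i\<close>-th face, applied to the neighbouring factors
  \<open>u\<close> of degree \<open>a\<close> and \<open>w\<close> of degree \<open>b\<close> in positions \<open>i\<close> and \<open>i + 1\<close>.\<close>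

definition face_op ::
  "('o, 'h) operadic_cat \<Rightarrow> ('o, 'h, 'l, 'a) left_operadic_mod
     \<Rightarrow> ('o, 'h, 'r, 'v) operad_data \<Rightarrow> ('l, 'a, 'r, 'v) opmod_data
     \<Rightarrow> nat \<Rightarrow> ('o, 'h, 'a) tower \<Rightarrow> int \<Rightarrow> int \<Rightarrow> 'v \<Rightarrow> 'v \<Rightarrow> 'v" where
  "face_op C M P X i = (\<lambda>(Ts, fs, \<alpha>) a b u w.
     if i = 0 then gam P (fs ! 0) b a w u
     else if i < length fs then gam P (ind C (fs ! i) (fs ! (i - 1))) b a w u
     else nu X (lind M \<alpha> (last fs)) b a w u)"

definition contract :: "nat \<Rightarrow> 'c \<Rightarrow> 'c list \<Rightarrow> 'c list" where
  "contract i c xs = take i xs @ [c] @ drop (i + 2) xs"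

definition bar_face ::
  "('r, 'z) ring_scheme \<Rightarrow> ('o, 'h) operadic_cat \<Rightarrow> ('o, 'h, 'l, 'a) left_operadic_mod
     \<Rightarrow> ('o, 'h, 'r, 'v) operad_data \<Rightarrow> ('l, 'a, 'r, 'v) opmod_data \<Rightarrow> 'l \<Rightarrow> nat \<Rightarrow> int \<Rightarrow> nat
     \<Rightarrow> ('o, 'h, 'a, 'r, 'v) bar_elt \<Rightarrow> ('o, 'h, 'a, 'r, 'v) bar_elt" where
  "bar_face R C M P X L n d i =
     bar_ext R C M P X L n d (bar_module R C M P X L (n - 1) d)
       (\<lambda>\<tau> ds vs. let a = ds ! i; b = ds ! (i + 1) in
          koszul_sign R a b \<odot>\<^bsub>bar_module R C M P X L (n - 1) d\<^esub>
            bar_gen R C M P X L (n - 1) d (del_tower C M i \<tau>) (contract i (a + b) ds)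
              (contract i (face_op C M P X i \<tau> a b (vs ! i) (vs ! (i + 1))) vs))"

definition bar_complex ::
  "('r, 'z) ring_scheme \<Rightarrow> ('o, 'h) operadic_cat \<Rightarrow> ('o, 'h, 'l, 'a) left_operadic_mod
     \<Rightarrow> ('o, 'h, 'r, 'v) operad_data \<Rightarrow> ('l, 'a, 'r, 'v) opmod_data \<Rightarrow> 'l
     \<Rightarrow> ('r, ('o, 'h, 'a, 'r, 'v) bar_elt) graded_complex" where
  "bar_complex R C M P X L =
     \<lparr>chains = bar_module R C M P X L,
      bdry = (\<lambda>n d x. \<Oplus>\<^bsub>bar_module R C M P X L (n - 1) d\<^esub> i \<in> {0..n}.
        minus_one_power R i \<odot>\<^bsub>bar_module R C M P X L (n - 1) d\<^esub> bar_face R C M P X L n d i x)\<rparr>"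

definition bar_augmentation ::
  "('r, 'z) ring_scheme \<Rightarrow> ('o, 'h) operadic_cat \<Rightarrow> ('o, 'h, 'l, 'a) left_operadic_mod
     \<Rightarrow> ('o, 'h, 'r, 'v) operad_data \<Rightarrow> ('l, 'a, 'r, 'v) opmod_data \<Rightarrow> 'l \<Rightarrow> int
     \<Rightarrow> ('o, 'h, 'a, 'r, 'v) bar_elt \<Rightarrow> 'v" where
  "bar_augmentation R C M P X L d =
     bar_ext R C M P X L 0 d (mmod X L d)
       (\<lambda>(Ts, fs, \<alpha>) ds vs. let a = ds ! 0; b = ds ! 1 in
          koszul_sign R a b \<odot>\<^bsub>mmod X L d\<^esub> nu X \<alpha> b a (vs ! 1) (vs ! 0))"

text \<open>The map of bar complexes induced by a morphism \<open>(\<theta>, \<eta>)\<close> from \<open>(P, X)\<close> to \<open>(Q, Y)\<close>: it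
  applies \<open>\<theta>\<close> and \<open>\<eta>\<close> to the tensor factors.\<close>

definition bar_coeff_map ::
  "('r, 'z) ring_scheme \<Rightarrow> ('o, 'h) operadic_cat \<Rightarrow> ('o, 'h, 'l, 'a) left_operadic_mod
     \<Rightarrow> ('o, 'h, 'r, 'v) operad_data \<Rightarrow> ('l, 'a, 'r, 'v) opmod_data
     \<Rightarrow> ('o, 'h, 'r, 'v) operad_data \<Rightarrow> ('l, 'a, 'r, 'v) opmod_data
     \<Rightarrow> ('o \<Rightarrow> int \<Rightarrow> 'v \<Rightarrow> 'v) \<Rightarrow> ('l \<Rightarrow> int \<Rightarrow> 'v \<Rightarrow> 'v) \<Rightarrow> 'l \<Rightarrow> nat \<Rightarrow> int
     \<Rightarrow> ('o, 'h, 'a, 'r, 'v) bar_elt \<Rightarrow> ('o, 'h, 'a, 'r, 'v) bar_elt" where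
  "bar_coeff_map R C M P X Q Y \<theta> \<eta> L n d =
     bar_ext R C M P X L n d (bar_module R C M Q Y L n d)
       (\<lambda>\<tau> ds vs. bar_gen R C M Q Y L n d \<tau> ds
          (map2 (\<lambda>g v. g v) (map2 (\<lambda>g e. g e) (tower_factors C M \<theta> \<eta> \<tau>) ds) vs))"

end

theory Submission
  imports Defs
begin

text \<open>A linear map out of a bar module is determined by its values on the generators
  \<open>t\<^sub>0 \<otimes> p\<^sub>1 \<otimes> \<dots> \<otimes> p\<^sub>n \<otimes> m\<close>, and any multilinear assignment of values extends. A morphism of left
  operadic modules sends towers to towers and preserves fibers, so the factors over a tower are
  literally the factors over its image: sending a generator over \<open>\<tau>\<close> to the same generator over the
  image of \<open>\<tau>\<close> defines \<open>\<beta>\<close>. As the morphism also preserves composition, the action and the induced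
  maps, \<open>\<beta>\<close> commutes with every single face, with the augmentation and with maps of coefficients.
  That the bar complexes are complexes is the identity \<open>d\<^sub>i d\<^sub>j = d\<^sub>j\<^sub>-\<^sub>1 d\<^sub>i\<close> for \<open>i < j\<close>: for \<open>j > i + 1\<close> the
  faces touch disjoint factors, for \<open>j = i + 1\<close> it is associativity, and the Koszul signs agree
  because the sign is multiplicative in each degree.\<close>

section \<open>Linear maps, direct sums and quotients\<close>

text \<open>\<open>chain_map\<close> includes that both ends are complexes, so the square-zero
  property has to be proved over the source as well as over the target. The theory of bar modules is
  therefore developed once, for an arbitrary operad with a module over it, and instantiated twice;
  at the source this needs that the restricted data are again an operad and a module. The obstacle
  is the concrete encoding: an element is a finitely supported function of towers and degree lists
  whose values are cosets in a free module, and maps out of it pick representatives by choice. Once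
  the universal properties are available, no element is unfolded any more. Each identity between
  faces splits into four, for the tower, the degrees, the factors and the sign; the lists of
  degrees, factors and modules are all treated by the one operation \<open>contract\<close>. The
  Koszul signs come from the order of arguments: the operations read the right one of two
  neighbouring factors first, so a face exchanges the two before multiplying them. Faces preserve
  the internal degree, so everything happens for a fixed \<open>d\<close>.\<close>

lemma mod_homI:
  assumes "\<And>x. x \<in> carrier U \<Longrightarrow> f x \<in> carrier V"
    and "\<And>x y. \<lbrakk>x \<in> carrier U; y \<in> carrier U\<rbrakk> \<Longrightarrow> f (x \<oplus>\<^bsub>U\<^esub> y) = f x \<oplus>\<^bsub>V\<^esub> f y"
    and "\<And>a x. \<lbrakk>a \<in> carrier R; x \<in> carrier U\<rbrakk> \<Longrightarrow> f (a \<odot>\<^bsub>U\<^esub> x) = a \<odot>\<^bsub>V\<^esub> f x"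
  shows "f \<in> mod_hom R U V"
  using assms unfolding mod_hom_def by blast

lemma mod_hom_closed: "\<lbrakk>f \<in> mod_hom R U V; x \<in> carrier U\<rbrakk> \<Longrightarrow> f x \<in> carrier V"
  unfolding mod_hom_def by blast

lemma mod_hom_add:
  "\<lbrakk>f \<in> mod_hom R U V; x \<in> carrier U; y \<in> carrier U\<rbrakk> \<Longrightarrow> f (x \<oplus>\<^bsub>U\<^esub> y) = f x \<oplus>\<^bsub>V\<^esub> f y"
  unfolding mod_hom_def by blast

lemma mod_hom_smult:
  "\<lbrakk>f \<in> mod_hom R U V; a \<in> carrier R; x \<in> carrier U\<rbrakk> \<Longrightarrow> f (a \<odot>\<^bsub>U\<^esub> x) = a \<odot>\<^bsub>V\<^esub> f x"
  unfolding mod_hom_def by blast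

lemma mod_hom_comp:
  assumes "g \<in> mod_hom R V W" "f \<in> mod_hom R U V"
  shows "(\<lambda>x. g (f x)) \<in> mod_hom R U W"
  by (intro mod_homI)
    (simp_all add: mod_hom_closed[OF assms(1)] mod_hom_closed[OF assms(2)] mod_hom_add[OF assms(1)]
      mod_hom_add[OF assms(2)] mod_hom_smult[OF assms(1)] mod_hom_smult[OF assms(2)])

text \<open>\<open>mod_hom\<close> asks for additivity and homogeneity only; zero is preserved
  because it is the multiple of itself by the scalar zero.\<close>

lemma mod_hom_zero:
  assumes "module R U" "module R V" "f \<in> mod_hom R U V"
  shows "f \<zero>\<^bsub>U\<^esub> = \<zero>\<^bsub>V\<^esub>"
proof -
  interpret U: module R U by fact
  interpret V: module R V by fact
  have "f \<zero>\<^bsub>U\<^esub> = f (\<zero>\<^bsub>R\<^esub> \<odot>\<^bsub>U\<^esub> \<zero>\<^bsub>U\<^esub>)"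
    by simp
  also have "\<dots> = \<zero>\<^bsub>R\<^esub> \<odot>\<^bsub>V\<^esub> f \<zero>\<^bsub>U\<^esub>"
    by (rule mod_hom_smult[OF assms(3)]) auto
  also have "\<dots> = \<zero>\<^bsub>V\<^esub>"
    by (rule V.smult_l_null) (auto intro: mod_hom_closed[OF assms(3)])
  finally show ?thesis .
qed

lemma mod_hom_finsum:
  assumes "module R U" "module R V" "f \<in> mod_hom R U V" "\<And>i. i \<in> A \<Longrightarrow> g i \<in> carrier U"
  shows "f (\<Oplus>\<^bsub>U\<^esub> i\<in>A. g i) = (\<Oplus>\<^bsub>V\<^esub> i\<in>A. f (g i))"
proof -
  interpret U: module R U by fact
  interpret V: module R V by fact
  show ?thesis
    using assms(4)
  proof (induction A rule: infinite_finite_induct)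
    \<comment> \<open>A sum over an infinite index set is zero by convention, on both sides.\<close>
    case (infinite A)
    then show ?case
      by (simp add: U.M.finsum_infinite V.M.finsum_infinite mod_hom_zero[OF assms(1-3)])
  next
    case empty
    then show ?case
      by (simp add: mod_hom_zero[OF assms(1-3)])
  next
    case (insert x F)
    then show ?case
      by (simp add: Pi_def mod_hom_closed[OF assms(3)] mod_hom_add[OF assms(3)])
  qed
qed

text \<open>Commutativity of the ring enters here: the factor \<open>c\<close> has to be moved past
  the scalar \<open>a\<close>. This is what makes faces with a Koszul or an alternating sign
  linear.\<close>

lemma mod_hom_smult_right:
  assumes "module R V" "f \<in> mod_hom R U V" "c \<in> carrier R"
  shows "(\<lambda>x. c \<odot>\<^bsub>V\<^esub> f x) \<in> mod_hom R U V"
proof -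
  interpret V: module R V by fact
  have "c \<odot>\<^bsub>V\<^esub> (a \<odot>\<^bsub>V\<^esub> y) = a \<odot>\<^bsub>V\<^esub> (c \<odot>\<^bsub>V\<^esub> y)" if "a \<in> carrier R" "y \<in> carrier V" for a y
    using that assms(3) by (metis V.R.m_comm V.smult_assoc1)
  then show ?thesis
    using assms(2,3) by (auto intro!: mod_homI simp: mod_hom_closed mod_hom_add mod_hom_smult V.smult_r_distr)
qed

text \<open>Needed for the differential, a pointwise sum of signed faces.\<close>

lemma mod_hom_finsum_right:
  assumes "module R V" "\<And>i. i \<in> A \<Longrightarrow> f i \<in> mod_hom R U V"
  shows "(\<lambda>x. \<Oplus>\<^bsub>V\<^esub> i\<in>A. f i x) \<in> mod_hom R U V"
proof -
  interpret V: module R V by fact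
  show ?thesis
    using assms(2)
  proof (induction A rule: infinite_finite_induct)
    case (infinite A)
    then show ?case by (auto intro!: mod_homI simp: V.M.finsum_infinite)
  next
    case empty
    then show ?case by (auto intro!: mod_homI)
  next
    case (insert i A)
    note h = mod_hom_closed[OF insert.prems] mod_hom_add[OF insert.prems] mod_hom_smult[OF insert.prems]
    have eq: "(\<Oplus>\<^bsub>V\<^esub> i\<in>insert i A. f i x) = f i x \<oplus>\<^bsub>V\<^esub> (\<Oplus>\<^bsub>V\<^esub> i\<in>A. f i x)" if "x \<in> carrier U" for x
      using insert that by (intro V.M.finsum_insert) (auto intro: mod_hom_closed)
    have 1: "f i \<in> mod_hom R U V" and 2: "(\<lambda>x. \<Oplus>\<^bsub>V\<^esub> i\<in>A. f i x) \<in> mod_hom R U V"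
      using insert by auto
    have hom: "(\<lambda>x. f i x \<oplus>\<^bsub>V\<^esub> (\<Oplus>\<^bsub>V\<^esub> i\<in>A. f i x)) \<in> mod_hom R U V"
      using mod_hom_closed[OF 1] mod_hom_closed[OF 2] mod_hom_add[OF 1] mod_hom_add[OF 2]
        mod_hom_smult[OF 1] mod_hom_smult[OF 2]
      by (intro mod_homI) (simp_all add: V.smult_r_distr V.M.a_ac)
    \<comment> \<open>The splitting \<open>eq\<close> holds on the carrier only, so the sum and the
      function in \<open>hom\<close> may differ elsewhere; the three clauses are checked on carrier
      elements.\<close>
    show ?case
    proof (intro mod_homI)
      fix x assume x: "x \<in> carrier U"
      show "(\<Oplus>\<^bsub>V\<^esub> j\<in>insert i A. f j x) \<in> carrier V"
        using mod_hom_closed[OF hom x] eq[OF x] by simp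
    next
      fix x y assume x: "x \<in> carrier U" "y \<in> carrier U"
      have "(\<Oplus>\<^bsub>V\<^esub> j\<in>insert i A. f j (x \<oplus>\<^bsub>U\<^esub> y)) = (\<Oplus>\<^bsub>V\<^esub> j\<in>insert i A. f j x \<oplus>\<^bsub>V\<^esub> f j y)"
        using insert.prems x by (intro V.M.finsum_cong') (auto simp: h)
      also have "\<dots> = (\<Oplus>\<^bsub>V\<^esub> j\<in>insert i A. f j x) \<oplus>\<^bsub>V\<^esub> (\<Oplus>\<^bsub>V\<^esub> j\<in>insert i A. f j y)"
        using x by (intro V.M.finsum_addf) (auto simp: h)
      finally show "(\<Oplus>\<^bsub>V\<^esub> j\<in>insert i A. f j (x \<oplus>\<^bsub>U\<^esub> y))
        = (\<Oplus>\<^bsub>V\<^esub> j\<in>insert i A. f j x) \<oplus>\<^bsub>V\<^esub> (\<Oplus>\<^bsub>V\<^esub> j\<in>insert i A. f j y)" .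
    next
      fix a x assume x: "a \<in> carrier R" "x \<in> carrier U"
      have "(\<Oplus>\<^bsub>V\<^esub> j\<in>insert i A. f j (a \<odot>\<^bsub>U\<^esub> x)) = (\<Oplus>\<^bsub>V\<^esub> j\<in>insert i A. a \<odot>\<^bsub>V\<^esub> f j x)"
        using insert.prems x by (intro V.M.finsum_cong') (auto simp: h)
      also have "\<dots> = a \<odot>\<^bsub>V\<^esub> (\<Oplus>\<^bsub>V\<^esub> j\<in>insert i A. f j x)"
        using insert x by (intro V.finsum_smult_ldistr[symmetric]) (auto simp: h)
      finally show "(\<Oplus>\<^bsub>V\<^esub> j\<in>insert i A. f j (a \<odot>\<^bsub>U\<^esub> x)) = a \<odot>\<^bsub>V\<^esub> (\<Oplus>\<^bsub>V\<^esub> j\<in>insert i A. f j x)" .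
    qed
  qed
qed

lemma (in abelian_group) a_inv_zero: "\<ominus> \<zero> = \<zero>"
  using r_neg[of \<zero>] by simp

section \<open>Direct sums\<close>

lemma direct_sum_simps:
  "carrier (direct_sum I M) = {x \<in> \<Pi>\<^sub>E i\<in>I. carrier (M i). finite {i \<in> I. x i \<noteq> \<zero>\<^bsub>M i\<^esub>}}"
  "\<zero>\<^bsub>direct_sum I M\<^esub> = (\<lambda>i\<in>I. \<zero>\<^bsub>M i\<^esub>)"
  "x \<oplus>\<^bsub>direct_sum I M\<^esub> y = (\<lambda>i\<in>I. x i \<oplus>\<^bsub>M i\<^esub> y i)"
  "a \<odot>\<^bsub>direct_sum I M\<^esub> x = (\<lambda>i\<in>I. a \<odot>\<^bsub>M i\<^esub> x i)"
  by (simp_all add: direct_sum_def)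

lemma direct_sum_carrier_D:
  assumes "x \<in> carrier (direct_sum I M)"
  shows "i \<in> I \<Longrightarrow> x i \<in> carrier (M i)" "finite {i \<in> I. x i \<noteq> \<zero>\<^bsub>M i\<^esub>}" "x \<in> extensional I"
  using assms by (auto simp: direct_sum_simps PiE_def)

text \<open>Any finite superset of the support will do: cancellation makes the support of a sum hard
  to name, but it stays inside the union of the supports.\<close>

lemma direct_sum_carrier_I:
  assumes "\<And>i. i \<in> I \<Longrightarrow> x i \<in> carrier (M i)" "x \<in> extensional I"
    "finite A" "{i \<in> I. x i \<noteq> \<zero>\<^bsub>M i\<^esub>} \<subseteq> A"
  shows "x \<in> carrier (direct_sum I M)"
  using assms finite_subset[OF assms(4,3)] by (auto simp: direct_sum_simps PiE_def)

lemma module_direct_sum: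
  assumes "cring R" and M: "\<And>i. i \<in> I \<Longrightarrow> module R (M i)"
  shows "module R (direct_sum I M)"
proof -
  let ?D = "direct_sum I M"
  have gr: "abelian_group (M i)" if "i \<in> I" for i
    using M[OF that] by (simp add: module_def)
  note mon = abelian_group.axioms(1)[OF gr]
  note D = direct_sum_carrier_D
  have Di: "x i \<in> carrier (M i)" if "i \<in> I" "x \<in> carrier ?D" for x i
    by (rule D(1)[OF that(2,1)])
  have add: "x \<oplus>\<^bsub>?D\<^esub> y \<in> carrier ?D" if x: "x \<in> carrier ?D" and y: "y \<in> carrier ?D" for x y
    by (rule direct_sum_carrier_I[OF _ _ finite_UnI[OF D(2)[OF x] D(2)[OF y]]])
      (auto simp: direct_sum_simps(3) D(1)[OF x] D(1)[OF y] abelian_monoid.a_closed[OF mon]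
         abelian_monoid.l_zero[OF mon] abelian_monoid.zero_closed[OF mon])
  have smult: "a \<odot>\<^bsub>?D\<^esub> x \<in> carrier ?D" if a: "a \<in> carrier R" and x: "x \<in> carrier ?D" for a x
    by (rule direct_sum_carrier_I[OF _ _ D(2)[OF x]])
      (auto simp: direct_sum_simps(4) D(1)[OF x] a module.smult_closed[OF M] module.smult_r_null[OF M])
  have inv: "\<exists>y\<in>carrier ?D. y \<oplus>\<^bsub>?D\<^esub> x = \<zero>\<^bsub>?D\<^esub>" if x: "x \<in> carrier ?D" for x
  proof (rule bexI[of _ "\<lambda>i\<in>I. \<ominus>\<^bsub>M i\<^esub> x i"])
    show "(\<lambda>i\<in>I. \<ominus>\<^bsub>M i\<^esub> x i) \<in> carrier ?D"
      by (rule direct_sum_carrier_I[OF _ _ D(2)[OF x]])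
        (auto simp: D(1)[OF x] abelian_group.a_inv_closed[OF gr] abelian_group.a_inv_zero[OF gr])
    show "(\<lambda>i\<in>I. \<ominus>\<^bsub>M i\<^esub> x i) \<oplus>\<^bsub>?D\<^esub> x = \<zero>\<^bsub>?D\<^esub>"
      by (auto simp: direct_sum_simps D(1)[OF x] abelian_group.l_neg[OF gr])
  qed
  have "abelian_group ?D"
  proof (rule abelian_groupI)
    show "\<zero>\<^bsub>?D\<^esub> \<in> carrier ?D"
      by (rule direct_sum_carrier_I[of _ _ _ "{}"])
        (auto simp: direct_sum_simps(2) abelian_monoid.zero_closed[OF mon])
    show "\<zero>\<^bsub>?D\<^esub> \<oplus>\<^bsub>?D\<^esub> x = x" if x: "x \<in> carrier ?D" for x
      using D(1,3)[OF x] by (auto simp: direct_sum_simps(2,3) fun_eq_iff extensional_def abelian_monoid.l_zero[OF mon])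
    show "x \<oplus>\<^bsub>?D\<^esub> y = y \<oplus>\<^bsub>?D\<^esub> x" if "x \<in> carrier ?D" "y \<in> carrier ?D" for x y
      using Di that unfolding direct_sum_simps(3) by (intro restrict_ext abelian_monoid.a_comm[OF mon])
    show "(x \<oplus>\<^bsub>?D\<^esub> y) \<oplus>\<^bsub>?D\<^esub> z = x \<oplus>\<^bsub>?D\<^esub> (y \<oplus>\<^bsub>?D\<^esub> z)"
      if "x \<in> carrier ?D" "y \<in> carrier ?D" "z \<in> carrier ?D" for x y z
      unfolding direct_sum_simps(3) by (intro restrict_ext) (simp add: Di that abelian_monoid.a_assoc[OF mon])
  qed (use add inv in auto)
  then show ?thesis
  proof (rule moduleI[OF \<open>cring R\<close>])
    show "\<one>\<^bsub>R\<^esub> \<odot>\<^bsub>?D\<^esub> x = x" if x: "x \<in> carrier ?D" for x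
      using D(1,3)[OF x] by (auto simp: direct_sum_simps(4) fun_eq_iff extensional_def module.smult_one[OF M])
  qed (use smult Di in \<open>auto simp: direct_sum_simps(3,4) module.smult_l_distr[OF M]
         module.smult_r_distr[OF M] module.smult_assoc1[OF M] intro!: restrict_ext\<close>)
qed

lemma direct_sum_proj_hom: "i \<in> I \<Longrightarrow> (\<lambda>x. x i) \<in> mod_hom R (direct_sum I M) (M i)"
  by (auto intro!: mod_homI simp: direct_sum_simps)

lemma direct_sum_inj_hom:
  assumes "\<And>i. i \<in> I \<Longrightarrow> module R (M i)" "i \<in> I"
  shows "direct_sum_inj I M i \<in> mod_hom R (M i) (direct_sum I M)"
proof (rule mod_homI)
  have mon: "abelian_monoid (M i)" if "i \<in> I" for i
    using assms(1)[OF that] by (simp add: module_def abelian_group_def)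
  note z = abelian_monoid.zero_closed[OF mon] abelian_monoid.l_zero[OF mon]
  show "direct_sum_inj I M i x \<in> carrier (direct_sum I M)" if "x \<in> carrier (M i)" for x
    by (rule direct_sum_carrier_I[of _ _ _ "{i}"]) (use that z in \<open>auto simp: direct_sum_inj_def\<close>)
  show "direct_sum_inj I M i (x \<oplus>\<^bsub>M i\<^esub> y)
      = direct_sum_inj I M i x \<oplus>\<^bsub>direct_sum I M\<^esub> direct_sum_inj I M i y"
    if "x \<in> carrier (M i)" "y \<in> carrier (M i)" for x y
    using that z by (auto simp: direct_sum_inj_def direct_sum_simps)
  show "direct_sum_inj I M i (a \<odot>\<^bsub>M i\<^esub> x) = a \<odot>\<^bsub>direct_sum I M\<^esub> direct_sum_inj I M i x"
    if "a \<in> carrier R" "x \<in> carrier (M i)" for a x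
    using that module.smult_r_null[OF assms(1)] by (auto simp: direct_sum_inj_def direct_sum_simps)
qed

text \<open>Each component of the finite sum is found by applying the projection, which is linear
  and so commutes with the sum; outside \<open>I\<close> both sides are
  \<open>undefined\<close>.\<close>

lemma direct_sum_decomp:
  assumes "cring R" and M: "\<And>i. i \<in> I \<Longrightarrow> module R (M i)" and x: "x \<in> carrier (direct_sum I M)"
  shows "x = (\<Oplus>\<^bsub>direct_sum I M\<^esub> i\<in>{i \<in> I. x i \<noteq> \<zero>\<^bsub>M i\<^esub>}. direct_sum_inj I M i (x i))"
    (is "x = (\<Oplus>\<^bsub>_\<^esub> i\<in>?S. _)")
proof -
  note x' = direct_sum_carrier_D[OF x]
  have mD: "module R (direct_sum I M)"
    by (rule module_direct_sum[OF assms(1,2)])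
  then interpret D: module R "direct_sum I M" .
  have inj: "direct_sum_inj I M i (x i) \<in> carrier (direct_sum I M)" if "i \<in> I" for i
    using that by (intro mod_hom_closed[OF direct_sum_inj_hom[OF M]] x'(1))
  have "x j = (\<Oplus>\<^bsub>direct_sum I M\<^esub> i\<in>?S. direct_sum_inj I M i (x i)) j" if j: "j \<in> I" for j
  proof -
    interpret Mj: module R "M j" by (rule M[OF j])
    have "(\<Oplus>\<^bsub>direct_sum I M\<^esub> i\<in>?S. direct_sum_inj I M i (x i)) j
        = (\<Oplus>\<^bsub>M j\<^esub> i\<in>?S. direct_sum_inj I M i (x i) j)"
      by (rule mod_hom_finsum[OF mD Mj.module_axioms direct_sum_proj_hom[OF j]]) (use inj in auto)
    also have "\<dots> = (\<Oplus>\<^bsub>M j\<^esub> i\<in>?S. if j = i then x i else \<zero>\<^bsub>M j\<^esub>)"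
      using j x'(1) by (intro Mj.M.finsum_cong') (auto simp: direct_sum_inj_def)
    also have "\<dots> = x j"
    proof (cases "j \<in> ?S")
      case True
      \<comment> \<open>For \<open>i\<close> other than \<open>j\<close> the value
        \<open>x i\<close> lies in the wrong module, so the rule for singleton sums is applied to
        the constant function with value \<open>x j\<close>; the two conditional summands are the
        same.\<close>
      have "(\<Oplus>\<^bsub>M j\<^esub> i\<in>?S. if j = i then x j else \<zero>\<^bsub>M j\<^esub>) = x j"
        using Mj.M.finsum_singleton[OF True x'(2), of "\<lambda>_. x j"] x'(1)[OF j] by simp
      moreover have "(\<lambda>i. if j = i then x i else \<zero>\<^bsub>M j\<^esub>) = (\<lambda>i. if j = i then x j else \<zero>\<^bsub>M j\<^esub>)"
        by auto
      ultimately show ?thesis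
        by simp
    next
      case False
      then have "(\<Oplus>\<^bsub>M j\<^esub> i\<in>?S. if j = i then x i else \<zero>\<^bsub>M j\<^esub>) = (\<Oplus>\<^bsub>M j\<^esub> i\<in>?S. \<zero>\<^bsub>M j\<^esub>)"
        by (intro Mj.M.finsum_cong') auto
      then show ?thesis
        using False j by simp
    qed
    finally show ?thesis by simp
  qed
  moreover have "(\<Oplus>\<^bsub>direct_sum I M\<^esub> i\<in>?S. direct_sum_inj I M i (x i)) \<in> carrier (direct_sum I M)"
    by (intro D.M.finsum_closed) (use inj in auto)
  ultimately show ?thesis
    using x'(3) direct_sum_carrier_D(3) by (blast intro: extensionalityI)
qed

text \<open>Uniqueness half of the universal property: by the decomposition into components, a
  linear map is computed summand by summand.\<close>

lemma direct_sum_hom_eqI: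
  assumes "cring R" "\<And>i. i \<in> I \<Longrightarrow> module R (M i)" "module R N"
    and f: "f \<in> mod_hom R (direct_sum I M) N" and g: "g \<in> mod_hom R (direct_sum I M) N"
    and eq: "\<And>i y. \<lbrakk>i \<in> I; y \<in> carrier (M i)\<rbrakk>
      \<Longrightarrow> f (direct_sum_inj I M i y) = g (direct_sum_inj I M i y)"
    and x: "x \<in> carrier (direct_sum I M)"
  shows "f x = g x"
proof -
  let ?S = "{i \<in> I. x i \<noteq> \<zero>\<^bsub>M i\<^esub>}"
  let ?s = "\<Oplus>\<^bsub>direct_sum I M\<^esub> i\<in>?S. direct_sum_inj I M i (x i)"
  interpret N: module R N by fact
  have mD: "module R (direct_sum I M)"
    by (rule module_direct_sum[OF assms(1,2)])
  have inj: "direct_sum_inj I M i (x i) \<in> carrier (direct_sum I M)" if "i \<in> ?S" for i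
    using that direct_sum_carrier_D(1)[OF x] by (intro mod_hom_closed[OF direct_sum_inj_hom[OF assms(2)]]) auto
  have "f ?s = (\<Oplus>\<^bsub>N\<^esub> i\<in>?S. f (direct_sum_inj I M i (x i)))"
    by (rule mod_hom_finsum[OF mD assms(3) f inj])
  also have "\<dots> = (\<Oplus>\<^bsub>N\<^esub> i\<in>?S. g (direct_sum_inj I M i (x i)))"
    using eq direct_sum_carrier_D(1)[OF x] mod_hom_closed[OF g inj] by (intro N.M.finsum_cong') auto
  also have "\<dots> = g ?s"
    by (rule mod_hom_finsum[OF mD assms(3) g inj, symmetric])
  finally show ?thesis
    using direct_sum_decomp[OF assms(1,2) x] by simp
qed

text \<open>The sum defining \<open>direct_sum_ext\<close> runs over the support of
  \<open>x\<close>, which varies with \<open>x\<close>; before two values can be added they need a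
  common index set. The extra summands vanish because each component map sends zero to zero.\<close>

lemma direct_sum_ext_superset:
  assumes "\<And>i. i \<in> I \<Longrightarrow> module R (M i)" "module R N"
    and g: "\<And>i. i \<in> I \<Longrightarrow> g i \<in> mod_hom R (M i) N"
    and x: "x \<in> carrier (direct_sum I M)"
    and J: "finite J" "J \<subseteq> I" "{i \<in> I. x i \<noteq> \<zero>\<^bsub>M i\<^esub>} \<subseteq> J"
  shows "direct_sum_ext I M N g x = (\<Oplus>\<^bsub>N\<^esub> i\<in>J. g i (x i))"
proof -
  interpret N: module R N by fact
  show ?thesis
    unfolding direct_sum_ext_def using J direct_sum_carrier_D(1)[OF x]
    by (intro N.M.add.finprod_mono_neutral_cong_left)
      (auto intro: mod_hom_closed[OF g] simp: mod_hom_zero[OF assms(1,2) g])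
qed

lemma direct_sum_ext_hom:
  assumes "cring R" "\<And>i. i \<in> I \<Longrightarrow> module R (M i)" "module R N"
    and g: "\<And>i. i \<in> I \<Longrightarrow> g i \<in> mod_hom R (M i) N"
  shows "direct_sum_ext I M N g \<in> mod_hom R (direct_sum I M) N"
proof -
  interpret N: module R N by fact
  interpret D: module R "direct_sum I M" by (rule module_direct_sum[OF assms(1,2)])
  let ?S = "\<lambda>x. {i \<in> I. x i \<noteq> \<zero>\<^bsub>M i\<^esub>}"
  note D = direct_sum_carrier_D
  note ext = direct_sum_ext_superset[of I R M N g, OF assms(2,3) g]
  have gc: "g i (x i) \<in> carrier N" if "i \<in> I" "x \<in> carrier (direct_sum I M)" for i x
    by (rule mod_hom_closed[OF g[OF that(1)] D(1)[OF that(2,1)]])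
  show ?thesis
  proof (rule mod_homI)
    show "direct_sum_ext I M N g x \<in> carrier N" if "x \<in> carrier (direct_sum I M)" for x
      unfolding direct_sum_ext_def using that by (intro N.M.finsum_closed) (auto intro: gc)
  next
    fix x y assume x: "x \<in> carrier (direct_sum I M)" and y: "y \<in> carrier (direct_sum I M)"
    let ?z = "x \<oplus>\<^bsub>direct_sum I M\<^esub> y"
    have z: "?z \<in> carrier (direct_sum I M)" using x y by simp
    \<comment> \<open>Contains the supports of both arguments and of their sum, so that all three
      values become sums over one set.\<close>
    let ?J = "?S x \<union> ?S y \<union> ?S ?z"
    have J: "finite ?J" using D(2)[OF x] D(2)[OF y] D(2)[OF z] by simp
    have "direct_sum_ext I M N g ?z = (\<Oplus>\<^bsub>N\<^esub> i\<in>?J. g i (?z i))"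
      by (rule ext) (use z J in auto)
    also have "\<dots> = (\<Oplus>\<^bsub>N\<^esub> i\<in>?J. g i (x i) \<oplus>\<^bsub>N\<^esub> g i (y i))"
      by (intro N.M.finsum_cong')
        (auto simp: direct_sum_simps(3) x y gc D(1)[OF x] D(1)[OF y] mod_hom_add[OF g])
    also have "\<dots> = (\<Oplus>\<^bsub>N\<^esub> i\<in>?J. g i (x i)) \<oplus>\<^bsub>N\<^esub> (\<Oplus>\<^bsub>N\<^esub> i\<in>?J. g i (y i))"
      by (intro N.M.finsum_addf) (auto simp: x y gc)
    also have "(\<Oplus>\<^bsub>N\<^esub> i\<in>?J. g i (x i)) = direct_sum_ext I M N g x"
      by (rule ext[symmetric]) (use x J in auto)
    also have "(\<Oplus>\<^bsub>N\<^esub> i\<in>?J. g i (y i)) = direct_sum_ext I M N g y"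
      by (rule ext[symmetric]) (use y J in auto)
    finally show "direct_sum_ext I M N g ?z = direct_sum_ext I M N g x \<oplus>\<^bsub>N\<^esub> direct_sum_ext I M N g y" .
  next
    fix a x assume a: "a \<in> carrier R" and x: "x \<in> carrier (direct_sum I M)"
    let ?z = "a \<odot>\<^bsub>direct_sum I M\<^esub> x"
    have z: "?z \<in> carrier (direct_sum I M)" using x a by simp
    let ?J = "?S x \<union> ?S ?z"
    have J: "finite ?J" using D(2)[OF x] D(2)[OF z] by simp
    have "direct_sum_ext I M N g ?z = (\<Oplus>\<^bsub>N\<^esub> i\<in>?J. g i (?z i))"
      by (rule ext) (use z J in auto)
    also have "\<dots> = (\<Oplus>\<^bsub>N\<^esub> i\<in>?J. a \<odot>\<^bsub>N\<^esub> g i (x i))"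
      by (intro N.M.finsum_cong')
        (auto simp: direct_sum_simps(4) x a gc D(1)[OF x] mod_hom_smult[OF g])
    also have "\<dots> = a \<odot>\<^bsub>N\<^esub> (\<Oplus>\<^bsub>N\<^esub> i\<in>?J. g i (x i))"
      by (intro N.finsum_smult_ldistr[symmetric] J a) (auto simp: x gc)
    also have "(\<Oplus>\<^bsub>N\<^esub> i\<in>?J. g i (x i)) = direct_sum_ext I M N g x"
      by (rule ext[symmetric]) (use x J in auto)
    finally show "direct_sum_ext I M N g ?z = a \<odot>\<^bsub>N\<^esub> direct_sum_ext I M N g x" .
  qed
qed

text \<open>The injected element has empty support if \<open>x\<close> is zero; the index set
  \<open>{i}\<close> covers both cases.\<close>

lemma direct_sum_ext_inj:
  assumes "\<And>i. i \<in> I \<Longrightarrow> module R (M i)" "module R N"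
    and "\<And>i. i \<in> I \<Longrightarrow> g i \<in> mod_hom R (M i) N" and "i \<in> I" "x \<in> carrier (M i)"
  shows "direct_sum_ext I M N g (direct_sum_inj I M i x) = g i x"
proof -
  interpret N: module R N by fact
  have "direct_sum_ext I M N g (direct_sum_inj I M i x)
      = (\<Oplus>\<^bsub>N\<^esub> j\<in>{i}. g j (direct_sum_inj I M i x j))"
    using assms(4,5)
    by (intro direct_sum_ext_superset[OF assms(1-3)] mod_hom_closed[OF direct_sum_inj_hom[OF assms(1)]])
      (auto simp: direct_sum_inj_def)
  also have "\<dots> = g i x"
    using assms(4,5) mod_hom_closed[OF assms(3)[OF assms(4)]] by (simp add: direct_sum_inj_def)
  finally show ?thesis .
qed

section \<open>The regular module and free modules\<close>

lemma module_regular: "cring R \<Longrightarrow> module R (regular_module R)"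
proof -
  assume "cring R"
  then interpret cring R .
  show ?thesis
    unfolding regular_module_def
  proof (rule moduleI)
    show "abelian_group \<lparr>carrier = carrier R, mult = undefined, one = undefined,
      zero = \<zero>\<^bsub>R\<^esub>, add = add R, smult = mult R\<rparr>"
      by (rule abelian_groupI) (auto simp: a_ac intro!: bexI[of _ "\<ominus>\<^bsub>R\<^esub> x" for x])
  qed (auto simp: l_distr r_distr m_assoc intro: cring_axioms)
qed

lemma regular_module_hom:
  assumes "module R N" "y \<in> carrier N"
  shows "(\<lambda>a. a \<odot>\<^bsub>N\<^esub> y) \<in> mod_hom R (regular_module R) N"
proof -
  interpret N: module R N by fact
  show ?thesis
    using assms(2) by (intro mod_homI) (auto simp: regular_module_def N.smult_l_distr N.smult_assoc1)
qed

lemma module_free: "cring R \<Longrightarrow> module R (free_module R S)"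
  unfolding free_module_def by (intro module_direct_sum module_regular)

lemma free_basis_closed:
  assumes "cring R" "s \<in> S"
  shows "free_basis R S s \<in> carrier (free_module R S)"
proof -
  interpret cring R by fact
  have "\<one>\<^bsub>R\<^esub> \<in> carrier (regular_module R)"
    by (simp add: regular_module_def)
  then show ?thesis
    unfolding free_basis_def free_module_def
    by (intro mod_hom_closed[OF direct_sum_inj_hom[OF module_regular]] assms)
qed

lemma free_module_hom_eqI:
  assumes "cring R" "module R N"
    and f: "f \<in> mod_hom R (free_module R S) N" and g: "g \<in> mod_hom R (free_module R S) N"
    and eq: "\<And>s. s \<in> S \<Longrightarrow> f (free_basis R S s) = g (free_basis R S s)"
    and x: "x \<in> carrier (free_module R S)"
  shows "f x = g x"
proof -
  interpret cring R by fact
  note inj = direct_sum_inj_hom[of S R "\<lambda>_. regular_module R", OF module_regular[OF assms(1)]]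
  have one: "\<one>\<^bsub>R\<^esub> \<in> carrier (regular_module R)"
    by (simp add: regular_module_def)
  show ?thesis
  proof (rule direct_sum_hom_eqI[of R S "\<lambda>_. regular_module R" N f g x])
    fix s y assume s: "s \<in> S" and y: "y \<in> carrier (regular_module R)"
    then have y': "y \<in> carrier R" by (simp add: regular_module_def)
    \<comment> \<open>Every element of the regular module is a multiple of one, so the basis vectors
      suffice.\<close>
    then have "y = y \<odot>\<^bsub>regular_module R\<^esub> \<one>\<^bsub>R\<^esub>"
      by (simp add: regular_module_def)
    then have "direct_sum_inj S (\<lambda>_. regular_module R) s y = y \<odot>\<^bsub>free_module R S\<^esub> free_basis R S s"
      unfolding free_basis_def free_module_def
      using mod_hom_smult[OF inj[OF s] y' one] by simp
    then show "f (direct_sum_inj S (\<lambda>_. regular_module R) s y) = g (direct_sum_inj S (\<lambda>_. regular_module R) s y)"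
      using mod_hom_smult[OF f y' free_basis_closed[OF assms(1) s]]
        mod_hom_smult[OF g y' free_basis_closed[OF assms(1) s]] eq[OF s] by simp
  qed (use assms module_regular[OF assms(1)] in \<open>auto simp: free_module_def\<close>)
qed

section \<open>Submodules and quotients\<close>

lemma submodule_span:
  assumes "module R M" "A \<subseteq> carrier M"
  shows "submodule (submodule_span R M A) R M"
proof -
  interpret module R M by fact
  \<comment> \<open>The whole carrier is one of the submodules intersected, so the family is
    nonempty and the span stays inside \<open>M\<close>.\<close>
  have c: "carrier M \<in> {H. submodule H R M \<and> A \<subseteq> H}"
    using carrier_is_submodule assms(2) by simp
  show ?thesis
  proof (rule submoduleI)
    show "submodule_span R M A \<subseteq> carrier M"
      using c unfolding submodule_span_def by blast
    show "\<zero>\<^bsub>M\<^esub> \<in> submodule_span R M A"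
      unfolding submodule_span_def submodule_def using subgroup.one_closed by fastforce
  qed (unfold submodule_span_def, (blast dest: submoduleE)+)
qed

lemma submodule_span_superset: "A \<subseteq> submodule_span R M A"
  unfolding submodule_span_def by blast

lemma mod_hom_kernel_submodule:
  assumes "module R M" "module R N" "f \<in> mod_hom R M N"
  shows "submodule {x \<in> carrier M. f x = \<zero>\<^bsub>N\<^esub>} R M"
proof -
  interpret M: module R M by fact
  interpret N: module R N by fact
  note f = mod_hom_add[OF assms(3)] mod_hom_smult[OF assms(3)] mod_hom_zero[OF assms]
  have "f (\<ominus>\<^bsub>M\<^esub> x) = \<zero>\<^bsub>N\<^esub>" if "x \<in> carrier M" "f x = \<zero>\<^bsub>N\<^esub>" for x
    using f(1)[of "\<ominus>\<^bsub>M\<^esub> x" x] that f(3) mod_hom_closed[OF assms(3), of "\<ominus>\<^bsub>M\<^esub> x"]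
    by (simp add: M.M.l_neg)
  then show ?thesis
    by (intro M.submoduleI) (auto simp: f)
qed

text \<open>The kernel is one of the submodules containing \<open>A\<close>, and the span is the
  least of them.\<close>

lemma mod_hom_span_zero:
  assumes "module R M" "module R N" "f \<in> mod_hom R M N" "A \<subseteq> carrier M"
    and "\<And>x. x \<in> A \<Longrightarrow> f x = \<zero>\<^bsub>N\<^esub>" and "x \<in> submodule_span R M A"
  shows "f x = \<zero>\<^bsub>N\<^esub>"
  using mod_hom_kernel_submodule[OF assms(1-3)] assms(4-6) unfolding submodule_span_def by blast

lemma submodule_abelian_subgroup:
  assumes "module R M" "submodule H R M"
  shows "abelian_subgroup H M"
proof -
  interpret module R M by fact
  interpret submodule H R M by fact
  show ?thesis
    by (intro abelian_subgroupI3 additive_subgroup.intro subgroup_axioms M.abelian_group_axioms)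
qed

lemma quotient_add:
  assumes "module R M" "submodule H R M" "x \<in> carrier M" "y \<in> carrier M"
  shows "(H +>\<^bsub>M\<^esub> x) \<oplus>\<^bsub>quotient_module M H\<^esub> (H +>\<^bsub>M\<^esub> y) = H +>\<^bsub>M\<^esub> (x \<oplus>\<^bsub>M\<^esub> y)"
  using abelian_subgroup.a_rcos_sum[OF submodule_abelian_subgroup[OF assms(1,2)] assms(3,4)]
  by (simp add: quotient_module_def)

text \<open>The action on the quotient is a union over all representatives of the coset, so every
  representative must give the same result. Two of them differ by an element of \<open>H\<close>,
  and \<open>H\<close> is closed under scalars.\<close>

lemma quotient_smult:
  assumes "module R M" "submodule H R M" "a \<in> carrier R" "x \<in> carrier M"
  shows "a \<odot>\<^bsub>quotient_module M H\<^esub> (H +>\<^bsub>M\<^esub> x) = H +>\<^bsub>M\<^esub> (a \<odot>\<^bsub>M\<^esub> x)"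
proof -
  interpret module R M by fact
  interpret H: submodule H R M by fact
  interpret A: abelian_subgroup H M by (rule submodule_abelian_subgroup[OF assms(1,2)])
  have "H +>\<^bsub>M\<^esub> (a \<odot>\<^bsub>M\<^esub> y) = H +>\<^bsub>M\<^esub> (a \<odot>\<^bsub>M\<^esub> x)" if y: "y \<in> H +>\<^bsub>M\<^esub> x" for y
  proof -
    obtain h where h: "h \<in> H" "y = h \<oplus>\<^bsub>M\<^esub> x"
      using y by (auto simp: a_r_coset_def')
    then have "a \<odot>\<^bsub>M\<^esub> y = (a \<odot>\<^bsub>M\<^esub> h) \<oplus>\<^bsub>M\<^esub> (a \<odot>\<^bsub>M\<^esub> x)"
      using assms(3,4) A.a_Hcarr by (simp add: smult_r_distr)
    then have "a \<odot>\<^bsub>M\<^esub> y \<in> H +>\<^bsub>M\<^esub> (a \<odot>\<^bsub>M\<^esub> x)"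
      using h assms(3) H.smult_closed by (auto simp: a_r_coset_def')
    then show ?thesis
      using M.a_repr_independence[OF _ _ H.subgroup_axioms] assms(3,4) by simp
  qed
  moreover have "x \<in> H +>\<^bsub>M\<^esub> x"
    by (rule A.a_rcos_self[OF assms(4)])
  ultimately have "(\<Union>y\<in>H +>\<^bsub>M\<^esub> x. H +>\<^bsub>M\<^esub> (a \<odot>\<^bsub>M\<^esub> y)) = H +>\<^bsub>M\<^esub> (a \<odot>\<^bsub>M\<^esub> x)"
    by blast
  then show ?thesis
    by (simp add: quotient_module_def)
qed

lemma quotient_carrier:
  "carrier (quotient_module M H) = (\<lambda>x. H +>\<^bsub>M\<^esub> x) ` carrier M"
  by (auto simp: quotient_module_def A_RCOSETS_defs a_r_coset_def)

lemma quotient_proj_hom: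
  assumes "module R M" "submodule H R M"
  shows "(\<lambda>x. H +>\<^bsub>M\<^esub> x) \<in> mod_hom R M (quotient_module M H)"
  using quotient_add[OF assms] quotient_smult[OF assms] by (auto intro!: mod_homI simp: quotient_carrier)

lemma quotient_zero:
  assumes "module R M" "submodule H R M"
  shows "\<zero>\<^bsub>quotient_module M H\<^esub> = H +>\<^bsub>M\<^esub> \<zero>\<^bsub>M\<^esub>"
proof -
  interpret A: abelian_subgroup H M by (rule submodule_abelian_subgroup[OF assms])
  show ?thesis
    using A.a_rcos_const[OF additive_subgroup.zero_closed[OF A.additive_subgroup_axioms]] by (simp add: quotient_module_def)
qed

lemma module_quotient:
  assumes "module R M" "submodule H R M"
  shows "module R (quotient_module M H)"
proof -
  interpret module R M by fact
  interpret H: submodule H R M by fact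
  let ?Q = "quotient_module M H"
  note q = quotient_add[OF assms] quotient_smult[OF assms] quotient_zero[OF assms]
  have "abelian_group ?Q"
  proof (rule abelian_groupI)
    fix K assume "K \<in> carrier ?Q"
    then obtain x where x: "x \<in> carrier M" "K = H +>\<^bsub>M\<^esub> x"
      by (auto simp: quotient_carrier)
    show "\<exists>K'\<in>carrier ?Q. K' \<oplus>\<^bsub>?Q\<^esub> K = \<zero>\<^bsub>?Q\<^esub>"
      by (rule bexI[of _ "H +>\<^bsub>M\<^esub> (\<ominus>\<^bsub>M\<^esub> x)"]) (use x in \<open>simp_all add: quotient_carrier q M.l_neg\<close>)
    fix K' assume "K' \<in> carrier ?Q"
    then obtain y where y: "y \<in> carrier M" "K' = H +>\<^bsub>M\<^esub> y"
      by (auto simp: quotient_carrier)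
    show "K \<oplus>\<^bsub>?Q\<^esub> K' = K' \<oplus>\<^bsub>?Q\<^esub> K"
      using x y by (simp add: q M.a_comm)
  qed (auto simp: quotient_carrier q M.a_assoc)
  then show ?thesis
    by (rule moduleI[OF R.is_cring])
      (auto simp: quotient_carrier q smult_l_distr smult_r_distr smult_assoc1)
qed

lemma quotient_hom_eqI:
  assumes "f \<in> mod_hom R (quotient_module M H) N" "g \<in> mod_hom R (quotient_module M H) N"
    and "\<And>x. x \<in> carrier M \<Longrightarrow> f (H +>\<^bsub>M\<^esub> x) = g (H +>\<^bsub>M\<^esub> x)"
    and "K \<in> carrier (quotient_module M H)"
  shows "f K = g K"
  using assms by (auto simp: quotient_carrier)

text \<open>\<open>f\<close> vanishes on \<open>H\<close>, so it is constant on cosets and the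
  choice of the representative is immaterial.\<close>

lemma mod_hom_some_coset:
  assumes "module R M" "module R N" "submodule H R M" "f \<in> mod_hom R M N"
    and "\<And>h. h \<in> H \<Longrightarrow> f h = \<zero>\<^bsub>N\<^esub>" and x: "x \<in> carrier M"
  shows "f (SOME c. c \<in> H +>\<^bsub>M\<^esub> x) = f x"
proof -
  interpret N: module R N by fact
  interpret A: abelian_subgroup H M by (rule submodule_abelian_subgroup[OF assms(1,3)])
  have "(SOME c. c \<in> H +>\<^bsub>M\<^esub> x) \<in> H +>\<^bsub>M\<^esub> x"
    by (rule someI[of _ x]) (rule A.a_rcos_self[OF x])
  then obtain h where h: "h \<in> H" "(SOME c. c \<in> H +>\<^bsub>M\<^esub> x) = h \<oplus>\<^bsub>M\<^esub> x"
    by (auto simp: a_r_coset_def')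
  then show ?thesis
    using assms(5)[OF h(1)] mod_hom_add[OF assms(4) _ x, of h] mod_hom_closed[OF assms(4) x] A.a_Hcarr
    by simp
qed

text \<open>Existence half of the universal property of the quotient, in the form in which
  \<open>tensor_ext\<close> uses it.\<close>

lemma quotient_ext_hom:
  assumes "module R M" "module R N" "submodule H R M" "f \<in> mod_hom R M N"
    and "\<And>h. h \<in> H \<Longrightarrow> f h = \<zero>\<^bsub>N\<^esub>"
  shows "(\<lambda>K. f (SOME c. c \<in> K)) \<in> mod_hom R (quotient_module M H) N"
proof -
  interpret M: module R M by fact
  note s = mod_hom_some_coset[OF assms] and f = mod_hom_add[OF assms(4)] mod_hom_smult[OF assms(4)]
  show ?thesis
    using mod_hom_closed[OF assms(4)]
    by (intro mod_homI)
      (auto simp: quotient_carrier s f quotient_add[OF assms(1,3)] quotient_smult[OF assms(1,3)])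
qed

section \<open>Tensor products\<close>

lemma tensor_gens_iff:
  "vs \<in> tensor_gens Ms \<longleftrightarrow> length vs = length Ms \<and> (\<forall>i<length Ms. vs ! i \<in> carrier (Ms ! i))"
proof (induction Ms arbitrary: vs)
  case Nil
  then show ?case by (simp add: tensor_gens_def)
next
  case (Cons M Ms)
  show ?case
  proof (cases vs)
    case Nil
    then show ?thesis by (simp add: tensor_gens_def set_Cons_def)
  next
    case (Cons v vs')
    have "vs \<in> tensor_gens (M # Ms) \<longleftrightarrow> v \<in> carrier M \<and> vs' \<in> tensor_gens Ms"
      by (simp add: tensor_gens_def set_Cons_def Cons)
    then show ?thesis
      by (auto simp: Cons.IH Cons All_less_Suc2)
  qed
qed

lemma tensor_gens_update:
  "\<lbrakk>vs \<in> tensor_gens Ms; i < length Ms; x \<in> carrier (Ms ! i)\<rbrakk> \<Longrightarrow> vs[i := x] \<in> tensor_gens Ms"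
  by (auto simp: tensor_gens_iff nth_list_update)

text \<open>Freezing all entries but one is phrased by list update. The separate closure clause
  covers the empty list, which has no slot.\<close>

definition multilinear ::
  "('r, 'z) ring_scheme \<Rightarrow> ('r, 'v) module list \<Rightarrow> ('r, 'w) module \<Rightarrow> ('v list \<Rightarrow> 'w) \<Rightarrow> bool" where
  "multilinear R Ms N g \<longleftrightarrow>
     (\<forall>vs\<in>tensor_gens Ms. g vs \<in> carrier N) \<and>
     (\<forall>vs\<in>tensor_gens Ms. \<forall>i<length Ms. (\<lambda>x. g (vs[i := x])) \<in> mod_hom R (Ms ! i) N)"

lemma multilinear_closed: "\<lbrakk>multilinear R Ms N g; vs \<in> tensor_gens Ms\<rbrakk> \<Longrightarrow> g vs \<in> carrier N"
  by (simp add: multilinear_def)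

lemma multilinear_hom:
  "\<lbrakk>multilinear R Ms N g; vs \<in> tensor_gens Ms; i < length Ms\<rbrakk>
    \<Longrightarrow> (\<lambda>x. g (vs[i := x])) \<in> mod_hom R (Ms ! i) N"
  by (simp add: multilinear_def)

lemma multilinear_comp_hom:
  assumes "multilinear R Ms N g" "f \<in> mod_hom R N N'"
  shows "multilinear R Ms N' (\<lambda>vs. f (g vs))"
  using multilinear_closed[OF assms(1)] mod_hom_closed[OF assms(2)]
    mod_hom_comp[OF assms(2) multilinear_hom[OF assms(1)]]
  unfolding multilinear_def by blast

lemma tensor_rels_cases:
  assumes "r \<in> tensor_rels R Ms"
  obtains
    (add) vs i x y where "vs \<in> tensor_gens Ms" "i < length Ms" "x \<in> carrier (Ms ! i)" "y \<in> carrier (Ms ! i)"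
      "r = free_basis R (tensor_gens Ms) (vs[i := x \<oplus>\<^bsub>Ms ! i\<^esub> y])
        \<ominus>\<^bsub>free_module R (tensor_gens Ms)\<^esub> (free_basis R (tensor_gens Ms) (vs[i := x])
          \<oplus>\<^bsub>free_module R (tensor_gens Ms)\<^esub> free_basis R (tensor_gens Ms) (vs[i := y]))"
  | (smult) vs i a x where "vs \<in> tensor_gens Ms" "i < length Ms" "a \<in> carrier R" "x \<in> carrier (Ms ! i)"
      "r = free_basis R (tensor_gens Ms) (vs[i := a \<odot>\<^bsub>Ms ! i\<^esub> x])
        \<ominus>\<^bsub>free_module R (tensor_gens Ms)\<^esub> a \<odot>\<^bsub>free_module R (tensor_gens Ms)\<^esub>
          free_basis R (tensor_gens Ms) (vs[i := x])"
  using assms unfolding tensor_rels_def Let_def by blast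

context
  fixes R :: "('r, 'z) ring_scheme" and Ms :: "('r, 'v) module list"
  assumes cring: "cring R" and modules: "\<And>i. i < length Ms \<Longrightarrow> module R (Ms ! i)"
begin

private abbreviation (input) "G \<equiv> tensor_gens Ms"
private abbreviation (input) "F \<equiv> free_module R (tensor_gens Ms)"
private abbreviation (input) "e \<equiv> free_basis R (tensor_gens Ms)"

private lemma basis_update:
  "\<lbrakk>vs \<in> G; i < length Ms; x \<in> carrier (Ms ! i)\<rbrakk> \<Longrightarrow> e (vs[i := x]) \<in> carrier F"
  by (intro free_basis_closed cring tensor_gens_update)

private lemma update_closed:
  assumes "i < length Ms" "x \<in> carrier (Ms ! i)"
  shows "y \<in> carrier (Ms ! i) \<Longrightarrow> x \<oplus>\<^bsub>Ms ! i\<^esub> y \<in> carrier (Ms ! i)"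
    "a \<in> carrier R \<Longrightarrow> a \<odot>\<^bsub>Ms ! i\<^esub> x \<in> carrier (Ms ! i)"
proof -
  interpret module R "Ms ! i" by (rule modules[OF assms(1)])
  show "y \<in> carrier (Ms ! i) \<Longrightarrow> x \<oplus>\<^bsub>Ms ! i\<^esub> y \<in> carrier (Ms ! i)"
    "a \<in> carrier R \<Longrightarrow> a \<odot>\<^bsub>Ms ! i\<^esub> x \<in> carrier (Ms ! i)"
    using assms by auto
qed

lemma tensor_rels_subset: "tensor_rels R Ms \<subseteq> carrier F"
proof
  interpret F: module R F by (rule module_free[OF cring])
  fix r assume "r \<in> tensor_rels R Ms"
  then show "r \<in> carrier F"
    by (cases rule: tensor_rels_cases) (auto intro!: F.M.minus_closed F.M.a_closed F.smult_closed basis_update update_closed)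
qed

lemma tensor_ker_submodule: "submodule (tensor_ker R Ms) R F"
  unfolding tensor_ker_def by (intro submodule_span module_free cring tensor_rels_subset)

lemma module_tensor: "module R (tensor R Ms)"
  unfolding tensor_def by (intro module_quotient module_free cring tensor_ker_submodule)

lemma tensor_proj_hom: "(\<lambda>x. tensor_ker R Ms +>\<^bsub>F\<^esub> x) \<in> mod_hom R F (tensor R Ms)"
  unfolding tensor_def by (intro quotient_proj_hom module_free cring tensor_ker_submodule)

text \<open>Pure tensors are the classes of the free basis: a map out of the quotient is determined
  by its pullback to the free module, and that by its values on the basis.\<close>

lemma tensor_hom_eqI:
  assumes "module R N" "f \<in> mod_hom R (tensor R Ms) N" "g \<in> mod_hom R (tensor R Ms) N"
    and "\<And>vs. vs \<in> tensor_gens Ms \<Longrightarrow> f (pure_tensor R Ms vs) = g (pure_tensor R Ms vs)"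
    and "K \<in> carrier (tensor R Ms)"
  shows "f K = g K"
proof -
  have "f (tensor_ker R Ms +>\<^bsub>F\<^esub> x) = g (tensor_ker R Ms +>\<^bsub>F\<^esub> x)" if "x \<in> carrier F" for x
    by (rule free_module_hom_eqI[OF cring assms(1) mod_hom_comp[OF assms(2) tensor_proj_hom]
        mod_hom_comp[OF assms(3) tensor_proj_hom] _ that])
      (use assms(4) in \<open>simp add: pure_tensor_def\<close>)
  then show ?thesis
    by (rule quotient_hom_eqI[OF assms(2,3)[unfolded tensor_def] _ assms(5)[unfolded tensor_def]])
qed

text \<open>The submodule divided out contains every failure of additivity and of homogeneity in a
  slot, so both sides of each law have the same class.\<close>

lemma multilinear_pure_tensor: "multilinear R Ms (tensor R Ms) (pure_tensor R Ms)"
proof -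
  interpret F: module R F by (rule module_free[OF cring])
  interpret S: submodule "tensor_ker R Ms" R F by (rule tensor_ker_submodule)
  have rel: "tensor_ker R Ms +>\<^bsub>F\<^esub> u = tensor_ker R Ms +>\<^bsub>F\<^esub> w"
    if "u \<ominus>\<^bsub>F\<^esub> w \<in> tensor_rels R Ms" "u \<in> carrier F" "w \<in> carrier F" for u w
  proof -
    have "u \<ominus>\<^bsub>F\<^esub> w \<in> tensor_ker R Ms"
      using subsetD[OF submodule_span_superset that(1)] unfolding tensor_ker_def .
    moreover have "u = (u \<ominus>\<^bsub>F\<^esub> w) \<oplus>\<^bsub>F\<^esub> w"
      using that(2,3) by (simp add: F.M.minus_eq F.M.a_assoc F.M.l_neg)
    ultimately have "u \<in> tensor_ker R Ms +>\<^bsub>F\<^esub> w"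
      by (auto simp: a_r_coset_def')
    then show ?thesis
      using F.M.a_repr_independence[OF _ that(3) S.subgroup_axioms] by simp
  qed
  show ?thesis
    unfolding multilinear_def
  proof (intro conjI ballI allI impI)
    show "pure_tensor R Ms vs \<in> carrier (tensor R Ms)" if "vs \<in> G" for vs
      unfolding pure_tensor_def by (intro mod_hom_closed[OF tensor_proj_hom] free_basis_closed cring that)
  next
    fix vs i assume vs: "vs \<in> G" and i: "i < length Ms"
    note b = basis_update[OF vs i] and c = update_closed[OF i]
    show "(\<lambda>x. pure_tensor R Ms (vs[i := x])) \<in> mod_hom R (Ms ! i) (tensor R Ms)"
    proof (rule mod_homI)
      show "pure_tensor R Ms (vs[i := x]) \<in> carrier (tensor R Ms)" if "x \<in> carrier (Ms ! i)" for x
        unfolding pure_tensor_def by (intro mod_hom_closed[OF tensor_proj_hom] b that)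
    next
      fix x y assume x: "x \<in> carrier (Ms ! i)" and y: "y \<in> carrier (Ms ! i)"
      have "tensor_ker R Ms +>\<^bsub>F\<^esub> e (vs[i := x \<oplus>\<^bsub>Ms ! i\<^esub> y])
          = tensor_ker R Ms +>\<^bsub>F\<^esub> (e (vs[i := x]) \<oplus>\<^bsub>F\<^esub> e (vs[i := y]))"
      proof (rule rel)
        show "e (vs[i := x \<oplus>\<^bsub>Ms ! i\<^esub> y]) \<ominus>\<^bsub>F\<^esub> (e (vs[i := x]) \<oplus>\<^bsub>F\<^esub> e (vs[i := y])) \<in> tensor_rels R Ms"
          unfolding tensor_rels_def Let_def using vs i x y by blast
      qed (use x y in \<open>auto intro!: b c F.M.a_closed\<close>)
      then show "pure_tensor R Ms (vs[i := x \<oplus>\<^bsub>Ms ! i\<^esub> y])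
          = pure_tensor R Ms (vs[i := x]) \<oplus>\<^bsub>tensor R Ms\<^esub> pure_tensor R Ms (vs[i := y])"
        unfolding pure_tensor_def by (simp add: mod_hom_add[OF tensor_proj_hom] b x y)
    next
      fix a x assume a: "a \<in> carrier R" and x: "x \<in> carrier (Ms ! i)"
      have "tensor_ker R Ms +>\<^bsub>F\<^esub> e (vs[i := a \<odot>\<^bsub>Ms ! i\<^esub> x])
          = tensor_ker R Ms +>\<^bsub>F\<^esub> (a \<odot>\<^bsub>F\<^esub> e (vs[i := x]))"
      proof (rule rel)
        show "e (vs[i := a \<odot>\<^bsub>Ms ! i\<^esub> x]) \<ominus>\<^bsub>F\<^esub> (a \<odot>\<^bsub>F\<^esub> e (vs[i := x])) \<in> tensor_rels R Ms"
          unfolding tensor_rels_def Let_def using vs i x a by blast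
      qed (use x a in \<open>auto intro!: b c F.smult_closed\<close>)
      then show "pure_tensor R Ms (vs[i := a \<odot>\<^bsub>Ms ! i\<^esub> x])
          = a \<odot>\<^bsub>tensor R Ms\<^esub> pure_tensor R Ms (vs[i := x])"
        unfolding pure_tensor_def by (simp add: mod_hom_smult[OF tensor_proj_hom] b x a)
    qed
  qed
qed

section \<open>The universal property of the tensor product\<close>

context
  fixes N :: "('r, 'w) module" and g :: "'v list \<Rightarrow> 'w"
  assumes modN: "module R N" and g: "multilinear R Ms N g"
begin

private abbreviation (input) "free_ext \<equiv> direct_sum_ext G (\<lambda>_. regular_module R) N (\<lambda>vs a. a \<odot>\<^bsub>N\<^esub> g vs)"

private lemma free_ext_hom: "free_ext \<in> mod_hom R F N"
  unfolding free_module_def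
  by (intro direct_sum_ext_hom cring module_regular regular_module_hom modN multilinear_closed[OF g])

private lemma free_ext_basis:
  assumes "vs \<in> G"
  shows "free_ext (e vs) = g vs"
proof -
  interpret N: module R N by (rule modN)
  have "\<one>\<^bsub>R\<^esub> \<in> carrier (regular_module R)"
    by (simp add: regular_module_def)
  then have "free_ext (e vs) = \<one>\<^bsub>R\<^esub> \<odot>\<^bsub>N\<^esub> g vs"
    unfolding free_basis_def
    by (intro direct_sum_ext_inj[of G R "\<lambda>_. regular_module R"] module_regular cring modN
        regular_module_hom multilinear_closed[OF g] assms)
  then show ?thesis
    using multilinear_closed[OF g assms] by simp
qed

text \<open>By multilinearity of \<open>g\<close> the two members of each relation have the same
  image, so the relations are killed, and with them the submodule that they span.\<close>

private lemma free_ext_ker: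
  assumes "k \<in> tensor_ker R Ms"
  shows "free_ext k = \<zero>\<^bsub>N\<^esub>"
proof (rule mod_hom_span_zero[OF module_free[OF cring] modN free_ext_hom tensor_rels_subset _
      assms[unfolded tensor_ker_def]])
  interpret N: module R N by (rule modN)
  interpret F: module R F by (rule module_free[OF cring])
  have minus: "free_ext (u \<ominus>\<^bsub>F\<^esub> w) = \<zero>\<^bsub>N\<^esub>"
    if u: "u \<in> carrier F" and w: "w \<in> carrier F" and eq: "free_ext u = free_ext w" for u w
  proof -
    have "free_ext u = free_ext ((u \<ominus>\<^bsub>F\<^esub> w) \<oplus>\<^bsub>F\<^esub> w)"
      using u w by (simp add: F.M.minus_eq F.M.a_assoc F.M.l_neg)
    also have "\<dots> = free_ext (u \<ominus>\<^bsub>F\<^esub> w) \<oplus>\<^bsub>N\<^esub> free_ext w"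
      using u w by (intro mod_hom_add[OF free_ext_hom]) auto
    finally show ?thesis
      using eq mod_hom_closed[OF free_ext_hom] u w by (simp add: N.M.add.l_cancel_one')
  qed
  fix r assume "r \<in> tensor_rels R Ms"
  then show "free_ext r = \<zero>\<^bsub>N\<^esub>"
  proof (cases rule: tensor_rels_cases)
    case (add vs i x y)
    note b = basis_update[OF add(1,2)] and c = update_closed[OF add(2)]
      and m = multilinear_hom[OF g add(1,2)] and u = tensor_gens_update[OF add(1,2)]
    show ?thesis
      unfolding add(5)
      by (rule minus)
        (use add in \<open>simp_all add: b c mod_hom_add[OF free_ext_hom] free_ext_basis u mod_hom_add[OF m]\<close>)
  next
    case (smult vs i a x)
    note b = basis_update[OF smult(1,2)] and c = update_closed[OF smult(2)]
      and m = multilinear_hom[OF g smult(1,2)] and u = tensor_gens_update[OF smult(1,2)]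
    show ?thesis
      unfolding smult(5)
      by (rule minus)
        (use smult in \<open>simp_all add: b c mod_hom_smult[OF free_ext_hom] free_ext_basis u mod_hom_smult[OF m]\<close>)
  qed
qed

lemma tensor_ext_hom: "tensor_ext R Ms N g \<in> mod_hom R (tensor R Ms) N"
  unfolding tensor_ext_def tensor_def
  by (intro quotient_ext_hom module_free cring modN tensor_ker_submodule free_ext_hom free_ext_ker)

lemma tensor_ext_pure:
  assumes "vs \<in> tensor_gens Ms"
  shows "tensor_ext R Ms N g (pure_tensor R Ms vs) = g vs"
  unfolding tensor_ext_def pure_tensor_def
  using free_ext_basis[OF assms]
    mod_hom_some_coset[OF module_free[OF cring] modN tensor_ker_submodule free_ext_hom free_ext_ker
      free_basis_closed[OF cring assms]] by simp

end

end

section \<open>Contraction of neighbouring factors\<close>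

lemma length_contract: "i + 1 < length xs \<Longrightarrow> length (contract i c xs) = length xs - 1"
  by (simp add: contract_def)

lemma contract_nth:
  assumes "i + 1 < length xs" "k < length xs - 1"
  shows "contract i c xs ! k = (if k < i then xs ! k else if k = i then c else xs ! Suc k)"
proof -
  consider "k < i" | "k = i" | k' where "k = Suc (i + k')"
    by (metis less_iff_Suc_add linorder_neqE_nat)
  then show ?thesis
    by cases (use assms in \<open>auto simp: contract_def nth_append\<close>)
qed

text \<open>Sorted by the place of the changed entry: left of the merged pair, inside it, or right
  of it, where the index drops by one because two entries have become one. The last clause changes
  the merged entry itself.\<close>

lemma contract_update:
  assumes "i + 1 < length xs"
  shows "k < i \<Longrightarrow> contract i c (xs[k := x]) = (contract i c xs)[k := x]"
    "contract i c (xs[i := x]) = contract i c xs"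
    "contract i c (xs[Suc i := x]) = contract i c xs"
    "i < k \<Longrightarrow> contract i c (xs[Suc k := x]) = (contract i c xs)[k := x]"
    "(contract i c xs)[i := d] = contract i d xs"
proof -
  show "i < k \<Longrightarrow> contract i c (xs[Suc k := x]) = (contract i c xs)[k := x]"
    using assms
    by (cases "Suc k < length xs")
      (auto intro!: nth_equalityI simp: length_contract contract_nth nth_list_update list_update_beyond)
qed (use assms in \<open>auto intro!: nth_equalityI simp: length_contract contract_nth nth_list_update\<close>)

text \<open>The two pairs are disjoint; the right one moves down by one place once the left one has
  been merged.\<close>

lemma contract_contract_far:
  assumes "Suc i < j" "j + 1 < length xs"
  shows "contract i a (contract j b xs) = contract (j - 1) b (contract i a xs)"
  using assms by (auto intro!: nth_equalityI simp: length_contract contract_nth)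

text \<open>Both sides replace the three entries from position \<open>i\<close> on by the single
  entry \<open>a\<close>, so the intermediate values \<open>b\<close> and \<open>c\<close> leave no
  trace.\<close>

lemma contract_contract_near:
  assumes "i + 2 < length xs"
  shows "contract i a (contract (Suc i) b xs) = contract i a (contract i c xs)"
  using assms by (auto intro!: nth_equalityI simp: length_contract contract_nth)

lemma map2_contract:
  assumes "length xs = length ys" "i + 1 < length xs"
  shows "map2 f (contract i a xs) (contract i b ys) = contract i (f a b) (map2 f xs ys)"
  using assms by (auto intro!: nth_equalityI simp: length_contract contract_nth)

text \<open>This is why faces preserve the internal degree.\<close>

lemma sum_list_contract:
  fixes xs :: "int list"
  assumes "i + 1 < length xs"
  shows "sum_list (contract i (xs ! i + xs ! (i + 1)) xs) = sum_list xs"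
proof -
  have "xs = take i xs @ xs ! i # xs ! (i + 1) # drop (i + 2) xs"
    using assms by (metis Suc_eq_plus1 Suc_lessD add_2_eq_Suc' append_take_drop_id Cons_nth_drop_Suc)
  then have "sum_list xs = sum_list (take i xs @ xs ! i # xs ! (i + 1) # drop (i + 2) xs)"
    by simp
  then show ?thesis
    by (simp add: contract_def)
qed

lemma contract_degree_lists:
  assumes "ds \<in> degree_lists (Suc k) d" "i < k"
  shows "contract i (ds ! i + ds ! (i + 1)) ds \<in> degree_lists k d"
  using assms sum_list_contract[of i ds] by (simp add: degree_lists_def length_contract)

lemma length_homog_parts: "length (homog_parts As ds) = min (length As) (length ds)"
  by (simp add: homog_parts_def)

lemma homog_parts_nth:
  "\<lbrakk>k < length As; k < length ds\<rbrakk> \<Longrightarrow> homog_parts As ds ! k = (As ! k) (ds ! k)"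
  by (simp add: homog_parts_def)

lemma homog_parts_contract:
  "\<lbrakk>length As = length ds; i + 1 < length ds\<rbrakk>
    \<Longrightarrow> homog_parts (contract i A As) (contract i d ds) = contract i (A d) (homog_parts As ds)"
  by (simp add: homog_parts_def map2_contract)

lemma bilinear_map_closed:
  "\<lbrakk>bilinear_map R U V W b; x \<in> carrier U; y \<in> carrier V\<rbrakk> \<Longrightarrow> b x y \<in> carrier W"
  unfolding bilinear_map_def using mod_hom_closed by metis

text \<open>The structure operations take the right factor first, whereas tensor factors are listed
  from left to right.\<close>

lemma bilinear_map_flip:
  "bilinear_map R U V W b \<Longrightarrow> bilinear_map R V U W (\<lambda>x y. b y x)"
  by (auto simp: bilinear_map_def)

lemma tensor_gens_contract:
  assumes "vs \<in> tensor_gens Ms" "i + 1 < length Ms" "c \<in> carrier A"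
  shows "contract i c vs \<in> tensor_gens (contract i A Ms)"
  using assms by (auto simp: tensor_gens_iff length_contract contract_nth)

text \<open>The source of the well-definedness of faces. A change outside the pair is a change of
  one entry of the contracted list; a change inside it reaches the merged entry through one argument
  of \<open>b\<close>, hence linearly.\<close>

lemma multilinear_contract:
  assumes g: "multilinear R (contract i A Ms) N g"
    and b: "bilinear_map R (Ms ! i) (Ms ! (i + 1)) A b" and i: "i + 1 < length Ms"
  shows "multilinear R Ms N (\<lambda>vs. g (contract i (b (vs ! i) (vs ! (i + 1))) vs))"
  unfolding multilinear_def
proof (intro conjI ballI allI impI)
  have closed: "contract i (b (vs ! i) (vs ! (i + 1))) vs \<in> tensor_gens (contract i A Ms)"
    if "vs \<in> tensor_gens Ms" for vs
    using that i by (intro tensor_gens_contract bilinear_map_closed[OF b]) (auto simp: tensor_gens_iff)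
  then show "g (contract i (b (vs ! i) (vs ! (i + 1))) vs) \<in> carrier N" if "vs \<in> tensor_gens Ms" for vs
    using that by (intro multilinear_closed[OF g])
  fix vs k assume vs: "vs \<in> tensor_gens Ms" and k: "k < length Ms"
  have len: "length vs = length Ms" and v: "\<And>j. j < length Ms \<Longrightarrow> vs ! j \<in> carrier (Ms ! j)"
    using vs by (auto simp: tensor_gens_iff)
  note hom = multilinear_hom[OF g closed[OF vs], unfolded length_contract[OF i]]
  note upd = contract_update[of i vs, unfolded len, OF i]
  \<comment> \<open>Entries right of the pair have their index lowered by one, hence the form
    \<open>Suc k'\<close>.\<close>
  consider "k < i" | "k = i" | "k = Suc i" | k' where "k = Suc k'" "i < k'"
    by (metis Suc_lessE Suc_lessI linorder_neqE_nat)
  then show "(\<lambda>x. g (contract i (b (vs[k := x] ! i) (vs[k := x] ! (i + 1))) (vs[k := x])))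
      \<in> mod_hom R (Ms ! k) N"
  proof cases
    case 1
    then show ?thesis
      using hom[of k] i k by (simp add: upd contract_nth)
  next
    case 2
    have "(\<lambda>x. b x (vs ! (i + 1))) \<in> mod_hom R (Ms ! i) A"
      using b v[OF i] by (simp add: bilinear_map_def)
    then show ?thesis
      using mod_hom_comp[OF hom[of i], of "\<lambda>x. b x (vs ! (i + 1))" "Ms ! i"] i 2 len
      by (simp add: upd contract_nth)
  next
    case 3
    have "b (vs ! i) \<in> mod_hom R (Ms ! (i + 1)) A"
      using b v[of i] i by (simp add: bilinear_map_def)
    then show ?thesis
      using mod_hom_comp[OF hom[of i], of "b (vs ! i)" "Ms ! (i + 1)"] i 3 len
      by (simp add: upd contract_nth)
  next
    case 4
    then show ?thesis
      using hom[of k'] i k by (simp add: upd contract_nth)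
  qed
qed

section \<open>Towers\<close>

lemma towersD:
  assumes "(Ts, fs, \<alpha>) \<in> towers C M L n"
  shows "length Ts = Suc n" "length fs = n" "\<And>i. i \<le> n \<Longrightarrow> Ts ! i \<in> obj C"
    "\<And>i. i < n \<Longrightarrow> fs ! i \<in> homs C (Ts ! Suc i) (Ts ! i)" "\<alpha> \<in> larrs M L (Ts ! n)"
  using assms by (auto simp: towers_def subset_iff)

lemma length_tower_factors:
  "\<tau> \<in> towers C M L n \<Longrightarrow> length (tower_factors C M p x \<tau>) = n + 2"
  by (auto simp: towers_def tower_factors_def)

lemma tower_factors_nth:
  assumes "(Ts, fs, \<alpha>) \<in> towers C M L n"
  shows "tower_factors C M p x (Ts, fs, \<alpha>) ! 0 = p (Ts ! 0)"
    "i < n \<Longrightarrow> tower_factors C M p x (Ts, fs, \<alpha>) ! Suc i = p (fib C (fs ! i))"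
    "tower_factors C M p x (Ts, fs, \<alpha>) ! Suc n = x (lfib M \<alpha>)"
proof -
  have "Ts \<noteq> []" "length fs = n"
    using towersD(1,2)[OF assms] by auto
  then show "tower_factors C M p x (Ts, fs, \<alpha>) ! 0 = p (Ts ! 0)"
    "i < n \<Longrightarrow> tower_factors C M p x (Ts, fs, \<alpha>) ! Suc i = p (fib C (fs ! i))"
    "tower_factors C M p x (Ts, fs, \<alpha>) ! Suc n = x (lfib M \<alpha>)"
    by (simp_all add: tower_factors_def nth_append hd_conv_nth)
qed

text \<open>One index formula for the three kinds of deletion. For \<open>i = 0\<close> every index
  shifts; for \<open>i = Suc n\<close> the bound \<open>k < n\<close> stays below the composite, so
  the last map is just dropped.\<close>

lemma del_tower_nth:
  assumes "(Ts, fs, \<alpha>) \<in> towers C M L (Suc n)" "i \<le> Suc n"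
    and "del_tower C M i (Ts, fs, \<alpha>) = (Ts', fs', \<alpha>')"
  shows "length Ts' = Suc n" "length fs' = n"
    "\<And>k. k \<le> n \<Longrightarrow> Ts' ! k = Ts ! (if k < i then k else Suc k)"
    "\<And>k. k < n \<Longrightarrow> fs' ! k = (if Suc k < i then fs ! k else if Suc k = i then fs ! k \<cdot>\<^bsub>C\<^esub> fs ! Suc k else fs ! Suc k)"
    "\<alpha>' = (if i = Suc n then act M (fs ! n) \<alpha> else \<alpha>)"
proof -
  note t = towersD[OF assms(1)]
  have eq: "Ts' = take i Ts @ drop (Suc i) Ts"
    "fs' = (if i = 0 then tl fs
      else if i < Suc n then take (i - 1) fs @ [fs ! (i - 1) \<cdot>\<^bsub>C\<^esub> fs ! i] @ drop (Suc i) fs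
      else butlast fs)"
    "\<alpha>' = (if i = Suc n then act M (last fs) \<alpha> else \<alpha>)"
    using assms(3) t(1,2) by (auto simp: del_tower_def)
  show "length Ts' = Suc n"
    using eq(1) t(1) assms(2) by simp
  show "length fs' = n"
    using eq(2) t(2) assms(2) by auto
  show "Ts' ! k = Ts ! (if k < i then k else Suc k)" if "k \<le> n" for k
    using eq(1) t(1) assms(2) that by (auto simp: nth_append)
  show "fs' ! k = (if Suc k < i then fs ! k else if Suc k = i then fs ! k \<cdot>\<^bsub>C\<^esub> fs ! Suc k else fs ! Suc k)"
    if "k < n" for k
  proof (cases "i = 0 \<or> i = Suc n")
    case True
    then show ?thesis
      using eq(2) t(2) that by (auto simp: nth_tl nth_butlast)
  next
    case False
    \<comment> \<open>The two maps that meet at the deleted object have the indices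
      \<open>i - 1\<close> and \<open>i\<close>, so composing them contracts the list at
      \<open>i - 1\<close>.\<close>
    then have "fs' = contract (i - 1) (fs ! (i - 1) \<cdot>\<^bsub>C\<^esub> fs ! i) fs"
      using eq(2) assms(2) by (simp add: contract_def)
    then show ?thesis
      using False that t(2) assms(2) by (auto simp: contract_nth)
  qed
  show "\<alpha>' = (if i = Suc n then act M (fs ! n) \<alpha> else \<alpha>)"
    using eq(3) t(2) by (metis diff_Suc_1 last_conv_nth length_0_conv nat.distinct(1))
qed

lemma face_op_eqs:
  assumes "length fs = Suc n"
  shows "face_op C M P X 0 (Ts, fs, \<alpha>) a b u w = gam P (fs ! 0) b a w u"
    "i < n \<Longrightarrow> face_op C M P X (Suc i) (Ts, fs, \<alpha>) a b u w = gam P (ind C (fs ! Suc i) (fs ! i)) b a w u"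
    "face_op C M P X (Suc n) (Ts, fs, \<alpha>) a b u w = nu X (lind M \<alpha> (fs ! n)) b a w u"
proof -
  have "last fs = fs ! n"
    using assms by (metis diff_Suc_1 last_conv_nth length_0_conv nat.distinct(1))
  then show "face_op C M P X 0 (Ts, fs, \<alpha>) a b u w = gam P (fs ! 0) b a w u"
    "i < n \<Longrightarrow> face_op C M P X (Suc i) (Ts, fs, \<alpha>) a b u w = gam P (ind C (fs ! Suc i) (fs ! i)) b a w u"
    "face_op C M P X (Suc n) (Ts, fs, \<alpha>) a b u w = nu X (lind M \<alpha> (fs ! n)) b a w u"
    using assms by (simp_all add: face_op_def)
qed

context left_operadic_module
begin

lemma del_tower_closed:
  assumes "\<tau> \<in> towers C M L (Suc n)" "i \<le> Suc n"
  shows "del_tower C M i \<tau> \<in> towers C M L n"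
proof -
  obtain Ts fs \<alpha> Ts' fs' \<alpha>' where \<tau>: "\<tau> = (Ts, fs, \<alpha>)" and d: "del_tower C M i (Ts, fs, \<alpha>) = (Ts', fs', \<alpha>')"
    by (metis prod_cases3)
  note t = towersD[OF assms(1)[unfolded \<tau>]] and del = del_tower_nth[OF assms(1)[unfolded \<tau>] assms(2) d]
  have "set Ts' \<subseteq> obj C"
    using t(3) del(1,3) by (auto simp: in_set_conv_nth)
  moreover have "fs' ! k \<in> homs C (Ts' ! Suc k) (Ts' ! k)" if k: "k < n" for k
    using t(4)[of k] t(4)[of "Suc k"] k cmp_hom by (auto simp: del)
  moreover have "\<alpha>' \<in> larrs M L (Ts' ! n)"
    using t(5) t(4)[of n] assms(2) act_larr by (auto simp: del)
  ultimately show ?thesis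
    using del(1,2) unfolding \<tau> d by (simp add: towers_def)
qed

text \<open>The case of interest is that of adjacent objects: three consecutive maps are composed in
  two ways, or, at the top, two maps act on the arrow one after the other or through their
  composite.\<close>

lemma del_del_tower:
  assumes "\<tau> \<in> towers C M L (Suc (Suc n))" "i < j" "j \<le> Suc (Suc n)"
  shows "del_tower C M i (del_tower C M j \<tau>) = del_tower C M (j - 1) (del_tower C M i \<tau>)"
proof -
  obtain Ts fs \<alpha> where \<tau>: "\<tau> = (Ts, fs, \<alpha>)"
    by (metis prod_cases3)
  obtain T1 f1 \<alpha>1 T2 f2 \<alpha>2 where 1: "del_tower C M j (Ts, fs, \<alpha>) = (T1, f1, \<alpha>1)"
      and 2: "del_tower C M i (T1, f1, \<alpha>1) = (T2, f2, \<alpha>2)"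
    by (metis prod_cases3)
  obtain T3 f3 \<alpha>3 T4 f4 \<alpha>4 where 3: "del_tower C M i (Ts, fs, \<alpha>) = (T3, f3, \<alpha>3)"
      and 4: "del_tower C M (j - 1) (T3, f3, \<alpha>3) = (T4, f4, \<alpha>4)"
    by (metis prod_cases3)
  have i: "i \<le> Suc n" and i': "i \<le> Suc (Suc n)" and j: "j - 1 \<le> Suc n"
    using assms by auto
  note t0 = assms(1)[unfolded \<tau>]
  note t1 = del_tower_closed[OF t0 assms(3), unfolded 1] and t3 = del_tower_closed[OF t0 i', unfolded 3]
  note t = towersD[OF t0]
  note n1 = del_tower_nth[OF t0 assms(3) 1] and n2 = del_tower_nth[OF t1 i 2]
    and n3 = del_tower_nth[OF t0 i' 3] and n4 = del_tower_nth[OF t3 j 4]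
  have "T2 = T4"
    using assms(2) by (intro nth_equalityI) (auto simp: n2(1) n4(1) n2(3) n4(3) n1(3) n3(3))
  moreover have "f2 = f4"
  proof (intro nth_equalityI)
    fix k assume "k < length f2"
    then have k: "k < n" by (simp add: n2)
    have "(fs ! k \<cdot> fs ! Suc k) \<cdot> fs ! Suc (Suc k) = fs ! k \<cdot> (fs ! Suc k \<cdot> fs ! Suc (Suc k))"
      using k by (intro cmp_assoc[OF t(4) t(4) t(4)]) auto
    then show "f2 ! k = f4 ! k"
      using k assms(2) by (auto simp: n2(4) n4(4) n1(4) n3(4))
  qed (simp add: n2 n4)
  moreover have "\<alpha>2 = \<alpha>4"
  proof -
    have "act M (fs ! n \<cdot> fs ! Suc n) \<alpha> = act M (fs ! n) (act M (fs ! Suc n) \<alpha>)"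
      by (rule act_cmp[OF t(5)]) (auto intro!: t(4))
    then show ?thesis
      using assms(2,3) by (auto simp: n2(5) n4(5) n1(4,5) n3(4,5))
  qed
  ultimately show ?thesis
    unfolding \<tau> 1 3 2 4 by simp
qed

text \<open>Every factor other than the one at \<open>i\<close> survives. The new one is quoted from
  the left-hand side because its description depends on the case: the value at \<open>T_1\<close>,
  at the fiber of a composite, or at the fiber of an arrow acted upon.\<close>

lemma tower_factors_del:
  assumes "\<tau> \<in> towers C M L (Suc n)" "i \<le> Suc n"
  shows "tower_factors C M p x (del_tower C M i \<tau>)
    = contract i (tower_factors C M p x (del_tower C M i \<tau>) ! i) (tower_factors C M p x \<tau>)"
proof (rule nth_equalityI)
  obtain Ts fs \<alpha> Ts' fs' \<alpha>' where \<tau>: "\<tau> = (Ts, fs, \<alpha>)" and d: "del_tower C M i (Ts, fs, \<alpha>) = (Ts', fs', \<alpha>')"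
    by (metis prod_cases3)
  note t0 = assms(1)[unfolded \<tau>]
  note t1 = del_tower_closed[OF t0 assms(2), unfolded d]
  note t = towersD[OF t0] and del = del_tower_nth[OF t0 assms(2) d]
  note f0 = tower_factors_nth[OF t0, where p = p and x = x] and f1 = tower_factors_nth[OF t1, where p = p and x = x]
  note len0 = length_tower_factors[OF t0, where p = p and x = x] and len1 = length_tower_factors[OF t1, where p = p and x = x]
  show "length (tower_factors C M p x (del_tower C M i \<tau>))
      = length (contract i (tower_factors C M p x (del_tower C M i \<tau>) ! i) (tower_factors C M p x \<tau>))"
    using assms(2) len0 len1 unfolding \<tau> d by (simp add: length_contract)
  fix k assume "k < length (tower_factors C M p x (del_tower C M i \<tau>))"
  then have k: "k < n + 2"
    using len1 unfolding \<tau> d by simp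
  show "tower_factors C M p x (del_tower C M i \<tau>) ! k
      = contract i (tower_factors C M p x (del_tower C M i \<tau>) ! i) (tower_factors C M p x \<tau>) ! k"
  proof (cases "k = i")
    case True
    then show ?thesis
      using k assms(2) len0 unfolding \<tau> by (simp add: contract_nth)
  next
    case False
    have "tower_factors C M p x (Ts', fs', \<alpha>') ! k
        = tower_factors C M p x (Ts, fs, \<alpha>) ! (if k < i then k else Suc k)"
    proof -
      consider "k = 0" | m where "k = Suc m" "m < n" | "k = Suc n"
        using k by (cases k) (auto simp: less_Suc_eq)
      then show ?thesis
      proof cases
        case 1
        then show ?thesis
          using False by (simp add: f0 f1 del(3))
      next
        case 2
        then show ?thesis
          using False f0(2)[of m] f0(2)[of "Suc m"] by (simp add: f1(2) del(4))
      next
        case 3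
        then have "\<alpha>' = \<alpha>" "\<not> k < i"
          using False assms(2) by (auto simp: del(5))
        then show ?thesis
          using 3 f0(3) f1(3) by simp
      qed
    qed
    then show ?thesis
      using k assms(2) len0 False unfolding \<tau> d by (simp add: contract_nth)
  qed
qed

end

section \<open>Bar modules\<close>

lemma koszul_sign_closed: "cring R \<Longrightarrow> koszul_sign R a b \<in> carrier R"
  by (simp add: koszul_sign_def cring.cring_simprules)

lemma koszul_sign_add_left:
  assumes "cring R"
  shows "koszul_sign R (a + b) c = koszul_sign R a c \<otimes>\<^bsub>R\<^esub> koszul_sign R b c"
proof -
  interpret cring R by fact
  show ?thesis
    by (auto simp: koszul_sign_def l_minus r_minus)
qed

lemma koszul_sign_add_right:
  assumes "cring R"
  shows "koszul_sign R a (b + c) = koszul_sign R a b \<otimes>\<^bsub>R\<^esub> koszul_sign R a c"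
proof -
  interpret cring R by fact
  show ?thesis
    by (auto simp: koszul_sign_def l_minus r_minus)
qed

text \<open>Kept free of any morphism, so that it can be interpreted both at the source and at the
  target of one.\<close>

locale bar_coefficients = left_operadic_module C M
  for C :: "('o, 'h) operadic_cat" (structure) and M :: "('o, 'h, 'l, 'a) left_operadic_mod" +
  fixes R :: "('r, 'z) ring_scheme"
    and P :: "('o, 'h, 'r, 'v) operad_data" and X :: "('l, 'a, 'r, 'v) opmod_data"
  assumes cring: "cring R" and operad: "operad R C P" and operad_module: "operad_module R C M P X"
begin

abbreviation parts where "parts \<tau> ds \<equiv> homog_parts (bar_factors C M P X \<tau>) ds"
abbreviation Bar where "Bar L n d \<equiv> bar_module R C M P X L n d"
abbreviation gen where "gen L n d \<equiv> bar_gen R C M P X L n d"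
abbreviation face where "face L n d i \<equiv> bar_face R C M P X L n d i"

lemma length_parts:
  "\<lbrakk>\<tau> \<in> towers C M L n; ds \<in> degree_lists (n + 2) d\<rbrakk> \<Longrightarrow> length (parts \<tau> ds) = n + 2"
  by (simp add: length_homog_parts length_tower_factors degree_lists_def)

lemma parts_nth:
  "\<lbrakk>\<tau> \<in> towers C M L n; ds \<in> degree_lists (n + 2) d; k < n + 2\<rbrakk>
    \<Longrightarrow> parts \<tau> ds ! k = (bar_factors C M P X \<tau> ! k) (ds ! k)"
  by (simp add: homog_parts_nth length_tower_factors degree_lists_def)

lemma module_parts:
  assumes "\<tau> \<in> towers C M L n" "ds \<in> degree_lists (n + 2) d" "k < n + 2"
  shows "module R (parts \<tau> ds ! k)"
proof -
  obtain Ts fs \<alpha> where \<tau>: "\<tau> = (Ts, fs, \<alpha>)"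
    by (metis prod_cases3)
  note t = towersD[OF assms(1)[unfolded \<tau>]]
    and f = tower_factors_nth[OF assms(1)[unfolded \<tau>], where p = "omod P" and x = "mmod X"]
  have omod: "module R (omod P A e)" if "A \<in> obj C" for A e
    using operad that by (simp add: operad_def)
  have mmod: "module R (mmod X L e)" if "L \<in> lobj M" for L e
    using operad_module that by (simp add: operad_module_def)
  consider "k = 0" | m where "k = Suc m" "m < n" | "k = Suc n"
    using assms(3) by (cases k) (auto simp: less_Suc_eq)
  then show ?thesis
  proof cases
    case 1
    then show ?thesis
      using omod[OF t(3)[of 0]] unfolding parts_nth[OF assms] by (simp add: \<tau> f)
  next
    case 2
    then have "fs ! m \<in> arr C"
      using t(4) by (simp add: homs_def)
    then show ?thesis
      using omod[OF fib_obj] 2 unfolding parts_nth[OF assms] by (simp add: \<tau> f)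
  next
    case 3
    have "\<alpha> \<in> larr M"
      using t(5) by (simp add: larrs_def)
    then show ?thesis
      using mmod[OF lfib_obj] 3 unfolding parts_nth[OF assms] by (simp add: \<tau> f)
  qed
qed

lemma module_tensor_parts:
  "\<lbrakk>\<tau> \<in> towers C M L n; ds \<in> degree_lists (n + 2) d\<rbrakk> \<Longrightarrow> module R (tensor R (parts \<tau> ds))"
  using module_parts by (intro module_tensor cring) (auto simp: length_parts)

lemma graded_tensor_bar_factors:
  "\<tau> \<in> towers C M L n \<Longrightarrow> graded_tensor R (bar_factors C M P X \<tau>) d
    = direct_sum (degree_lists (n + 2) d) (\<lambda>ds. tensor R (parts \<tau> ds))"
  by (simp add: graded_tensor_def length_tower_factors)

lemma module_graded_tensor_bar_factors:
  "\<tau> \<in> towers C M L n \<Longrightarrow> module R (graded_tensor R (bar_factors C M P X \<tau>) d)"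
  using module_tensor_parts
  by (simp add: graded_tensor_bar_factors module_direct_sum cring)

lemma module_bar: "module R (Bar L n d)"
  unfolding bar_module_def by (intro module_direct_sum cring module_graded_tensor_bar_factors)

lemma tensor_inj_hom:
  assumes "\<tau> \<in> towers C M L n" "ds \<in> degree_lists (n + 2) d"
  shows "direct_sum_inj (degree_lists (n + 2) d) (\<lambda>ds. tensor R (parts \<tau> ds)) ds
    \<in> mod_hom R (tensor R (parts \<tau> ds)) (graded_tensor R (bar_factors C M P X \<tau>) d)"
  unfolding graded_tensor_bar_factors[OF assms(1)]
  using direct_sum_inj_hom[of "degree_lists (n + 2) d" R "\<lambda>ds. tensor R (parts \<tau> ds)" ds]
    module_tensor_parts assms by blast

lemma graded_inj_hom:
  assumes "\<tau> \<in> towers C M L n"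
  shows "direct_sum_inj (towers C M L n) (\<lambda>\<tau>. graded_tensor R (bar_factors C M P X \<tau>) d) \<tau>
    \<in> mod_hom R (graded_tensor R (bar_factors C M P X \<tau>) d) (Bar L n d)"
  unfolding bar_module_def
  using direct_sum_inj_hom[of "towers C M L n" R "\<lambda>\<tau>. graded_tensor R (bar_factors C M P X \<tau>) d" \<tau>]
    module_graded_tensor_bar_factors assms by blast

lemma multilinear_gen:
  assumes "\<tau> \<in> towers C M L n" "ds \<in> degree_lists (n + 2) d"
  shows "multilinear R (parts \<tau> ds) (Bar L n d) (gen L n d \<tau> ds)"
proof -
  have pure: "multilinear R (parts \<tau> ds) (tensor R (parts \<tau> ds)) (pure_tensor R (parts \<tau> ds))"
    using module_parts[OF assms] by (intro multilinear_pure_tensor cring) (simp add: length_parts[OF assms])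
  show ?thesis
    using multilinear_comp_hom[OF multilinear_comp_hom[OF pure tensor_inj_hom[OF assms]] graded_inj_hom[OF assms(1)]]
    unfolding bar_gen_def .
qed

lemma gen_closed:
  "\<lbrakk>\<tau> \<in> towers C M L n; ds \<in> degree_lists (n + 2) d; vs \<in> tensor_gens (parts \<tau> ds)\<rbrakk>
    \<Longrightarrow> gen L n d \<tau> ds vs \<in> carrier (Bar L n d)"
  by (rule multilinear_closed[OF multilinear_gen])

text \<open>Peels off the three layers of the encoding: the sum over towers, the sum over degree
  lists, the tensor product. The identities between maps of bar modules below rest on it.\<close>

lemma bar_hom_eqI:
  assumes "module R N" "f \<in> mod_hom R (Bar L n d) N" "g \<in> mod_hom R (Bar L n d) N"
    and eq: "\<And>\<tau> ds vs. \<lbrakk>\<tau> \<in> towers C M L n; ds \<in> degree_lists (n + 2) d; vs \<in> tensor_gens (parts \<tau> ds)\<rbrakk>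
      \<Longrightarrow> f (gen L n d \<tau> ds vs) = g (gen L n d \<tau> ds vs)"
    and "x \<in> carrier (Bar L n d)"
  shows "f x = g x"
proof (rule direct_sum_hom_eqI[OF cring module_graded_tensor_bar_factors assms(1)
      assms(2)[unfolded bar_module_def] assms(3)[unfolded bar_module_def] _ assms(5)[unfolded bar_module_def]])
  fix \<tau> y assume \<tau>: "\<tau> \<in> towers C M L n" and y: "y \<in> carrier (graded_tensor R (bar_factors C M P X \<tau>) d)"
  let ?o = "direct_sum_inj (towers C M L n) (\<lambda>\<tau>. graded_tensor R (bar_factors C M P X \<tau>) d) \<tau>"
  let ?i = "\<lambda>ds. direct_sum_inj (degree_lists (n + 2) d) (\<lambda>ds. tensor R (parts \<tau> ds)) ds"
  note gt = graded_tensor_bar_factors[OF \<tau>, of d]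
  have homs: "(\<lambda>y. f (?o y)) \<in> mod_hom R (direct_sum (degree_lists (n + 2) d) (\<lambda>ds. tensor R (parts \<tau> ds))) N"
    "(\<lambda>y. g (?o y)) \<in> mod_hom R (direct_sum (degree_lists (n + 2) d) (\<lambda>ds. tensor R (parts \<tau> ds))) N"
    using mod_hom_comp[OF assms(2) graded_inj_hom[OF \<tau>]] mod_hom_comp[OF assms(3) graded_inj_hom[OF \<tau>]] unfolding gt by blast+
  show "f (?o y) = g (?o y)"
  proof (rule direct_sum_hom_eqI[OF cring module_tensor_parts[OF \<tau>] assms(1) homs _ y[unfolded gt]])
    fix ds z assume ds: "ds \<in> degree_lists (n + 2) d" and z: "z \<in> carrier (tensor R (parts \<tau> ds))"
    note inner = tensor_inj_hom[OF \<tau> ds, unfolded gt]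
    show "f (?o (?i ds z)) = g (?o (?i ds z))"
    proof (rule tensor_hom_eqI[OF cring _ assms(1) mod_hom_comp[OF homs(1) inner] mod_hom_comp[OF homs(2) inner] _ z])
      show "module R (parts \<tau> ds ! k)" if "k < length (parts \<tau> ds)" for k
        using module_parts[OF \<tau> ds] that by (simp add: length_parts[OF \<tau> ds])
      show "f (?o (?i ds (pure_tensor R (parts \<tau> ds) vs))) = g (?o (?i ds (pure_tensor R (parts \<tau> ds) vs)))"
        if "vs \<in> tensor_gens (parts \<tau> ds)" for vs
        using eq[OF \<tau> ds that] unfolding bar_gen_def .
    qed
  qed
qed

section \<open>Linear maps with prescribed values on the generators\<close>

context
  fixes L :: 'l and n :: nat and d :: int and N :: "('r, 'w) module"
    and g :: "('o, 'h, 'a) tower \<Rightarrow> int list \<Rightarrow> 'v list \<Rightarrow> 'w"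
  assumes N: "module R N"
    and g: "\<And>\<tau> ds. \<lbrakk>\<tau> \<in> towers C M L n; ds \<in> degree_lists (n + 2) d\<rbrakk>
      \<Longrightarrow> multilinear R (parts \<tau> ds) N (g \<tau> ds)"
begin

private lemma tensor_ext_parts_hom:
  assumes "\<tau> \<in> towers C M L n" "ds \<in> degree_lists (n + 2) d"
  shows "tensor_ext R (parts \<tau> ds) N (g \<tau> ds) \<in> mod_hom R (tensor R (parts \<tau> ds)) N"
  using module_parts[OF assms] by (intro tensor_ext_hom cring N g assms) (simp add: length_parts[OF assms])

private lemma graded_ext_hom:
  assumes "\<tau> \<in> towers C M L n"
  shows "direct_sum_ext (degree_lists (n + 2) d) (\<lambda>ds. tensor R (parts \<tau> ds)) N
      (\<lambda>ds. tensor_ext R (parts \<tau> ds) N (g \<tau> ds))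
    \<in> mod_hom R (graded_tensor R (bar_factors C M P X \<tau>) d) N"
  unfolding graded_tensor_bar_factors[OF assms]
  by (intro direct_sum_ext_hom cring module_tensor_parts[OF assms] N tensor_ext_parts_hom assms)

lemma bar_ext_hom: "bar_ext R C M P X L n d N g \<in> mod_hom R (Bar L n d) N"
  unfolding bar_ext_def bar_module_def
  by (intro direct_sum_ext_hom cring module_graded_tensor_bar_factors N graded_ext_hom)

lemma bar_ext_gen:
  assumes \<tau>: "\<tau> \<in> towers C M L n" and ds: "ds \<in> degree_lists (n + 2) d"
    and vs: "vs \<in> tensor_gens (parts \<tau> ds)"
  shows "bar_ext R C M P X L n d N g (gen L n d \<tau> ds vs) = g \<tau> ds vs"
proof -
  let ?i = "direct_sum_inj (degree_lists (n + 2) d) (\<lambda>ds. tensor R (parts \<tau> ds)) ds"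
  let ?t = "pure_tensor R (parts \<tau> ds) vs"
  have parts: "module R (parts \<tau> ds ! k)" if "k < length (parts \<tau> ds)" for k
    using module_parts[OF \<tau> ds] that by (simp add: length_parts[OF \<tau> ds])
  have t: "?t \<in> carrier (tensor R (parts \<tau> ds))"
    by (rule multilinear_closed[OF multilinear_pure_tensor[OF cring parts] vs])
  have "?i ?t \<in> carrier (graded_tensor R (bar_factors C M P X \<tau>) d)"
    by (rule mod_hom_closed[OF tensor_inj_hom[OF \<tau> ds] t])
  then have "bar_ext R C M P X L n d N g (gen L n d \<tau> ds vs)
      = direct_sum_ext (degree_lists (n + 2) d) (\<lambda>ds. tensor R (parts \<tau> ds)) N
          (\<lambda>ds. tensor_ext R (parts \<tau> ds) N (g \<tau> ds)) (?i ?t)"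
    unfolding bar_ext_def bar_gen_def
    by (intro direct_sum_ext_inj[OF module_graded_tensor_bar_factors N graded_ext_hom \<tau>])
  also have "\<dots> = tensor_ext R (parts \<tau> ds) N (g \<tau> ds) ?t"
    by (rule direct_sum_ext_inj[of _ R "\<lambda>ds. tensor R (parts \<tau> ds)" N
          "\<lambda>ds. tensor_ext R (parts \<tau> ds) N (g \<tau> ds)" ds ?t])
      (fact module_tensor_parts[OF \<tau>] N tensor_ext_parts_hom[OF \<tau>] ds t)+
  also have "\<dots> = g \<tau> ds vs"
    by (rule tensor_ext_pure[OF cring parts N g[OF \<tau> ds] vs])
  finally show ?thesis .
qed

end

section \<open>Faces\<close>

lemma gam_bilinear:
  "h \<in> homs C A B \<Longrightarrow> bilinear_map R (omod P (fib C h) i) (omod P B j) (omod P A (i + j)) (gam P h i j)"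
  using operad unfolding operad_def by metis

lemma gam_assoc:
  "\<lbrakk>f \<in> homs C A B; g \<in> homs C B D; x \<in> carrier (omod P (fib C f) i);
    y \<in> carrier (omod P (fib C g) j); z \<in> carrier (omod P D k)\<rbrakk>
    \<Longrightarrow> gam P f i (j + k) x (gam P g j k y z) = gam P (g \<cdot> f) (i + j) k (gam P (ind C f g) i j x y) z"
  using operad unfolding operad_def by metis

lemma nu_bilinear:
  "\<alpha> \<in> larrs M L S \<Longrightarrow> bilinear_map R (mmod X (lfib M \<alpha>) i) (omod P S j) (mmod X L (i + j)) (nu X \<alpha> i j)"
  using operad_module unfolding operad_module_def by metis

lemma nu_gam:
  "\<lbrakk>\<alpha> \<in> larrs M L B; g \<in> homs C B D; x \<in> carrier (mmod X (lfib M \<alpha>) i);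
    y \<in> carrier (omod P (fib C g) j); z \<in> carrier (omod P D k)\<rbrakk>
    \<Longrightarrow> nu X \<alpha> i (j + k) x (gam P g j k y z) = nu X (act M g \<alpha>) (i + j) k (nu X (lind M \<alpha> g) i j x y) z"
  using operad_module unfolding operad_module_def by metis

text \<open>The fiber axioms make the operations fit the factors: the induced map at an inner
  \<open>i\<close> goes from the fiber of \<open>f_i f_(i+1)\<close> to \<open>F_i\<close>, and its
  own fiber is \<open>F_(i+1)\<close> by \<open>fib_ind\<close>. At the top,
  \<open>lfib_lind\<close> plays this part.\<close>

lemma face_op_bilinear:
  assumes "\<tau> \<in> towers C M L (Suc n)" "i \<le> Suc n"
  shows "bilinear_map R ((bar_factors C M P X \<tau> ! i) a) ((bar_factors C M P X \<tau> ! (i + 1)) b)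
    ((bar_factors C M P X (del_tower C M i \<tau>) ! i) (a + b)) (face_op C M P X i \<tau> a b)"
proof -
  obtain Ts fs \<alpha> Ts' fs' \<alpha>' where \<tau>: "\<tau> = (Ts, fs, \<alpha>)" and del: "del_tower C M i (Ts, fs, \<alpha>) = (Ts', fs', \<alpha>')"
    by (metis prod_cases3)
  note t0 = assms(1)[unfolded \<tau>]
  note t = towersD[OF t0] and nths = del_tower_nth[OF t0 assms(2) del]
  note t1 = del_tower_closed[OF t0 assms(2), unfolded del]
  note f0 = tower_factors_nth[OF t0, where p = "omod P" and x = "mmod X"]
    and f1 = tower_factors_nth[OF t1, where p = "omod P" and x = "mmod X"]
  note op = face_op_eqs[OF t(2)]
  consider (first) "i = 0" | (inner) k where "i = Suc k" "k < n" | (last) "i = Suc n"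
    using assms(2) by (cases i) (auto simp: less_Suc_eq le_less)
  then show ?thesis
  proof cases
    case first
    \<comment> \<open>The degrees come in the order \<open>b\<close>, \<open>a\<close> because the
      right factor is the first argument; flipping the map and commuting the sum gives the form
      required.\<close>
    have "bilinear_map R (omod P (fib C (fs ! 0)) b) (omod P (Ts ! 0) a) (omod P (Ts ! 1) (b + a)) (gam P (fs ! 0) b a)"
      using gam_bilinear[OF t(4)[of 0]] by simp
    then show ?thesis
      using f0(2)[of 0] unfolding \<tau> del
      by - (rule bilinear_map_flip, simp add: f0(1) f1(1) op nths(3) first add.commute)
  next
    case inner
    have h: "fs ! Suc k \<in> homs C (Ts ! Suc (Suc k)) (Ts ! Suc k)" "fs ! k \<in> homs C (Ts ! Suc k) (Ts ! k)"
      using inner t(4) by auto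
    have "fib C (ind C (fs ! Suc k) (fs ! k)) = fib C (fs ! Suc k)"
      by (rule fib_ind[OF h])
    then have "bilinear_map R (omod P (fib C (fs ! Suc k)) b) (omod P (fib C (fs ! k)) a)
        (omod P (fib C (fs ! k \<cdot> fs ! Suc k)) (b + a)) (gam P (ind C (fs ! Suc k) (fs ! k)) b a)"
      using gam_bilinear[OF ind_hom[OF h], of b a] by simp
    then show ?thesis
      using f0(2)[of k] f0(2)[of "Suc k"] inner unfolding \<tau> del
      by - (rule bilinear_map_flip, simp add: f1(2) op(2) nths(4) inner(1) add.commute)
  next
    case last
    have h: "fs ! n \<in> homs C (Ts ! Suc n) (Ts ! n)"
      using t(4) by auto
    have "lfib M (lind M \<alpha> (fs ! n)) = lfib M \<alpha>"
      by (rule lfib_lind[OF t(5) h])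
    then have "bilinear_map R (mmod X (lfib M \<alpha>) b) (omod P (fib C (fs ! n)) a)
        (mmod X (lfib M (act M (fs ! n) \<alpha>)) (b + a)) (nu X (lind M \<alpha> (fs ! n)) b a)"
      using nu_bilinear[OF lind_larr[OF t(5) h], of b a] by simp
    then show ?thesis
      using f0(2)[of n] f0(3) f1(3) unfolding \<tau> del
      by - (rule bilinear_map_flip, simp add: op(3) nths(5) last add.commute)
  qed
qed

text \<open>The operation at \<open>i\<close> reads at most \<open>f_i\<close> and
  \<open>f_(i+1)\<close>, with the arrow \<alpha> in place of the latter at the top, while deleting
  \<open>T_j\<close> alters only what meets \<open>T_j\<close>. The gap keeps the two apart, up to
  the shift of indices in the second clause.\<close>

lemma face_op_del_far:
  assumes "\<tau> \<in> towers C M L (Suc (Suc n))" "Suc i < j" "j \<le> Suc (Suc n)"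
  shows "face_op C M P X i (del_tower C M j \<tau>) a b u w = face_op C M P X i \<tau> a b u w"
    "face_op C M P X (j - 1) (del_tower C M i \<tau>) a b u w = face_op C M P X j \<tau> a b u w"
proof -
  obtain Ts fs \<alpha> T1 f1 \<alpha>1 T2 f2 \<alpha>2 where \<tau>: "\<tau> = (Ts, fs, \<alpha>)"
    and 1: "del_tower C M j (Ts, fs, \<alpha>) = (T1, f1, \<alpha>1)" and 2: "del_tower C M i (Ts, fs, \<alpha>) = (T2, f2, \<alpha>2)"
    by (metis prod_cases3)
  have i: "i \<le> Suc (Suc n)"
    using assms by simp
  note t0 = assms(1)[unfolded \<tau>]
  note t = towersD[OF t0] and n1 = del_tower_nth[OF t0 assms(3) 1] and n2 = del_tower_nth[OF t0 i 2]
  note op = face_op_eqs[OF t(2)] and op1 = face_op_eqs[OF n1(2)] and op2 = face_op_eqs[OF n2(2)]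
  show "face_op C M P X i (del_tower C M j \<tau>) a b u w = face_op C M P X i \<tau> a b u w"
  proof (cases i)
    case 0
    then show ?thesis
      using assms(2) unfolding \<tau> 1 by (simp add: op op1 n1(4))
  next
    case (Suc k)
    then show ?thesis
      using assms(2,3) unfolding \<tau> 1 by (simp add: op op1 n1(4))
  qed
  \<comment> \<open>The bottom face cannot occur as \<open>j - 1\<close>; \<open>k = n\<close> is
    the top face, whose operation is \<open>nu\<close>, and the others use \<open>gam\<close> of an
    induced map.\<close>
  obtain k where k: "j = Suc (Suc k)" "k \<le> n" "i \<le> k"
    using assms(2,3) by (cases j; cases "j - 1") auto
  show "face_op C M P X (j - 1) (del_tower C M i \<tau>) a b u w = face_op C M P X j \<tau> a b u w"
  proof (cases "k = n")
    case True
    then show ?thesis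
      using k unfolding \<tau> 2 by (simp add: op(3) op2(3) n2(4,5))
  next
    case False
    then show ?thesis
      using k unfolding \<tau> 2 by (simp add: op(2) op2(2) n2(4))
  qed
qed

text \<open>Both sides multiply three consecutive factors. They agree by associativity because, by the
  axioms \<open>ind_ind\<close> and \<open>lind_lind\<close>, an induced map of induced maps is again an induced map.\<close>

lemma face_op_del_near:
  assumes "\<tau> \<in> towers C M L (Suc (Suc n))" "i \<le> Suc n"
    and u: "u \<in> carrier ((bar_factors C M P X \<tau> ! i) a)"
    and v: "v \<in> carrier ((bar_factors C M P X \<tau> ! Suc i) b)"
    and w: "w \<in> carrier ((bar_factors C M P X \<tau> ! Suc (Suc i)) c)"
  shows "face_op C M P X i (del_tower C M (Suc i) \<tau>) a (b + c) u (face_op C M P X (Suc i) \<tau> b c v w)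
    = face_op C M P X i (del_tower C M i \<tau>) (a + b) c (face_op C M P X i \<tau> a b u v) w"
proof -
  obtain Ts fs \<alpha> T1 f1 \<alpha>1 T2 f2 \<alpha>2 where \<tau>: "\<tau> = (Ts, fs, \<alpha>)"
    and 1: "del_tower C M (Suc i) (Ts, fs, \<alpha>) = (T1, f1, \<alpha>1)" and 2: "del_tower C M i (Ts, fs, \<alpha>) = (T2, f2, \<alpha>2)"
    by (metis prod_cases3)
  have i: "i \<le> Suc (Suc n)" "Suc i \<le> Suc (Suc n)"
    using assms(2) by simp_all
  note t0 = assms(1)[unfolded \<tau>]
  note t = towersD[OF t0] and n1 = del_tower_nth[OF t0 i(2) 1] and n2 = del_tower_nth[OF t0 i(1) 2]
  note op = face_op_eqs[OF t(2)] and op1 = face_op_eqs[OF n1(2)] and op2 = face_op_eqs[OF n2(2)]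
  note f = tower_factors_nth[OF t0, where p = "omod P" and x = "mmod X"]
  note [simp] = add.commute[of c b] add.commute[of b a] add.commute[of "b + c" a] add.commute[of c "a + b"]
  consider (first) "i = 0" | (inner) k where "i = Suc k" "k < n" | (last) "i = Suc n"
    using assms(2) by (cases i) (auto simp: less_Suc_eq le_less)
  then show ?thesis
  proof cases
    case first
    have h: "fs ! 1 \<in> homs C (Ts ! 2) (Ts ! 1)" "fs ! 0 \<in> homs C (Ts ! 1) (Ts ! 0)"
      using t(4)[of 1] t(4)[of 0] by (simp_all add: numeral_2_eq_2)
    \<comment> \<open>Associativity for \<open>f_2\<close> followed by \<open>f_1\<close>; the
      induced map on its right-hand side is the one that the inner face uses.\<close>
    have "gam P (fs ! 1) c (b + a) w (gam P (fs ! 0) b a v u)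
        = gam P (fs ! 0 \<cdot> fs ! 1) (c + b) a (gam P (ind C (fs ! 1) (fs ! 0)) c b w v) u"
      using u v w f(1) f(2)[of 0] f(2)[of 1] unfolding \<tau> first
      by (intro gam_assoc[OF h]) simp_all
    then show ?thesis
      unfolding \<tau> 1 2 by (simp add: op op1 op2 n1(4) n2(4) first)
  next
    case inner
    have h: "fs ! Suc (Suc k) \<in> homs C (Ts ! Suc (Suc (Suc k))) (Ts ! Suc (Suc k))"
      "fs ! Suc k \<in> homs C (Ts ! Suc (Suc k)) (Ts ! Suc k)" "fs ! k \<in> homs C (Ts ! Suc k) (Ts ! k)"
      using inner t(4) by auto
    let ?f = "ind C (fs ! Suc (Suc k)) (fs ! k \<cdot> fs ! Suc k)" and ?g = "ind C (fs ! Suc k) (fs ! k)"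
    note hg = cmp_hom[OF h(2,3)]
    \<comment> \<open>Associativity is applied inside the fibers over \<open>T_k\<close>:
      \<open>?f\<close> and \<open>?g\<close> are the consecutive maps between the fibers of the
      triple composite, of the double composite and of \<open>fs ! k\<close>.\<close>
    have "gam P ?f c (b + a) w (gam P ?g b a v u) = gam P (?g \<cdot> ?f) (c + b) a (gam P (ind C ?f ?g) c b w v) u"
      using u v w f(2)[of k] f(2)[of "Suc k"] f(2)[of "Suc (Suc k)"] inner(2) unfolding \<tau> inner(1)
      by (intro gam_assoc[OF ind_hom[OF h(1) hg] ind_hom[OF h(2,3)]])
        (simp_all add: fib_ind[OF h(1) hg] fib_ind[OF h(2,3)])
    then have "gam P ?f c (b + a) w (gam P ?g b a v u)
        = gam P (ind C (fs ! Suc k \<cdot> fs ! Suc (Suc k)) (fs ! k)) (c + b) a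
            (gam P (ind C (fs ! Suc (Suc k)) (fs ! Suc k)) c b w v) u"
      by (simp only: ind_ind[OF h] ind_cmp[OF h])
    then show ?thesis
      using inner unfolding \<tau> 1 2 by (simp add: op op1 op2 n1(4) n2(4) inner(1))
  next
    case last
    have h: "fs ! Suc n \<in> homs C (Ts ! Suc (Suc n)) (Ts ! Suc n)" "fs ! n \<in> homs C (Ts ! Suc n) (Ts ! n)"
      using t(4) by auto
    let ?f = "lind M \<alpha> (fs ! n \<cdot> fs ! Suc n)" and ?g = "ind C (fs ! Suc n) (fs ! n)"
    note hg = cmp_hom[OF h]
    \<comment> \<open>The module law for the induced arrow into the fiber of
      \<open>fs ! n \<cdot> fs ! Suc n\<close>, followed by the induced map to the fiber of
      \<open>fs ! n\<close>.\<close>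
    have "nu X ?f c (b + a) w (gam P ?g b a v u) = nu X (act M ?g ?f) (c + b) a (nu X (lind M ?f ?g) c b w v) u"
      using u v w f(2)[of n] f(2)[of "Suc n"] f(3) unfolding \<tau> last
      by (intro nu_gam[OF lind_larr[OF t(5) hg] ind_hom[OF h]])
        (simp_all add: lfib_lind[OF t(5) hg] fib_ind[OF h])
    then have "nu X ?f c (b + a) w (gam P ?g b a v u)
        = nu X (lind M (act M (fs ! Suc n) \<alpha>) (fs ! n)) (c + b) a (nu X (lind M \<alpha> (fs ! Suc n)) c b w v) u"
      by (simp only: lind_lind[OF t(5) h] lind_act[OF t(5) h])
    then show ?thesis
      unfolding \<tau> 1 2 by (simp add: op op1 op2 n1(4,5) n2(4,5) last)
  qed
qed

end

section \<open>The bar complex\<close>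

text \<open>The cancellation behind a squared differential: the positions \<open>(i, j + 1)\<close>
  and \<open>(j, i)\<close> with \<open>i \<le> j\<close> pair off the whole rectangle.\<close>

lemma (in abelian_group) alternating_double_sum:
  assumes "\<And>i j. B i j \<in> carrier G" "\<And>i j. \<lbrakk>i \<le> j; j \<le> m\<rbrakk> \<Longrightarrow> B i (Suc j) = \<ominus> B j i"
  shows "(\<Oplus>i\<in>{..m}. \<Oplus>j\<in>{..Suc m}. B i j) = \<zero>"
  using assms(2)
proof (induction m)
  case 0
  then show ?case
    using assms(1) by (simp add: l_neg)
next
  case (Suc m)
  have row: "(\<Oplus>j\<in>{..Suc (Suc m)}. B i j) = B i (Suc (Suc m)) \<oplus> (\<Oplus>j\<in>{..Suc m}. B i j)" for i
    using assms(1) by (intro finsum_Suc) auto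
  have "(\<Oplus>i\<in>{..Suc m}. \<Oplus>j\<in>{..Suc (Suc m)}. B i j)
      = (\<Oplus>i\<in>{..Suc m}. B i (Suc (Suc m))) \<oplus> (\<Oplus>i\<in>{..Suc m}. \<Oplus>j\<in>{..Suc m}. B i j)"
    unfolding row using assms(1) by (intro finsum_addf) auto
  also have "(\<Oplus>i\<in>{..Suc m}. \<Oplus>j\<in>{..Suc m}. B i j)
      = (\<Oplus>j\<in>{..Suc m}. B (Suc m) j) \<oplus> (\<Oplus>i\<in>{..m}. \<Oplus>j\<in>{..Suc m}. B i j)"
    using assms(1) by (intro finsum_Suc) auto
  also have "(\<Oplus>i\<in>{..m}. \<Oplus>j\<in>{..Suc m}. B i j) = \<zero>"
    by (rule Suc.IH) (use Suc.prems in auto)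
  \<comment> \<open>The induction step adds the column \<open>m + 2\<close> and the row
    \<open>m + 1\<close>, whose entries cancel one against one.\<close>
  also have "(\<Oplus>i\<in>{..Suc m}. B i (Suc (Suc m))) \<oplus> ((\<Oplus>j\<in>{..Suc m}. B (Suc m) j) \<oplus> \<zero>)
      = (\<Oplus>i\<in>{..Suc m}. B i (Suc (Suc m)) \<oplus> B (Suc m) i)"
    using assms(1) by (subst finsum_addf) auto
  also have "\<dots> = (\<Oplus>i\<in>{..Suc m}. \<zero>)"
    using assms(1) Suc.prems by (intro finsum_cong') (auto simp: l_neg)
  finally show ?case
    by simp
qed

lemma minus_one_power_closed: "cring R \<Longrightarrow> minus_one_power R i \<in> carrier R"
proof -
  assume "cring R"
  then interpret cring R .
  show ?thesis by (simp add: minus_one_power_def)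
qed

lemma minus_one_power_Suc:
  "cring R \<Longrightarrow> minus_one_power R (Suc i) = \<ominus>\<^bsub>R\<^esub> minus_one_power R i"
proof -
  assume "cring R"
  then interpret cring R .
  show ?thesis by (simp add: minus_one_power_def r_minus)
qed

context bar_coefficients
begin

abbreviation face_sign where
  "face_sign i ds \<equiv> koszul_sign R (ds ! i) (ds ! (i + 1))"
abbreviation face_degrees where
  "face_degrees i (ds :: int list) \<equiv> contract i (ds ! i + ds ! (i + 1)) ds"
abbreviation face_factors where
  "face_factors i \<tau> ds vs \<equiv>
    contract i (face_op C M P X i \<tau> (ds ! i) (ds ! (i + 1)) (vs ! i) (vs ! (i + 1))) vs"

lemma face_degrees_closed:
  "\<lbrakk>ds \<in> degree_lists (Suc n + 2) d; i \<le> Suc n\<rbrakk> \<Longrightarrow> face_degrees i ds \<in> degree_lists (n + 2) d"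
  by (intro contract_degree_lists) auto

lemma parts_face:
  assumes "\<tau> \<in> towers C M L (Suc n)" "ds \<in> degree_lists (Suc n + 2) d" "i \<le> Suc n"
  shows "parts (del_tower C M i \<tau>) (face_degrees i ds)
    = contract i ((bar_factors C M P X (del_tower C M i \<tau>) ! i) (ds ! i + ds ! (i + 1))) (parts \<tau> ds)"
proof -
  have "parts (del_tower C M i \<tau>) (face_degrees i ds)
      = homog_parts (contract i (bar_factors C M P X (del_tower C M i \<tau>) ! i) (bar_factors C M P X \<tau>)) (face_degrees i ds)"
    using tower_factors_del[OF assms(1,3), of "omod P" "mmod X"] by simp
  also have "\<dots> = contract i ((bar_factors C M P X (del_tower C M i \<tau>) ! i) (ds ! i + ds ! (i + 1))) (parts \<tau> ds)"
    using assms by (intro homog_parts_contract) (auto simp: length_tower_factors degree_lists_def)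
  finally show ?thesis .
qed

lemma face_op_bilinear_parts:
  assumes "\<tau> \<in> towers C M L (Suc n)" "ds \<in> degree_lists (Suc n + 2) d" "i \<le> Suc n"
  shows "bilinear_map R (parts \<tau> ds ! i) (parts \<tau> ds ! (i + 1))
    ((bar_factors C M P X (del_tower C M i \<tau>) ! i) (ds ! i + ds ! (i + 1)))
    (face_op C M P X i \<tau> (ds ! i) (ds ! (i + 1)))"
  using face_op_bilinear[OF assms(1,3), of "ds ! i" "ds ! (i + 1)"] assms(3)
    parts_nth[OF assms(1,2), of i] parts_nth[OF assms(1,2), of "i + 1"] by simp

lemma face_factors_closed:
  assumes "\<tau> \<in> towers C M L (Suc n)" "ds \<in> degree_lists (Suc n + 2) d" "i \<le> Suc n"
    and vs: "vs \<in> tensor_gens (parts \<tau> ds)"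
  shows "face_factors i \<tau> ds vs \<in> tensor_gens (parts (del_tower C M i \<tau>) (face_degrees i ds))"
proof -
  have len: "i + 1 < length (parts \<tau> ds)"
    using assms(3) by (simp add: length_parts[OF assms(1,2)])
  show ?thesis
    unfolding parts_face[OF assms(1-3)]
    using vs len
    by (intro tensor_gens_contract bilinear_map_closed[OF face_op_bilinear_parts[OF assms(1-3)]])
      (auto simp: tensor_gens_iff)
qed

lemma multilinear_face:
  assumes "\<tau> \<in> towers C M L (Suc n)" "ds \<in> degree_lists (Suc n + 2) d" "i \<le> Suc n"
  shows "multilinear R (parts \<tau> ds) (Bar L n d)
    (\<lambda>vs. face_sign i ds \<odot>\<^bsub>Bar L n d\<^esub>
      gen L n d (del_tower C M i \<tau>) (face_degrees i ds) (face_factors i \<tau> ds vs))"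
proof -
  have len: "i + 1 < length (parts \<tau> ds)"
    using assms(3) by (simp add: length_parts[OF assms(1,2)])
  have id: "(\<lambda>y. y) \<in> mod_hom R (Bar L n d) (Bar L n d)"
    by (simp add: mod_hom_def)
  note gen = multilinear_gen[OF del_tower_closed[OF assms(1,3)] face_degrees_closed[OF assms(2,3)],
      unfolded parts_face[OF assms]]
  show ?thesis
    by (rule multilinear_comp_hom[OF multilinear_contract[OF gen face_op_bilinear_parts[OF assms] len]
          mod_hom_smult_right[OF module_bar id koszul_sign_closed[OF cring]]])
qed

lemma face_hom: "i \<le> Suc n \<Longrightarrow> face L (Suc n) d i \<in> mod_hom R (Bar L (Suc n) d) (Bar L n d)"
  unfolding bar_face_def Let_def diff_Suc_1 by (intro bar_ext_hom module_bar multilinear_face)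

lemma face_gen:
  assumes "\<tau> \<in> towers C M L (Suc n)" "ds \<in> degree_lists (Suc n + 2) d" "i \<le> Suc n"
    and "vs \<in> tensor_gens (parts \<tau> ds)"
  shows "face L (Suc n) d i (gen L (Suc n) d \<tau> ds vs) = face_sign i ds \<odot>\<^bsub>Bar L n d\<^esub>
    gen L n d (del_tower C M i \<tau>) (face_degrees i ds) (face_factors i \<tau> ds vs)"
  unfolding bar_face_def Let_def diff_Suc_1
  by (rule bar_ext_gen[OF module_bar multilinear_face[OF _ _ assms(3)] assms(1,2,4)])

section \<open>The simplicial identities between faces\<close>

lemma face_degrees_face_degrees:
  assumes "i < j" "j + 1 < length ds"
  shows "face_degrees i (face_degrees j ds) = face_degrees (j - 1) (face_degrees i ds)"
proof (cases "j = Suc i")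
  case True
  then show ?thesis
    using assms contract_contract_near[of i ds _ "ds ! Suc i + ds ! Suc (Suc i)" "ds ! i + ds ! Suc i"]
    by (simp add: contract_nth add.assoc)
next
  case False
  then have "Suc i < j"
    using assms(1) by simp
  then show ?thesis
    using assms contract_contract_far[of i j ds] by (auto simp: contract_nth)
qed

text \<open>For overlapping faces on neighbours of degrees \<open>a\<close>, \<open>b\<close>,
  \<open>c\<close>, both products have the exponent \<open>ab + ac + bc\<close>, the sign of
  reversing the three. For disjoint faces neither sign sees the other merger, and they
  commute.\<close>

lemma face_sign_face_sign:
  assumes "i < j" "j + 1 < length ds"
  shows "face_sign j ds \<otimes>\<^bsub>R\<^esub> face_sign i (face_degrees j ds)
    = face_sign i ds \<otimes>\<^bsub>R\<^esub> face_sign (j - 1) (face_degrees i ds)"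
proof -
  interpret R: cring R by (rule cring)
  note [simp] = koszul_sign_closed[OF cring]
  show ?thesis
  proof (cases "j = Suc i")
    case True
    then show ?thesis
      using assms
      by (simp add: contract_nth koszul_sign_add_left[OF cring] koszul_sign_add_right[OF cring] R.m_ac)
  next
    case False
    then have "Suc i < j"
      using assms(1) by simp
    then show ?thesis
      using assms by (auto simp: contract_nth R.m_comm)
  qed
qed

lemma face_factors_face_factors:
  assumes \<tau>: "\<tau> \<in> towers C M L (Suc (Suc n))" and ds: "ds \<in> degree_lists (Suc (Suc n) + 2) d"
    and vs: "vs \<in> tensor_gens (parts \<tau> ds)" and ij: "i < j" "j \<le> Suc (Suc n)"
  shows "face_factors i (del_tower C M j \<tau>) (face_degrees j ds) (face_factors j \<tau> ds vs)
    = face_factors (j - 1) (del_tower C M i \<tau>) (face_degrees i ds) (face_factors i \<tau> ds vs)"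
proof -
  have len: "length ds = n + 4" "length vs = n + 4"
    using ds vs length_parts[OF \<tau> ds] by (auto simp: degree_lists_def tensor_gens_iff)
  show ?thesis
  proof (cases "j = Suc i")
    case True
    have v: "vs ! k \<in> carrier ((bar_factors C M P X \<tau> ! k) (ds ! k))" if "k < Suc (Suc n) + 2" for k
      using vs that unfolding parts_nth[OF \<tau> ds that, symmetric]
      by (simp add: tensor_gens_iff length_parts[OF \<tau> ds])
    \<comment> \<open>The same three factors are multiplied in two ways, and the degrees are grouped
      as the factors are.\<close>
    have "face_op C M P X i (del_tower C M (Suc i) \<tau>) (ds ! i) (ds ! Suc i + ds ! Suc (Suc i)) (vs ! i)
        (face_op C M P X (Suc i) \<tau> (ds ! Suc i) (ds ! Suc (Suc i)) (vs ! Suc i) (vs ! Suc (Suc i)))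
      = face_op C M P X i (del_tower C M i \<tau>) (ds ! i + ds ! Suc i) (ds ! Suc (Suc i))
        (face_op C M P X i \<tau> (ds ! i) (ds ! Suc i) (vs ! i) (vs ! Suc i)) (vs ! Suc (Suc i))"
      using ij True by (intro face_op_del_near[OF \<tau>] v) auto
    then show ?thesis
      using ij True len contract_contract_near[of i vs] by (simp add: contract_nth)
  next
    case False
    then have far: "Suc i < j"
      using ij by simp
    then show ?thesis
      using ij len contract_contract_far[OF far, of vs]
      by (auto simp: contract_nth face_op_del_far[OF \<tau> far ij(2), simplified])
  qed
qed

lemma face_face:
  assumes ij: "i < j" "j \<le> Suc (Suc n)" and x: "x \<in> carrier (Bar L (Suc (Suc n)) d)"
  shows "face L (Suc n) d i (face L (Suc (Suc n)) d j x)
    = face L (Suc n) d (j - 1) (face L (Suc (Suc n)) d i x)"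
proof (rule bar_hom_eqI[OF module_bar _ _ _ x])
  have ij': "i \<le> Suc n" "j - 1 \<le> Suc n" "i \<le> Suc (Suc n)"
    using ij by auto
  show "(\<lambda>x. face L (Suc n) d i (face L (Suc (Suc n)) d j x)) \<in> mod_hom R (Bar L (Suc (Suc n)) d) (Bar L n d)"
    by (intro mod_hom_comp[OF face_hom face_hom] ij ij')
  show "(\<lambda>x. face L (Suc n) d (j - 1) (face L (Suc (Suc n)) d i x)) \<in> mod_hom R (Bar L (Suc (Suc n)) d) (Bar L n d)"
    by (intro mod_hom_comp[OF face_hom face_hom] ij ij')
  fix \<tau> ds vs
  assume \<tau>: "\<tau> \<in> towers C M L (Suc (Suc n))" and ds: "ds \<in> degree_lists (Suc (Suc n) + 2) d"
    and vs: "vs \<in> tensor_gens (parts \<tau> ds)"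
  interpret B: module R "Bar L n d" by (rule module_bar)
  \<comment> \<open>Two successive faces of a generator form a scalar times a single generator. Both
    sides of the identity are instances of this, after which sign, tower, degrees and factors are
    compared separately.\<close>
  have ff: "face L (Suc n) d k (face L (Suc (Suc n)) d l (gen L (Suc (Suc n)) d \<tau> ds vs))
      = (face_sign l ds \<otimes>\<^bsub>R\<^esub> face_sign k (face_degrees l ds)) \<odot>\<^bsub>Bar L n d\<^esub>
        gen L n d (del_tower C M k (del_tower C M l \<tau>)) (face_degrees k (face_degrees l ds))
          (face_factors k (del_tower C M l \<tau>) (face_degrees l ds) (face_factors l \<tau> ds vs))"
    if k: "k \<le> Suc n" and l: "l \<le> Suc (Suc n)" for k l
  proof -
    note \<tau>' = del_tower_closed[OF \<tau> l] and ds' = face_degrees_closed[OF ds l]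
      and vs' = face_factors_closed[OF \<tau> ds l vs]
    have "gen L n d (del_tower C M k (del_tower C M l \<tau>)) (face_degrees k (face_degrees l ds))
        (face_factors k (del_tower C M l \<tau>) (face_degrees l ds) (face_factors l \<tau> ds vs)) \<in> carrier (Bar L n d)"
      by (rule gen_closed[OF del_tower_closed[OF \<tau>' k] face_degrees_closed[OF ds' k] face_factors_closed[OF \<tau>' ds' k vs']])
    then show ?thesis
      by (simp only: face_gen[OF \<tau> ds l vs] face_gen[OF \<tau>' ds' k vs'] koszul_sign_closed[OF cring]
          mod_hom_smult[OF face_hom[OF k]] gen_closed[OF \<tau>' ds' vs'] B.smult_assoc1)
  qed
  have len: "j + 1 < length ds"
    using ds ij by (simp add: degree_lists_def)
  show "face L (Suc n) d i (face L (Suc (Suc n)) d j (gen L (Suc (Suc n)) d \<tau> ds vs))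
      = face L (Suc n) d (j - 1) (face L (Suc (Suc n)) d i (gen L (Suc (Suc n)) d \<tau> ds vs))"
    unfolding ff[OF ij'(1) ij(2)] ff[OF ij'(2,3)] del_del_tower[OF \<tau> ij] face_sign_face_sign[OF ij(1) len]
      face_degrees_face_degrees[OF ij(1) len] face_factors_face_factors[OF \<tau> ds vs ij] ..
qed

lemma bdry_bar:
  "bdry (bar_complex R C M P X L) (Suc n) d x
    = (\<Oplus>\<^bsub>Bar L n d\<^esub> i\<in>{..Suc n}. minus_one_power R i \<odot>\<^bsub>Bar L n d\<^esub> face L (Suc n) d i x)"
  by (simp add: bar_complex_def atLeast0AtMost)

lemma signed_face_hom:
  "i \<le> Suc n \<Longrightarrow> (\<lambda>x. minus_one_power R i \<odot>\<^bsub>Bar L n d\<^esub> face L (Suc n) d i x)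
    \<in> mod_hom R (Bar L (Suc n) d) (Bar L n d)"
  by (intro mod_hom_smult_right module_bar face_hom minus_one_power_closed cring)

lemma chain_complex_bar: "chain_complex R (bar_complex R C M P X L)"
  unfolding chain_complex_def
proof (intro conjI allI ballI)
  show "module R (chains (bar_complex R C M P X L) n d)" for n d
    by (simp add: bar_complex_def module_bar)
  show "bdry (bar_complex R C M P X L) (Suc n) d
      \<in> mod_hom R (chains (bar_complex R C M P X L) (Suc n) d) (chains (bar_complex R C M P X L) n d)" for n d
  proof -
    have "(\<lambda>x. \<Oplus>\<^bsub>Bar L n d\<^esub> i\<in>{..Suc n}. minus_one_power R i \<odot>\<^bsub>Bar L n d\<^esub> face L (Suc n) d i x)
        \<in> mod_hom R (Bar L (Suc n) d) (Bar L n d)"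
      by (intro mod_hom_finsum_right module_bar signed_face_hom) simp
    then show ?thesis
      by (simp add: bar_complex_def atLeast0AtMost)
  qed
  fix n d x assume "x \<in> carrier (chains (bar_complex R C M P X L) (Suc (Suc n)) d)"
  then have x: "x \<in> carrier (Bar L (Suc (Suc n)) d)"
    by (simp add: bar_complex_def)
  interpret R: cring R by (rule cring)
  interpret B: module R "Bar L n d" by (rule module_bar)
  let ?s = "minus_one_power R"
  let ?ff = "\<lambda>i j. face L (Suc n) d i (face L (Suc (Suc n)) d j x)"
  \<comment> \<open>Faces are known to be linear only for indices in range, while the cancellation
    lemma wants all entries in the carrier; hence the extension by zero.\<close>
  let ?T = "\<lambda>i j. if i \<le> Suc n \<and> j \<le> Suc (Suc n) then (?s i \<otimes>\<^bsub>R\<^esub> ?s j) \<odot>\<^bsub>Bar L n d\<^esub> ?ff i j else \<zero>\<^bsub>Bar L n d\<^esub>"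
  have s: "?s i \<in> carrier R" for i
    by (rule minus_one_power_closed[OF cring])
  have f: "face L (Suc (Suc n)) d j x \<in> carrier (Bar L (Suc n) d)" if "j \<le> Suc (Suc n)" for j
    by (rule mod_hom_closed[OF face_hom[OF that] x])
  have ff: "?ff i j \<in> carrier (Bar L n d)" if "i \<le> Suc n" "j \<le> Suc (Suc n)" for i j
    by (rule mod_hom_closed[OF face_hom[OF that(1)] f[OF that(2)]])
  have sf: "?s j \<odot>\<^bsub>Bar L (Suc n) d\<^esub> face L (Suc (Suc n)) d j x \<in> carrier (Bar L (Suc n) d)"
    if "j \<le> Suc (Suc n)" for j
    by (rule mod_hom_closed[OF signed_face_hom[OF that] x])
  have T: "?s i \<odot>\<^bsub>Bar L n d\<^esub> face L (Suc n) d i (?s j \<odot>\<^bsub>Bar L (Suc n) d\<^esub> face L (Suc (Suc n)) d j x) = ?T i j"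
    if "i \<le> Suc n" "j \<le> Suc (Suc n)" for i j
    using that s by (simp add: mod_hom_smult[OF face_hom] f ff B.smult_assoc1)
  have "bdry (bar_complex R C M P X L) (Suc n) d (bdry (bar_complex R C M P X L) (Suc (Suc n)) d x)
      = (\<Oplus>\<^bsub>Bar L n d\<^esub> i\<in>{..Suc n}. \<Oplus>\<^bsub>Bar L n d\<^esub> j\<in>{..Suc (Suc n)}. ?T i j)"
    unfolding bdry_bar
  proof (intro B.M.finsum_cong' refl)
    fix i assume "i \<in> {..Suc n}"
    then have i: "i \<le> Suc n" by simp
    have "?s i \<odot>\<^bsub>Bar L n d\<^esub> face L (Suc n) d i
        (\<Oplus>\<^bsub>Bar L (Suc n) d\<^esub> j\<in>{..Suc (Suc n)}. ?s j \<odot>\<^bsub>Bar L (Suc n) d\<^esub> face L (Suc (Suc n)) d j x)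
      = (\<Oplus>\<^bsub>Bar L n d\<^esub> j\<in>{..Suc (Suc n)}.
          ?s i \<odot>\<^bsub>Bar L n d\<^esub> face L (Suc n) d i (?s j \<odot>\<^bsub>Bar L (Suc n) d\<^esub> face L (Suc (Suc n)) d j x))"
      by (rule mod_hom_finsum[OF module_bar module_bar signed_face_hom[OF i]]) (simp add: sf)
    also have "\<dots> = (\<Oplus>\<^bsub>Bar L n d\<^esub> j\<in>{..Suc (Suc n)}. ?T i j)"
      using T[OF i] s ff by (intro B.M.finsum_cong') auto
    finally show "?s i \<odot>\<^bsub>Bar L n d\<^esub> face L (Suc n) d i
        (\<Oplus>\<^bsub>Bar L (Suc n) d\<^esub> j\<in>{..Suc (Suc n)}. ?s j \<odot>\<^bsub>Bar L (Suc n) d\<^esub> face L (Suc (Suc n)) d j x)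
      = (\<Oplus>\<^bsub>Bar L n d\<^esub> j\<in>{..Suc (Suc n)}. ?T i j)" .
  qed (use s ff in \<open>auto intro!: B.M.finsum_closed\<close>)
  also have "\<dots> = \<zero>\<^bsub>Bar L n d\<^esub>"
  proof (rule B.M.alternating_double_sum)
    show "?T i j \<in> carrier (Bar L n d)" for i j
      using s ff by simp
    fix i j assume ij: "i \<le> j" "j \<le> Suc n"
    then have "?ff i (Suc j) = ?ff j i"
      using face_face[of i "Suc j" n x] x by simp
    \<comment> \<open>The face with index \<open>Suc j\<close> carries one factor of minus one more
      than that with index \<open>j\<close>.\<close>
    moreover have "(?s i \<otimes>\<^bsub>R\<^esub> ?s (Suc j)) \<odot>\<^bsub>Bar L n d\<^esub> ?ff j i = \<ominus>\<^bsub>Bar L n d\<^esub> ((?s j \<otimes>\<^bsub>R\<^esub> ?s i) \<odot>\<^bsub>Bar L n d\<^esub> ?ff j i)"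
      using ij s ff[of j i] by (simp add: minus_one_power_Suc[OF cring] R.r_minus B.smult_l_minus R.m_comm[of "?s i"])
    ultimately show "?T i (Suc j) = \<ominus>\<^bsub>Bar L n d\<^esub> ?T j i"
      using ij by simp
  qed
  finally show "bdry (bar_complex R C M P X L) (Suc n) d (bdry (bar_complex R C M P X L) (Suc (Suc n)) d x)
      = \<zero>\<^bsub>chains (bar_complex R C M P X L) n d\<^esub>"
    by (simp add: bar_complex_def)
qed

end

section \<open>Augmentation and change of coefficients\<close>

text \<open>Changing one entry before the maps are applied changes one entry after them, through the
  linear map of that slot.\<close>

lemma multilinear_map2:
  assumes g: "multilinear R Ms' N g" and len: "length hs = length Ms" "length Ms' = length Ms"
    and hom: "\<And>k. k < length Ms \<Longrightarrow> hs ! k \<in> mod_hom R (Ms ! k) (Ms' ! k)"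
  shows "multilinear R Ms N (\<lambda>vs. g (map2 (\<lambda>h v. h v) hs vs))"
  unfolding multilinear_def
proof (intro conjI ballI allI impI)
  have closed: "map2 (\<lambda>h v. h v) hs vs \<in> tensor_gens Ms'" if "vs \<in> tensor_gens Ms" for vs
    using that mod_hom_closed[OF hom] len by (auto simp: tensor_gens_iff)
  then show "g (map2 (\<lambda>h v. h v) hs vs) \<in> carrier N" if "vs \<in> tensor_gens Ms" for vs
    using that by (intro multilinear_closed[OF g])
  fix vs k assume vs: "vs \<in> tensor_gens Ms" and k: "k < length Ms"
  have "map2 (\<lambda>h v. h v) hs (vs[k := x]) = (map2 (\<lambda>h v. h v) hs vs)[k := (hs ! k) x]" for x
    using k len vs by (auto intro!: nth_equalityI simp: nth_list_update tensor_gens_iff)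
  then show "(\<lambda>x. g (map2 (\<lambda>h v. h v) hs (vs[k := x]))) \<in> mod_hom R (Ms ! k) N"
    using mod_hom_comp[OF multilinear_hom[OF g closed[OF vs], unfolded len(2), OF k] hom[OF k]] by simp
qed

lemma towers_0E:
  assumes "\<tau> \<in> towers C M L 0"
  obtains T \<alpha> where "\<tau> = ([T], [], \<alpha>)" "T \<in> obj C" "\<alpha> \<in> larrs M L T"
  using assms by (auto simp: towers_def length_Suc_conv)

lemma degree_lists_2E:
  assumes "ds \<in> degree_lists 2 d"
  obtains a b where "ds = [a, b]" "d = a + b"
  using assms by (auto simp: degree_lists_def length_Suc_conv numeral_2_eq_2)

context bar_coefficients
begin

lemma bar_augmentation_multilinear:
  assumes "\<tau> \<in> towers C M L 0" "ds \<in> degree_lists (0 + 2) d"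
  shows "multilinear R (parts \<tau> ds) (mmod X L d) ((\<lambda>(Ts, fs, \<alpha>) ds vs. let a = ds ! 0; b = ds ! 1 in
    koszul_sign R a b \<odot>\<^bsub>mmod X L d\<^esub> nu X \<alpha> b a (vs ! 1) (vs ! 0)) \<tau> ds)"
proof -
  obtain T \<alpha> where \<tau>: "\<tau> = ([T], [], \<alpha>)" "\<alpha> \<in> larrs M L T"
    using towers_0E[OF assms(1)] by blast
  obtain a b where ds: "ds = [a, b]" "d = a + b"
    using degree_lists_2E[of ds d] assms(2) by (auto simp: numeral_2_eq_2)
  \<comment> \<open>A tower over \<open>L\<close> contains an arrow with source
    \<open>L\<close>.\<close>
  have L: "L \<in> lobj M"
    using \<tau>(2) lsrc_obj by (auto simp: larrs_def)
  then have mmod: "module R (mmod X L d)"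
    using operad_module by (simp add: operad_module_def)
  have parts: "parts \<tau> ds = [omod P T a, mmod X (lfib M \<alpha>) b]"
    by (simp add: \<tau> ds tower_factors_def homog_parts_def)
  have bil: "bilinear_map R (omod P T a) (mmod X (lfib M \<alpha>) b) (mmod X L d) (\<lambda>u w. nu X \<alpha> b a w u)"
    using bilinear_map_flip[OF nu_bilinear[OF \<tau>(2), of b a]] by (simp add: ds add.commute)
  have id: "(\<lambda>y. y) \<in> mod_hom R (mmod X L d) (mmod X L d)"
    by (simp add: mod_hom_def)
  \<comment> \<open>The augmentation is treated as the contraction of a list of two entries to one,
    followed by reading off that entry; so the lemma on contractions applies to it.\<close>
  have single: "multilinear R (contract 0 (mmod X L d) (parts \<tau> ds)) (mmod X L d) (\<lambda>vs. vs ! 0)"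
    using id by (auto simp: parts contract_def multilinear_def tensor_gens_iff)
  have "multilinear R (parts \<tau> ds) (mmod X L d) (\<lambda>vs. contract 0 (nu X \<alpha> b a (vs ! (0 + 1)) (vs ! 0)) vs ! 0)"
    by (rule multilinear_contract[OF single]) (simp_all add: parts bil)
  then have "multilinear R (parts \<tau> ds) (mmod X L d)
      (\<lambda>vs. koszul_sign R a b \<odot>\<^bsub>mmod X L d\<^esub> contract 0 (nu X \<alpha> b a (vs ! (0 + 1)) (vs ! 0)) vs ! 0)"
    by (rule multilinear_comp_hom[OF _ mod_hom_smult_right[OF mmod id koszul_sign_closed[OF cring]]])
  then show ?thesis
    by (simp add: \<tau> ds contract_def)
qed

lemma bar_augmentation_hom:
  "L \<in> lobj M \<Longrightarrow> bar_augmentation R C M P X L d \<in> mod_hom R (Bar L 0 d) (mmod X L d)"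
  unfolding bar_augmentation_def using operad_module
  by (intro bar_ext_hom bar_augmentation_multilinear) (simp_all add: operad_module_def)

lemma bar_augmentation_gen:
  assumes "\<tau> \<in> towers C M L 0" "ds \<in> degree_lists 2 d" "vs \<in> tensor_gens (parts \<tau> ds)"
  shows "bar_augmentation R C M P X L d (gen L 0 d \<tau> ds vs)
    = koszul_sign R (ds ! 0) (ds ! 1) \<odot>\<^bsub>mmod X L d\<^esub> nu X (snd (snd \<tau>)) (ds ! 1) (ds ! 0) (vs ! 1) (vs ! 0)"
proof -
  have "L \<in> lobj M"
    using assms(1) lsrc_obj by (auto simp: towers_def larrs_def)
  then have mmod: "module R (mmod X L d)"
    using operad_module by (simp add: operad_module_def)
  have ds: "ds \<in> degree_lists (0 + 2) d"
    using assms(2) by (simp add: numeral_2_eq_2)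
  show ?thesis
    unfolding bar_augmentation_def
    by (rule trans[OF bar_ext_gen[OF mmod bar_augmentation_multilinear assms(1) ds assms(3)]])
      (simp_all only: case_prod_beta Let_def)
qed

end

section \<open>Maps of coefficients\<close>

locale bar_coefficients_map = bar_coefficients C M R P X + target: bar_coefficients C M R Q Y
  for C :: "('o, 'h) operadic_cat" (structure) and M :: "('o, 'h, 'l, 'a) left_operadic_mod"
    and R :: "('r, 'z) ring_scheme"
    and P :: "('o, 'h, 'r, 'v) operad_data" and X :: "('l, 'a, 'r, 'v) opmod_data"
    and Q :: "('o, 'h, 'r, 'v) operad_data" and Y :: "('l, 'a, 'r, 'v) opmod_data" +
  fixes \<theta> :: "'o \<Rightarrow> int \<Rightarrow> 'v \<Rightarrow> 'v" and \<eta> :: "'l \<Rightarrow> int \<Rightarrow> 'v \<Rightarrow> 'v"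
  assumes \<theta>_hom: "A \<in> obj C \<Longrightarrow> \<theta> A d \<in> mod_hom R (omod P A d) (omod Q A d)"
    and \<eta>_hom: "L \<in> lobj M \<Longrightarrow> \<eta> L d \<in> mod_hom R (mmod X L d) (mmod Y L d)"
begin

abbreviation coeff_homs where
  "coeff_homs \<tau> ds \<equiv> map2 (\<lambda>g e. g e) (tower_factors C M \<theta> \<eta> \<tau>) ds"

lemma coeff_homs_nth:
  assumes "\<tau> \<in> towers C M L n" "ds \<in> degree_lists (n + 2) d" "k < n + 2"
  shows "coeff_homs \<tau> ds ! k \<in> mod_hom R (parts \<tau> ds ! k) (target.parts \<tau> ds ! k)"
proof -
  obtain Ts fs \<alpha> where \<tau>: "\<tau> = (Ts, fs, \<alpha>)"
    by (metis prod_cases3)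
  note t0 = assms(1)[unfolded \<tau>]
  note t = towersD[OF t0] and f = tower_factors_nth[OF t0]
  have *: "coeff_homs \<tau> ds ! k = (tower_factors C M \<theta> \<eta> \<tau> ! k) (ds ! k)"
    using assms by (simp add: length_tower_factors degree_lists_def)
  consider "k = 0" | m where "k = Suc m" "m < n" | "k = Suc n"
    using assms(3) by (cases k) (auto simp: less_Suc_eq)
  then show ?thesis
  proof cases
    case 1
    then show ?thesis
      using \<theta>_hom[OF t(3)[of 0]] unfolding * parts_nth[OF assms] target.parts_nth[OF assms] by (simp add: \<tau> f)
  next
    case 2
    then have "fs ! m \<in> arr C"
      using t(4) by (simp add: homs_def)
    then show ?thesis
      using \<theta>_hom[OF fib_obj] 2 unfolding * parts_nth[OF assms] target.parts_nth[OF assms] by (simp add: \<tau> f)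
  next
    case 3
    have "\<alpha> \<in> larr M"
      using t(5) by (simp add: larrs_def)
    then show ?thesis
      using \<eta>_hom[OF lfib_obj] 3 unfolding * parts_nth[OF assms] target.parts_nth[OF assms] by (simp add: \<tau> f)
  qed
qed

lemma coeff_homs_closed:
  assumes "\<tau> \<in> towers C M L n" "ds \<in> degree_lists (n + 2) d" "vs \<in> tensor_gens (parts \<tau> ds)"
  shows "map2 (\<lambda>g v. g v) (coeff_homs \<tau> ds) vs \<in> tensor_gens (target.parts \<tau> ds)"
  using assms(3) mod_hom_closed[OF coeff_homs_nth[OF assms(1,2)]] assms(1,2)
  by (auto simp: tensor_gens_iff length_parts[OF assms(1,2)] target.length_parts[OF assms(1,2)]
      length_tower_factors degree_lists_def)

lemma multilinear_coeff:
  assumes "\<tau> \<in> towers C M L n" "ds \<in> degree_lists (n + 2) d"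
  shows "multilinear R (parts \<tau> ds) (target.Bar L n d)
    (\<lambda>vs. target.gen L n d \<tau> ds (map2 (\<lambda>g v. g v) (coeff_homs \<tau> ds) vs))"
proof (rule multilinear_map2[OF target.multilinear_gen[OF assms]])
  show "length (coeff_homs \<tau> ds) = length (parts \<tau> ds)"
    using assms(2) by (simp add: length_parts[OF assms] length_tower_factors[OF assms(1)] degree_lists_def)
  show "coeff_homs \<tau> ds ! k \<in> mod_hom R (parts \<tau> ds ! k) (target.parts \<tau> ds ! k)"
    if "k < length (parts \<tau> ds)" for k
    using coeff_homs_nth[OF assms] that length_parts[OF assms] by simp
qed (simp add: length_parts[OF assms] target.length_parts[OF assms])

lemma bar_coeff_map_hom:
  "bar_coeff_map R C M P X Q Y \<theta> \<eta> L n d \<in> mod_hom R (Bar L n d) (target.Bar L n d)"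
  unfolding bar_coeff_map_def by (intro bar_ext_hom target.module_bar multilinear_coeff)

lemma bar_coeff_map_gen:
  assumes "\<tau> \<in> towers C M L n" "ds \<in> degree_lists (n + 2) d" "vs \<in> tensor_gens (parts \<tau> ds)"
  shows "bar_coeff_map R C M P X Q Y \<theta> \<eta> L n d (gen L n d \<tau> ds vs)
    = target.gen L n d \<tau> ds (map2 (\<lambda>g v. g v) (coeff_homs \<tau> ds) vs)"
  unfolding bar_coeff_map_def by (rule bar_ext_gen[OF target.module_bar multilinear_coeff assms])

end

section \<open>Restriction along a morphism\<close>

context operadic_module_morphism
begin

abbreviation mtower where "mtower \<equiv> map_tower \<Phi>o \<Phi>a \<Psi>a"

lemma homs_arr: "f \<in> homs C X Y \<Longrightarrow> f \<in> arr C"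
  by (simp add: homs_def)

lemma larrs_larr: "\<alpha> \<in> larrs M L S \<Longrightarrow> \<alpha> \<in> larr M"
  by (simp add: larrs_def)

lemma map_tower_closed:
  assumes "\<tau> \<in> towers C M L n"
  shows "mtower \<tau> \<in> towers C' M' (\<Psi>o L) n"
proof -
  obtain Ts fs \<alpha> where \<tau>: "\<tau> = (Ts, fs, \<alpha>)"
    by (metis prod_cases3)
  note t = towersD[OF assms[unfolded \<tau>]]
  have "set (map \<Phi>o Ts) \<subseteq> obj C'"
    using assms \<Phi>_obj by (auto simp: \<tau> towers_def)
  then show ?thesis
    using t \<Phi>_hom \<Psi>_larr by (auto simp: \<tau> towers_def map_tower_def)
qed

text \<open>Stated for arbitrary values \<open>p\<close> and \<open>x\<close>, so that it serves for
  the lists of modules and for the lists of coefficient maps alike.\<close>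

lemma tower_factors_map_tower:
  assumes "\<tau> \<in> towers C M L n"
  shows "tower_factors C' M' p x (mtower \<tau>) = tower_factors C M (\<lambda>s. p (\<Phi>o s)) (\<lambda>m. x (\<Psi>o m)) \<tau>"
proof -
  obtain Ts fs \<alpha> where \<tau>: "\<tau> = (Ts, fs, \<alpha>)"
    by (metis prod_cases3)
  note t = towersD[OF assms[unfolded \<tau>]]
  have "Ts \<noteq> []"
    using t(1) by auto
  moreover have "fib C' (\<Phi>a f) = \<Phi>o (fib C f)" if "f \<in> set fs" for f
    using that t(2,4) \<Phi>_fib homs_arr by (metis in_set_conv_nth)
  moreover have "lfib M' (\<Psi>a \<alpha>) = \<Psi>o (lfib M \<alpha>)"
    using \<Psi>_lfib larrs_larr[OF t(5)] by simp
  ultimately show ?thesis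
    by (simp add: \<tau> tower_factors_def map_tower_def hd_map)
qed

text \<open>At an inner object this is \<open>\<Phi>_cmp\<close>, at the top
  \<open>\<Psi>_act\<close>; at the bottom nothing is composed.\<close>

lemma del_tower_map_tower:
  assumes "\<tau> \<in> towers C M L (Suc n)" "i \<le> Suc n"
  shows "del_tower C' M' i (mtower \<tau>) = mtower (del_tower C M i \<tau>)"
proof -
  obtain Ts fs \<alpha> where \<tau>: "\<tau> = (Ts, fs, \<alpha>)"
    by (metis prod_cases3)
  obtain T1 f1 \<alpha>1 T2 f2 \<alpha>2 where 1: "del_tower C M i (Ts, fs, \<alpha>) = (T1, f1, \<alpha>1)"
    and 2: "del_tower C' M' i (map \<Phi>o Ts, map \<Phi>a fs, \<Psi>a \<alpha>) = (T2, f2, \<alpha>2)"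
    by (metis prod_cases3)
  note t = towersD[OF assms(1)[unfolded \<tau>]]
  have m: "(map \<Phi>o Ts, map \<Phi>a fs, \<Psi>a \<alpha>) \<in> towers C' M' (\<Psi>o L) (Suc n)"
    using map_tower_closed[OF assms(1)] by (simp add: \<tau> map_tower_def)
  note n1 = del_tower_nth[OF assms(1)[unfolded \<tau>] assms(2) 1] and n2 = del_tower_nth[OF m assms(2) 2]
  have "T2 = map \<Phi>o T1"
    using t(1) by (intro nth_equalityI) (auto simp: n1(1,3) n2(1,3))
  moreover have "f2 = map \<Phi>a f1"
  proof (intro nth_equalityI)
    fix k assume "k < length f2"
    then have k: "k < n" by (simp add: n2(2))
    then have "\<Phi>a (fs ! k \<cdot>\<^bsub>C\<^esub> fs ! Suc k) = \<Phi>a (fs ! k) \<cdot>\<^bsub>C'\<^esub> \<Phi>a (fs ! Suc k)"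
      by (intro \<Phi>_cmp[OF t(4) t(4)]) auto
    then show "f2 ! k = map \<Phi>a f1 ! k"
      using k t(2) by (cases "i = Suc k") (simp_all add: n1(2,4) n2(4))
  qed (simp add: n1(2) n2(2))
  moreover have "\<alpha>2 = \<Psi>a \<alpha>1"
    using t(2) \<Psi>_act[OF t(5) t(4)[of n]] by (simp add: n1(5) n2(5))
  ultimately show ?thesis
    by (simp add: \<tau> map_tower_def 1 2)
qed

lemma restrict_simps:
  "omod (restrict_operad \<Phi>o \<Phi>a P) = (\<lambda>s. omod P (\<Phi>o s))" "gam (restrict_operad \<Phi>o \<Phi>a P) = (\<lambda>h. gam P (\<Phi>a h))"
  "mmod (restrict_module \<Psi>o \<Psi>a X) = (\<lambda>m. mmod X (\<Psi>o m))" "nu (restrict_module \<Psi>o \<Psi>a X) = (\<lambda>\<alpha>. nu X (\<Psi>a \<alpha>))"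
  by (simp_all add: restrict_operad_def restrict_module_def)

lemma face_op_map_tower:
  assumes "\<tau> \<in> towers C M L (Suc n)" "i \<le> Suc n"
  shows "face_op C' M' P X i (mtower \<tau>) a b u w
    = face_op C M (restrict_operad \<Phi>o \<Phi>a P) (restrict_module \<Psi>o \<Psi>a X) i \<tau> a b u w"
proof -
  obtain Ts fs \<alpha> where \<tau>: "\<tau> = (Ts, fs, \<alpha>)"
    by (metis prod_cases3)
  note t = towersD[OF assms(1)[unfolded \<tau>]]
  have len: "length (map \<Phi>a fs) = Suc n"
    using t(2) by simp
  note op = face_op_eqs[OF t(2)] face_op_eqs[OF len]
  consider "i = 0" | k where "i = Suc k" "k < n" | "i = Suc n"
    using assms(2) by (cases i) (auto simp: less_Suc_eq le_less)
  then show ?thesis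
  proof cases
    case 1
    then show ?thesis
      using t(2) by (simp add: \<tau> map_tower_def op restrict_simps)
  next
    case 2
    then show ?thesis
      using t(2) \<Phi>_ind[OF t(4)[of "Suc k"] t(4)[of k]] by (simp add: \<tau> map_tower_def op restrict_simps)
  next
    case 3
    then show ?thesis
      using t(2) \<Psi>_lind[OF t(5) t(4)[of n]] by (simp add: \<tau> map_tower_def op restrict_simps)
  qed
qed

section \<open>Restricted operads and modules\<close>

lemma operad_restrict:
  assumes "operad R C' P"
  shows "operad R C (restrict_operad \<Phi>o \<Phi>a P)"
  unfolding operad_def restrict_simps
proof (intro conjI allI ballI)
  show "module R (omod P (\<Phi>o A) d)" if "A \<in> obj C" for A d
    using assms \<Phi>_obj[OF that] by (simp add: operad_def)
  show "bilinear_map R (omod P (\<Phi>o (fib C h)) i) (omod P (\<Phi>o B) j) (omod P (\<Phi>o A) (i + j)) (gam P (\<Phi>a h) i j)"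
    if "h \<in> homs C A B" for A B h i j
    using assms \<Phi>_hom[OF that] \<Phi>_fib[OF homs_arr[OF that]] unfolding operad_def by simp
  show "gam P (\<Phi>a f) i (j + k) x (gam P (\<Phi>a g) j k y z)
      = gam P (\<Phi>a (g \<cdot>\<^bsub>C\<^esub> f)) (i + j) k (gam P (\<Phi>a (ind C f g)) i j x y) z"
    if f: "f \<in> homs C A B" and g: "g \<in> homs C B D" and "x \<in> carrier (omod P (\<Phi>o (fib C f)) i)"
      "y \<in> carrier (omod P (\<Phi>o (fib C g)) j)" "z \<in> carrier (omod P (\<Phi>o D) k)" for A B D f g i j k x y z
    \<comment> \<open>Once fibers, composites and induced maps are rewritten in terms of the images,
      this is the law over the target for the images of \<open>f\<close> and
      \<open>g\<close>.\<close>
    using assms \<Phi>_hom[OF f] \<Phi>_hom[OF g] that(3-5)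
    unfolding operad_def \<Phi>_fib[OF homs_arr[OF f]] \<Phi>_fib[OF homs_arr[OF g]] \<Phi>_cmp[OF f g] \<Phi>_ind[OF f g]
    by blast
qed

lemma operad_module_restrict:
  assumes "operad_module R C' M' P X"
  shows "operad_module R C M (restrict_operad \<Phi>o \<Phi>a P) (restrict_module \<Psi>o \<Psi>a X)"
  unfolding operad_module_def restrict_simps
proof (intro conjI allI ballI)
  show "module R (mmod X (\<Psi>o L) d)" if "L \<in> lobj M" for L d
    using assms \<Psi>_obj[OF that] by (simp add: operad_module_def)
  show "bilinear_map R (mmod X (\<Psi>o (lfib M \<alpha>)) i) (omod P (\<Phi>o S) j) (mmod X (\<Psi>o L) (i + j)) (nu X (\<Psi>a \<alpha>) i j)"
    if "\<alpha> \<in> larrs M L S" for L S \<alpha> i j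
    using assms \<Psi>_larr[OF that] \<Psi>_lfib[OF larrs_larr[OF that]] unfolding operad_module_def by simp
  show "nu X (\<Psi>a \<alpha>) i (j + k) x (gam P (\<Phi>a g) j k y z)
      = nu X (\<Psi>a (act M g \<alpha>)) (i + j) k (nu X (\<Psi>a (lind M \<alpha> g)) i j x y) z"
    if \<alpha>: "\<alpha> \<in> larrs M L B" and g: "g \<in> homs C B D" and "x \<in> carrier (mmod X (\<Psi>o (lfib M \<alpha>)) i)"
      "y \<in> carrier (omod P (\<Phi>o (fib C g)) j)" "z \<in> carrier (omod P (\<Phi>o D) k)" for L B D \<alpha> g i j k x y z
    using assms \<Psi>_larr[OF \<alpha>] \<Phi>_hom[OF g] that(3-5)
    unfolding operad_module_def \<Psi>_lfib[OF larrs_larr[OF \<alpha>]] \<Phi>_fib[OF homs_arr[OF g]] \<Psi>_act[OF \<alpha> g] \<Psi>_lind[OF \<alpha> g]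
    by blast
qed

end

text \<open>Different towers may have the same image, so this is no mere renaming of summands: the
  contributions of all towers with one image are added, which extension from the generators does by
  itself.\<close>

definition bar_map ::
  "('r, 'z) ring_scheme \<Rightarrow> ('o, 'h) operadic_cat \<Rightarrow> ('o, 'h, 'l, 'a) left_operadic_mod
    \<Rightarrow> ('o2, 'h2) operadic_cat \<Rightarrow> ('o2, 'h2, 'l2, 'a2) left_operadic_mod
    \<Rightarrow> ('o \<Rightarrow> 'o2) \<Rightarrow> ('h \<Rightarrow> 'h2) \<Rightarrow> ('l \<Rightarrow> 'l2) \<Rightarrow> ('a \<Rightarrow> 'a2)
    \<Rightarrow> ('o2, 'h2, 'r, 'v) operad_data \<Rightarrow> ('l2, 'a2, 'r, 'v) opmod_data \<Rightarrow> 'l \<Rightarrow> nat \<Rightarrow> int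
    \<Rightarrow> ('o, 'h, 'a, 'r, 'v) bar_elt \<Rightarrow> ('o2, 'h2, 'a2, 'r, 'v) bar_elt" where
  "bar_map R C M C' M' \<Phi>o \<Phi>a \<Psi>o \<Psi>a P X L n d =
     bar_ext R C M (restrict_operad \<Phi>o \<Phi>a P) (restrict_module \<Psi>o \<Psi>a X) L n d
       (bar_module R C' M' P X (\<Psi>o L) n d)
       (\<lambda>\<tau>. bar_gen R C' M' P X (\<Psi>o L) n d (map_tower \<Phi>o \<Phi>a \<Psi>a \<tau>))"

section \<open>The comparison map and its properties\<close>

locale bar_restriction = operadic_module_morphism C M C' M' \<Phi>o \<Phi>a \<Psi>o \<Psi>a + target: bar_coefficients C' M' R P X
  for R :: "('r, 'z) ring_scheme"
    and C :: "('o, 'h) operadic_cat" and M :: "('o, 'h, 'l, 'a) left_operadic_mod"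
    and C' :: "('o2, 'h2) operadic_cat" and M' :: "('o2, 'h2, 'l2, 'a2) left_operadic_mod"
    and \<Phi>o :: "'o \<Rightarrow> 'o2" and \<Phi>a :: "'h \<Rightarrow> 'h2" and \<Psi>o :: "'l \<Rightarrow> 'l2" and \<Psi>a :: "'a \<Rightarrow> 'a2"
    and P :: "('o2, 'h2, 'r, 'v) operad_data" and X :: "('l2, 'a2, 'r, 'v) opmod_data"
begin

text \<open>Supplies the bar theory at the source, in particular that the source is a
  complex.\<close>

sublocale restr: bar_coefficients C M R "restrict_operad \<Phi>o \<Phi>a P" "restrict_module \<Psi>o \<Psi>a X"
  by (intro bar_coefficients.intro bar_coefficients_axioms.intro source.left_operadic_module_axioms
      target.cring operad_restrict operad_module_restrict target.operad target.operad_module)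

abbreviation restriction where
  "restriction L n d \<equiv> bar_map R C M C' M' \<Phi>o \<Phi>a \<Psi>o \<Psi>a P X L n d"

lemma parts_map_tower:
  "\<tau> \<in> towers C M L n \<Longrightarrow> target.parts (mtower \<tau>) ds = restr.parts \<tau> ds"
  by (simp add: tower_factors_map_tower restrict_simps)

lemma multilinear_restriction:
  assumes "\<tau> \<in> towers C M L n" "ds \<in> degree_lists (n + 2) d"
  shows "multilinear R (restr.parts \<tau> ds) (target.Bar (\<Psi>o L) n d) (target.gen (\<Psi>o L) n d (mtower \<tau>) ds)"
  using target.multilinear_gen[OF map_tower_closed[OF assms(1)] assms(2)] unfolding parts_map_tower[OF assms(1)] .

lemma restriction_hom: "restriction L n d \<in> mod_hom R (restr.Bar L n d) (target.Bar (\<Psi>o L) n d)"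
  unfolding bar_map_def by (intro restr.bar_ext_hom target.module_bar multilinear_restriction)

lemma restriction_gen:
  assumes "\<tau> \<in> towers C M L n" "ds \<in> degree_lists (n + 2) d" "vs \<in> tensor_gens (restr.parts \<tau> ds)"
  shows "restriction L n d (restr.gen L n d \<tau> ds vs) = target.gen (\<Psi>o L) n d (mtower \<tau>) ds vs"
  unfolding bar_map_def by (rule restr.bar_ext_gen[OF target.module_bar multilinear_restriction assms])

text \<open>On a generator, the sign and the merged degrees depend on \<open>ds\<close> alone and so
  agree; the towers agree by \<open>del_tower_map_tower\<close> and the merged factors by
  \<open>face_op_map_tower\<close>.\<close>

lemma restriction_face:
  assumes i: "i \<le> Suc n" and x: "x \<in> carrier (restr.Bar L (Suc n) d)"
  shows "restriction L n d (restr.face L (Suc n) d i x) = target.face (\<Psi>o L) (Suc n) d i (restriction L (Suc n) d x)"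
proof (rule restr.bar_hom_eqI[OF target.module_bar mod_hom_comp[OF restriction_hom restr.face_hom[OF i]]
      mod_hom_comp[OF target.face_hom[OF i] restriction_hom] _ x])
  fix \<tau> ds vs
  assume \<tau>: "\<tau> \<in> towers C M L (Suc n)" and ds: "ds \<in> degree_lists (Suc n + 2) d"
    and vs: "vs \<in> tensor_gens (restr.parts \<tau> ds)"
  have vs': "vs \<in> tensor_gens (target.parts (mtower \<tau>) ds)"
    using vs by (simp only: parts_map_tower[OF \<tau>])
  note \<tau>' = source.del_tower_closed[OF \<tau> i] and ds' = restr.face_degrees_closed[OF ds i]
    and fv = restr.face_factors_closed[OF \<tau> ds i vs]
  show "restriction L n d (restr.face L (Suc n) d i (restr.gen L (Suc n) d \<tau> ds vs))
      = target.face (\<Psi>o L) (Suc n) d i (restriction L (Suc n) d (restr.gen L (Suc n) d \<tau> ds vs))"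
    unfolding restriction_gen[OF \<tau> ds vs] restr.face_gen[OF \<tau> ds i vs]
      target.face_gen[OF map_tower_closed[OF \<tau>] ds i vs'] del_tower_map_tower[OF \<tau> i]
      face_op_map_tower[OF \<tau> i]
      mod_hom_smult[OF restriction_hom koszul_sign_closed[OF target.cring] restr.gen_closed[OF \<tau>' ds' fv]]
      restriction_gen[OF \<tau>' ds' fv] ..
qed

lemma chain_map_restriction:
  "chain_map R (bar_complex R C M (restrict_operad \<Phi>o \<Phi>a P) (restrict_module \<Psi>o \<Psi>a X) L)
    (bar_complex R C' M' P X (\<Psi>o L)) (restriction L)"
  unfolding chain_map_def
proof (intro conjI allI ballI restr.chain_complex_bar target.chain_complex_bar)
  show "restriction L n d \<in> mod_hom R
      (chains (bar_complex R C M (restrict_operad \<Phi>o \<Phi>a P) (restrict_module \<Psi>o \<Psi>a X) L) n d)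
      (chains (bar_complex R C' M' P X (\<Psi>o L)) n d)" for n d
    using restriction_hom by (simp add: bar_complex_def)
  fix n d x
  assume "x \<in> carrier (chains (bar_complex R C M (restrict_operad \<Phi>o \<Phi>a P) (restrict_module \<Psi>o \<Psi>a X) L) (Suc n) d)"
  then have x: "x \<in> carrier (restr.Bar L (Suc n) d)"
    by (simp add: bar_complex_def)
  interpret B: module R "target.Bar (\<Psi>o L) n d" by (rule target.module_bar)
  let ?s = "minus_one_power R"
  have s: "?s i \<in> carrier R" for i
    by (rule minus_one_power_closed[OF target.cring])
  have f: "restr.face L (Suc n) d i x \<in> carrier (restr.Bar L n d)" if "i \<le> Suc n" for i
    by (rule mod_hom_closed[OF restr.face_hom[OF that] x])
  have y: "restriction L (Suc n) d x \<in> carrier (target.Bar (\<Psi>o L) (Suc n) d)"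
    by (rule mod_hom_closed[OF restriction_hom x])
  have sf: "?s i \<odot>\<^bsub>restr.Bar L n d\<^esub> restr.face L (Suc n) d i x \<in> carrier (restr.Bar L n d)" if "i \<le> Suc n" for i
    by (rule mod_hom_closed[OF restr.signed_face_hom[OF that] x])
  \<comment> \<open>By linearity the alternating sum passes through the map, and then the faces
    correspond one by one.\<close>
  have "restriction L n d (\<Oplus>\<^bsub>restr.Bar L n d\<^esub> i\<in>{..Suc n}. ?s i \<odot>\<^bsub>restr.Bar L n d\<^esub> restr.face L (Suc n) d i x)
      = (\<Oplus>\<^bsub>target.Bar (\<Psi>o L) n d\<^esub> i\<in>{..Suc n}. restriction L n d (?s i \<odot>\<^bsub>restr.Bar L n d\<^esub> restr.face L (Suc n) d i x))"
    by (rule mod_hom_finsum[OF restr.module_bar target.module_bar restriction_hom]) (simp add: sf)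
  also have "\<dots> = (\<Oplus>\<^bsub>target.Bar (\<Psi>o L) n d\<^esub> i\<in>{..Suc n}.
      ?s i \<odot>\<^bsub>target.Bar (\<Psi>o L) n d\<^esub> target.face (\<Psi>o L) (Suc n) d i (restriction L (Suc n) d x))"
    using mod_hom_closed[OF target.signed_face_hom y]
    by (intro B.M.finsum_cong') (auto simp: mod_hom_smult[OF restriction_hom s f] restriction_face[OF _ x])
  finally show "restriction L n d (bdry (bar_complex R C M (restrict_operad \<Phi>o \<Phi>a P) (restrict_module \<Psi>o \<Psi>a X) L) (Suc n) d x)
      = bdry (bar_complex R C' M' P X (\<Psi>o L)) (Suc n) d (restriction L (Suc n) d x)"
    unfolding restr.bdry_bar target.bdry_bar .
qed

lemma restriction_augmentation:
  assumes L: "L \<in> lobj M" and z: "z \<in> carrier (restr.Bar L 0 d)"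
  shows "bar_augmentation R C' M' P X (\<Psi>o L) d (restriction L 0 d z)
    = bar_augmentation R C M (restrict_operad \<Phi>o \<Phi>a P) (restrict_module \<Psi>o \<Psi>a X) L d z"
proof (rule restr.bar_hom_eqI[OF _ mod_hom_comp[OF target.bar_augmentation_hom[OF \<Psi>_obj[OF L]] restriction_hom]
      restr.bar_augmentation_hom[OF L, unfolded restrict_simps] _ z])
  show "module R (mmod X (\<Psi>o L) d)"
    using target.operad_module \<Psi>_obj[OF L] by (simp add: operad_module_def)
  fix \<tau> ds vs
  assume \<tau>: "\<tau> \<in> towers C M L 0" and ds: "ds \<in> degree_lists (0 + 2) d" and vs: "vs \<in> tensor_gens (restr.parts \<tau> ds)"
  have vs': "vs \<in> tensor_gens (target.parts (mtower \<tau>) ds)"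
    using vs by (simp only: parts_map_tower[OF \<tau>])
  have ds': "ds \<in> degree_lists 2 d"
    using ds by (simp add: numeral_2_eq_2)
  \<comment> \<open>The restricted operation at an arrow is by definition the given operation at the
    image of that arrow.\<close>
  show "bar_augmentation R C' M' P X (\<Psi>o L) d (restriction L 0 d (restr.gen L 0 d \<tau> ds vs))
      = bar_augmentation R C M (restrict_operad \<Phi>o \<Phi>a P) (restrict_module \<Psi>o \<Psi>a X) L d (restr.gen L 0 d \<tau> ds vs)"
    unfolding restriction_gen[OF \<tau> ds vs] restr.bar_augmentation_gen[OF \<tau> ds' vs]
      target.bar_augmentation_gen[OF map_tower_closed[OF \<tau>] ds' vs']
    by (simp add: restrict_simps map_tower_def case_prod_beta)
qed

end

text \<open>Both composites apply \<theta> and \<eta> to the factors and move the tower to its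
  image. Two pairs of coefficients occur, hence two interpretations of the comparison
  locale.\<close>

lemma (in operadic_module_morphism) restriction_natural:
  assumes "bar_restriction R C M C' M' \<Phi>o \<Phi>a \<Psi>o \<Psi>a P X"
    and "bar_restriction R C M C' M' \<Phi>o \<Phi>a \<Psi>o \<Psi>a Q Y"
    and maps: "operad_map R C' P Q \<theta>" "operad_module_map R M' P X Y \<theta> \<eta>"
    and z: "z \<in> carrier (bar_module R C M (restrict_operad \<Phi>o \<Phi>a P) (restrict_module \<Psi>o \<Psi>a X) L n d)"
  shows "bar_coeff_map R C' M' P X Q Y \<theta> \<eta> (\<Psi>o L) n d
      (bar_map R C M C' M' \<Phi>o \<Phi>a \<Psi>o \<Psi>a P X L n d z)
    = bar_map R C M C' M' \<Phi>o \<Phi>a \<Psi>o \<Psi>a Q Y L n d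
      (bar_coeff_map R C M (restrict_operad \<Phi>o \<Phi>a P) (restrict_module \<Psi>o \<Psi>a X)
        (restrict_operad \<Phi>o \<Phi>a Q) (restrict_module \<Psi>o \<Psi>a Y) (\<lambda>s. \<theta> (\<Phi>o s)) (\<lambda>m. \<eta> (\<Psi>o m)) L n d z)"
proof -
  interpret P: bar_restriction R C M C' M' \<Phi>o \<Phi>a \<Psi>o \<Psi>a P X by fact
  interpret Q: bar_restriction R C M C' M' \<Phi>o \<Phi>a \<Psi>o \<Psi>a Q Y by fact
  have hom: "\<theta> A e \<in> mod_hom R (omod P A e) (omod Q A e)" if "A \<in> obj C'" for A e
    using maps(1) that by (simp add: operad_map_def)
  have hom': "\<eta> K e \<in> mod_hom R (mmod X K e) (mmod Y K e)" if "K \<in> lobj M'" for K e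
    using maps(2) that by (simp add: operad_module_map_def)
  interpret T: bar_coefficients_map C' M' R P X Q Y \<theta> \<eta>
    by unfold_locales (simp_all add: hom hom')
  \<comment> \<open>Over the source the coefficient maps are precomposed with the maps on objects,
    as the modules are.\<close>
  interpret S: bar_coefficients_map C M R "restrict_operad \<Phi>o \<Phi>a P" "restrict_module \<Psi>o \<Psi>a X"
    "restrict_operad \<Phi>o \<Phi>a Q" "restrict_module \<Psi>o \<Psi>a Y" "\<lambda>s. \<theta> (\<Phi>o s)" "\<lambda>m. \<eta> (\<Psi>o m)"
    by unfold_locales (simp_all add: restrict_simps hom hom' \<Phi>_obj \<Psi>_obj)
  show ?thesis
  proof (rule P.restr.bar_hom_eqI[OF Q.target.module_bar mod_hom_comp[OF T.bar_coeff_map_hom P.restriction_hom]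
        mod_hom_comp[OF Q.restriction_hom S.bar_coeff_map_hom] _ z])
    fix \<tau> ds vs
    assume \<tau>: "\<tau> \<in> towers C M L n" and ds: "ds \<in> degree_lists (n + 2) d"
      and vs: "vs \<in> tensor_gens (P.restr.parts \<tau> ds)"
    have vs': "vs \<in> tensor_gens (P.target.parts (mtower \<tau>) ds)"
      using vs by (simp only: P.parts_map_tower[OF \<tau>])
    show "bar_coeff_map R C' M' P X Q Y \<theta> \<eta> (\<Psi>o L) n d (P.restriction L n d (P.restr.gen L n d \<tau> ds vs))
      = Q.restriction L n d
          (bar_coeff_map R C M (restrict_operad \<Phi>o \<Phi>a P) (restrict_module \<Psi>o \<Psi>a X)
            (restrict_operad \<Phi>o \<Phi>a Q) (restrict_module \<Psi>o \<Psi>a Y) (\<lambda>s. \<theta> (\<Phi>o s)) (\<lambda>m. \<eta> (\<Psi>o m)) L n d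
            (P.restr.gen L n d \<tau> ds vs))"
      unfolding P.restriction_gen[OF \<tau> ds vs] S.bar_coeff_map_gen[OF \<tau> ds vs]
        T.bar_coeff_map_gen[OF map_tower_closed[OF \<tau>] ds vs']
        Q.restriction_gen[OF \<tau> ds S.coeff_homs_closed[OF \<tau> ds vs]] tower_factors_map_tower[OF \<tau>] ..
  qed
qed

text \<open>\<beta> is quantified before the coefficients because naturality compares its values at
  two pairs of them. Together with linearity, the formula on generators determines it on the
  carriers.\<close>

theorem proposition82:
  fixes R :: "('r, 'z) ring_scheme"
    and C' :: "('o1, 'h1) operadic_cat" and M' :: "('o1, 'h1, 'l1, 'a1) left_operadic_mod"
    and C'' :: "('o2, 'h2) operadic_cat" and M'' :: "('o2, 'h2, 'l2, 'a2) left_operadic_mod"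
    and \<Phi>o :: "'o1 \<Rightarrow> 'o2" and \<Phi>a :: "'h1 \<Rightarrow> 'h2"
    and \<Psi>o :: "'l1 \<Rightarrow> 'l2" and \<Psi>a :: "'a1 \<Rightarrow> 'a2"
  assumes "cring R"
    and "operadic_module_morphism C' M' C'' M'' \<Phi>o \<Phi>a \<Psi>o \<Psi>a"
  defines "\<Phi>_res \<equiv> restrict_operad \<Phi>o \<Phi>a"
    and "\<Psi>_res \<equiv> restrict_module \<Psi>o \<Psi>a"
  shows "\<exists>\<beta> :: ('o2, 'h2, 'r, 'v) operad_data \<Rightarrow> ('l2, 'a2, 'r, 'v) opmod_data \<Rightarrow> 'l1
          \<Rightarrow> nat \<Rightarrow> int \<Rightarrow> ('o1, 'h1, 'a1, 'r, 'v) bar_elt \<Rightarrow> ('o2, 'h2, 'a2, 'r, 'v) bar_elt.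
    (\<forall>P X. operad R C'' P \<and> operad_module R C'' M'' P X \<longrightarrow>
       (\<forall>L\<in>lobj M'.
          chain_map R (bar_complex R C' M' (\<Phi>_res P) (\<Psi>_res X) L)
            (bar_complex R C'' M'' P X (\<Psi>o L)) (\<beta> P X L) \<and>
          (\<forall>d. \<forall>z\<in>carrier (bar_module R C' M' (\<Phi>_res P) (\<Psi>_res X) L 0 d).
             bar_augmentation R C'' M'' P X (\<Psi>o L) d (\<beta> P X L 0 d z)
               = bar_augmentation R C' M' (\<Phi>_res P) (\<Psi>_res X) L d z) \<and>
          (\<forall>n d. \<forall>\<tau>\<in>towers C' M' L n. \<forall>ds\<in>degree_lists (n + 2) d.
             \<forall>vs\<in>tensor_gens (homog_parts (bar_factors C' M' (\<Phi>_res P) (\<Psi>_res X) \<tau>) ds).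
               \<beta> P X L n d (bar_gen R C' M' (\<Phi>_res P) (\<Psi>_res X) L n d \<tau> ds vs)
                 = bar_gen R C'' M'' P X (\<Psi>o L) n d (map_tower \<Phi>o \<Phi>a \<Psi>a \<tau>) ds vs))) \<and>
    (\<forall>P X Q Y \<theta> \<eta>.
       operad R C'' P \<and> operad_module R C'' M'' P X \<and>
       operad R C'' Q \<and> operad_module R C'' M'' Q Y \<and>
       operad_map R C'' P Q \<theta> \<and> operad_module_map R M'' P X Y \<theta> \<eta> \<longrightarrow>
       (\<forall>L\<in>lobj M'. \<forall>n d. \<forall>z\<in>carrier (bar_module R C' M' (\<Phi>_res P) (\<Psi>_res X) L n d).
          bar_coeff_map R C'' M'' P X Q Y \<theta> \<eta> (\<Psi>o L) n d (\<beta> P X L n d z)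
            = \<beta> Q Y L n d
                (bar_coeff_map R C' M' (\<Phi>_res P) (\<Psi>_res X) (\<Phi>_res Q) (\<Psi>_res Y)
                   (\<lambda>s. \<theta> (\<Phi>o s)) (\<lambda>m. \<eta> (\<Psi>o m)) L n d z)))"
proof -
  interpret operadic_module_morphism C' M' C'' M'' \<Phi>o \<Phi>a \<Psi>o \<Psi>a by fact
  have restriction: "bar_restriction R C' M' C'' M'' \<Phi>o \<Phi>a \<Psi>o \<Psi>a P X"
    if "operad R C'' P" "operad_module R C'' M'' P X"
    for P :: "('o2, 'h2, 'r, 'v) operad_data" and X :: "('l2, 'a2, 'r, 'v) opmod_data"
    using that \<open>cring R\<close>
    by (intro bar_restriction.intro bar_coefficients.intro bar_coefficients_axioms.intro
        operadic_module_morphism_axioms target.left_operadic_module_axioms)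
  show ?thesis
    unfolding \<Phi>_res_def \<Psi>_res_def
  proof (intro exI[of _ "bar_map R C' M' C'' M'' \<Phi>o \<Phi>a \<Psi>o \<Psi>a"] conjI allI impI ballI; elim conjE)
    fix P :: "('o2, 'h2, 'r, 'v) operad_data" and X :: "('l2, 'a2, 'r, 'v) opmod_data"
      and L n d z
    assume "operad R C'' P" "operad_module R C'' M'' P X"
    then interpret bar_restriction R C' M' C'' M'' \<Phi>o \<Phi>a \<Psi>o \<Psi>a P X
      by (rule restriction)
    show "chain_map R (bar_complex R C' M' (restrict_operad \<Phi>o \<Phi>a P) (restrict_module \<Psi>o \<Psi>a X) L)
        (bar_complex R C'' M'' P X (\<Psi>o L)) (restriction L)"
      by (rule chain_map_restriction)
    show "bar_augmentation R C'' M'' P X (\<Psi>o L) d (restriction L 0 d z)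
        = bar_augmentation R C' M' (restrict_operad \<Phi>o \<Phi>a P) (restrict_module \<Psi>o \<Psi>a X) L d z"
      if "L \<in> lobj M'" "z \<in> carrier (restr.Bar L 0 d)"
      by (rule restriction_augmentation[OF that])
    show "restriction L n d (restr.gen L n d \<tau> ds vs) = target.gen (\<Psi>o L) n d (mtower \<tau>) ds vs"
      if "\<tau> \<in> towers C' M' L n" "ds \<in> degree_lists (n + 2) d" "vs \<in> tensor_gens (restr.parts \<tau> ds)" for \<tau> ds vs
      by (rule restriction_gen[OF that])
  next
    fix P Q :: "('o2, 'h2, 'r, 'v) operad_data" and X Y :: "('l2, 'a2, 'r, 'v) opmod_data"
      and \<theta> \<eta> L n d z
    assume "operad R C'' P" "operad_module R C'' M'' P X" "operad R C'' Q" "operad_module R C'' M'' Q Y"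
      and "operad_map R C'' P Q \<theta>" "operad_module_map R M'' P X Y \<theta> \<eta>"
      and "z \<in> carrier (bar_module R C' M' (restrict_operad \<Phi>o \<Phi>a P) (restrict_module \<Psi>o \<Psi>a X) L n d)"
    then show "bar_coeff_map R C'' M'' P X Q Y \<theta> \<eta> (\<Psi>o L) n d (bar_map R C' M' C'' M'' \<Phi>o \<Phi>a \<Psi>o \<Psi>a P X L n d z)
      = bar_map R C' M' C'' M'' \<Phi>o \<Phi>a \<Psi>o \<Psi>a Q Y L n d
          (bar_coeff_map R C' M' (restrict_operad \<Phi>o \<Phi>a P) (restrict_module \<Psi>o \<Psi>a X)
            (restrict_operad \<Phi>o \<Phi>a Q) (restrict_module \<Psi>o \<Psi>a Y) (\<lambda>s. \<theta> (\<Phi>o s)) (\<lambda>m. \<eta> (\<Psi>o m)) L n d z)"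
      by (intro restriction_natural restriction)
  qed
qed

end
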